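(* Let $p$ be a prime and let $C_1,\ldots,C_r$ be cyclic $p$-groups generated by $x_1,\ldots,x_r$ respectively, of orders $1<p^{\alpha_1}\leq\cdots\leq p^{\alpha_r}$. Let $G=C_1\amalg^{\mathfrak{N}_{p+1}}\cdots\amalg^{\mathfrak{N}_{p+1}} C_r$ be their $(p+1)$-nilpotent product. Then the center of $G$ is $Z(G)=\langle x_r^{p^{\alpha_{r-1}+1}},\,G_{p+1}\rangle$.
   Context: For groups $C_1,\dots,C_r$ and a positive integer $k$, the $k$-nilpotent product $C_1\amalg^{\mathfrak{N}_k}\cdots\amalg^{\mathfrak{N}_k}C_r$ is the quotient $F/\gamma_{k+1}(F)$ of the free product $F=C_1*\cdots*C_r$ by the $(k+1)$-st term of its lower central series. For a group $G$, $G_i$ denotes the $i$-th term of the lower central series: $G_1=G$, $G_{i+1}=[G_i,G]$. Commutators are $[a,b]=a^{-1}b^{-1}ab$. *)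

theory Defs
  imports "HOL-Algebra.Algebra" "HOL-Computational_Algebra.Primes"
begin

text \<open>A letter (i, True) stands for the generator x_i, (i, False) for its inverse.\<close>

type_synonym word = "(nat \<times> bool) list"

definition inv_letter :: "nat \<times> bool \<Rightarrow> nat \<times> bool" where
  "inv_letter a = (fst a, \<not> snd a)"

fun push_letter :: "nat \<times> bool \<Rightarrow> word \<Rightarrow> word" where
  "push_letter a [] = [a]"
| "push_letter a (b # w) = (if b = inv_letter a then w else a # b # w)"

fun reduced :: "word \<Rightarrow> bool" where
  "reduced [] = True"
| "reduced [a] = True"
| "reduced (a # b # w) = (b \<noteq> inv_letter a \<and> reduced (b # w))"

definition free_group :: "nat set \<Rightarrow> word monoid" where
  "free_group I = \<lparr> carrier = {w. set w \<subseteq> I \<times> UNIV \<and> reduced w},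
                    monoid.mult = (\<lambda>u v. foldr push_letter u v),
                    one = [] \<rparr>"

definition free_gen :: "nat \<Rightarrow> word" where
  "free_gen i = [(i, True)]"

definition normal_closure :: "('a, 'b) monoid_scheme \<Rightarrow> 'a set \<Rightarrow> 'a set" where
  "normal_closure G S =
     generate G {g \<otimes>\<^bsub>G\<^esub> s \<otimes>\<^bsub>G\<^esub> inv\<^bsub>G\<^esub> g | g s. g \<in> carrier G \<and> s \<in> S}"

definition gcomm :: "('a, 'b) monoid_scheme \<Rightarrow> 'a \<Rightarrow> 'a \<Rightarrow> 'a" where
  "gcomm G a b = inv\<^bsub>G\<^esub> a \<otimes>\<^bsub>G\<^esub> inv\<^bsub>G\<^esub> b \<otimes>\<^bsub>G\<^esub> a \<otimes>\<^bsub>G\<^esub> b"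

text \<open>Lower central series, 1-indexed: lcs G 1 = G, lcs G (i+1) = [lcs G i, G].
  (lcs G 0 is set to G as a harmless convention.)\<close>
fun lcs :: "('a, 'b) monoid_scheme \<Rightarrow> nat \<Rightarrow> 'a set" where
  "lcs G 0 = carrier G"
| "lcs G (Suc 0) = carrier G"
| "lcs G (Suc (Suc n)) =
     generate G {gcomm G a b | a b. a \<in> lcs G (Suc n) \<and> b \<in> carrier G}"

definition center :: "('a, 'b) monoid_scheme \<Rightarrow> 'a set" where
  "center G = {z \<in> carrier G. \<forall>g \<in> carrier G. z \<otimes>\<^bsub>G\<^esub> g = g \<otimes>\<^bsub>G\<^esub> z}"

text \<open>Free product C_1 * ... * C_r of cyclic groups C_i = <x_i> of order ords i,
  realised as the free group on x_1..x_r modulo the normal closure of the x_i^(ords i).\<close>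
definition cyc_relators :: "(nat \<Rightarrow> nat) \<Rightarrow> nat \<Rightarrow> word set" where
  "cyc_relators ords r = {free_gen i [^]\<^bsub>free_group {1..r}\<^esub> ords i | i. i \<in> {1..r}}"

definition cyc_free_product :: "(nat \<Rightarrow> nat) \<Rightarrow> nat \<Rightarrow> word set monoid" where
  "cyc_free_product ords r =
     free_group {1..r} Mod normal_closure (free_group {1..r}) (cyc_relators ords r)"

definition cyc_free_product_gen :: "(nat \<Rightarrow> nat) \<Rightarrow> nat \<Rightarrow> nat \<Rightarrow> word set" where
  "cyc_free_product_gen ords r i =
     r_coset (free_group {1..r}) (normal_closure (free_group {1..r}) (cyc_relators ords r))
       (free_gen i)"

definition cyc_nil_product :: "(nat \<Rightarrow> nat) \<Rightarrow> nat \<Rightarrow> nat \<Rightarrow> word set set monoid" where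
  "cyc_nil_product ords r k =
     cyc_free_product ords r Mod lcs (cyc_free_product ords r) (k + 1)"

definition cyc_nil_gen :: "(nat \<Rightarrow> nat) \<Rightarrow> nat \<Rightarrow> nat \<Rightarrow> nat \<Rightarrow> word set set" where
  "cyc_nil_gen ords r k i =
     r_coset (cyc_free_product ords r) (lcs (cyc_free_product ords r) (k + 1))
       (cyc_free_product_gen ords r i)"

end

theory Submission
  imports Defs "HOL-Library.Multiset"
begin

text \<open>
  Let \<open>G\<close> be the nilpotent product and \<open>F\<close> the free group mapping onto it.

  That the power of \<open>x r\<close> is central comes from polynomial sequences. If \<open>y\<close> has order dividing
  \<open>p ^ b\<close>, then \<open>n \<mapsto> [y, x ^ n]\<close> is a product of powers \<open>h_i ^ (n choose i)\<close> with \<open>h_i\<close> in the term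
  \<open>i + 1\<close> of the lower central series of \<open>\<langle>x, y\<rangle>\<close>. Expanding commutators with one entry \<open>y ^ n\<close> in
  the same way shows that this term has exponent \<open>p ^ b\<close> for \<open>i \<ge> 2\<close> and \<open>p ^ (b + 1)\<close> for \<open>i = 1\<close>, so
  that all factors vanish at \<open>n = p ^ (b + 1)\<close>.

  Conversely, if \<open>f\<close> in \<open>F\<close> maps to a central element, then its Magnus series commutes with every
  \<open>X_j\<close> modulo each ideal containing the series of order at least \<open>p + 2\<close> and the
  \<open>(1 + X_i) ^ (p ^ \<alpha> i) - 1\<close>. Suitable ideals give congruences for the coefficients of \<open>f\<close>. In degree
  one these say that \<open>f\<close> is a power of \<open>x r\<close> of the required kind modulo commutators. If \<open>f\<close> lies in
  the term \<open>w\<close> of the lower central series with \<open>2 \<le> w \<le> p\<close>, they say that the coefficient at a word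
  \<open>u\<close> of length \<open>w\<close> with at least two different letters is divisible by the least order of a
  generator in \<open>u\<close>. A Dynkin operator recovers from these coefficients the multidegree components of
  \<open>f\<close>, each multiplied by the multiplicity of a letter, which is prime to \<open>p\<close>; hence \<open>f\<close> lies in the
  term \<open>w + 1\<close> up to relators.
\<close>

section \<open>The lower central series\<close>

text \<open>The extra \<open>1\<close> in the exponent \<open>\<alpha> (r - 1) + 1\<close> has one
  source on both sides. The binomial coefficient of \<open>p ^ b\<close> over \<open>i\<close> is
  divisible by \<open>p ^ b\<close> for \<open>0 < i < p\<close>, but at \<open>i = p\<close> a
  factor \<open>p\<close> is lost, and class \<open>p + 1\<close> is just large enough for the index
  \<open>p\<close> to occur. In the converse direction the exponent sum \<open>e\<close> of
  \<open>x r\<close> enters through the coefficient at \<open>p\<close> copies of \<open>r\<close>,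
  the binomial coefficient of \<open>e\<close> over \<open>p\<close>; if \<open>p\<close> divides
  \<open>e\<close>, divisibility of this coefficient by \<open>p ^ a\<close> forces
  \<open>p ^ (a + 1)\<close> to divide \<open>e\<close>. No normal form by basic commutators is
  used. Magnus coefficients give necessary congruences, torsion of brackets modulo the next term
  shows that they suffice, and the Dynkin operator connects the two. The moduli depend on the
  letters that occur, so it has to be applied in each multidegree separately.\<close>

context group
begin

lemma inv_mult_cancel [simp]:
  "x \<in> carrier G \<Longrightarrow> y \<in> carrier G \<Longrightarrow> inv x \<otimes> (x \<otimes> y) = y"
  "x \<in> carrier G \<Longrightarrow> y \<in> carrier G \<Longrightarrow> x \<otimes> (inv x \<otimes> y) = y"
  by (simp_all flip: m_assoc)

lemmas word_simps = m_assoc inv_mult_group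

lemma gcomm_closed [simp, intro]:
  "a \<in> carrier G \<Longrightarrow> b \<in> carrier G \<Longrightarrow> gcomm G a b \<in> carrier G"
  by (simp add: gcomm_def)

lemma inv_gcomm:
  "a \<in> carrier G \<Longrightarrow> b \<in> carrier G \<Longrightarrow> inv (gcomm G a b) = gcomm G b a"
  by (simp add: gcomm_def word_simps)

lemma gcomm_one [simp]:
  "a \<in> carrier G \<Longrightarrow> gcomm G a \<one> = \<one>" "a \<in> carrier G \<Longrightarrow> gcomm G \<one> a = \<one>"
  by (simp_all add: gcomm_def word_simps)

lemma gcomm_self [simp]: "a \<in> carrier G \<Longrightarrow> gcomm G a a = \<one>"
  by (simp add: gcomm_def word_simps)

lemma gcomm_eq_one_iff:
  assumes "a \<in> carrier G" "b \<in> carrier G"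
  shows "gcomm G a b = \<one> \<longleftrightarrow> a \<otimes> b = b \<otimes> a"
proof -
  have "gcomm G a b = inv (b \<otimes> a) \<otimes> (a \<otimes> b)"
    using assms by (simp add: gcomm_def word_simps)
  then show ?thesis
    using assms by (metis inv_closed inv_equality inv_inv m_closed l_inv)
qed

lemma gcomm_mult_left:
  assumes "a \<in> carrier G" "b \<in> carrier G" "c \<in> carrier G"
  shows "gcomm G (a \<otimes> b) c = gcomm G a c \<otimes> gcomm G (gcomm G a c) b \<otimes> gcomm G b c"
  using assms by (simp add: gcomm_def word_simps)

lemma gcomm_mult_right:
  assumes "a \<in> carrier G" "b \<in> carrier G" "c \<in> carrier G"
  shows "gcomm G a (b \<otimes> c) = gcomm G a c \<otimes> gcomm G a b \<otimes> gcomm G (gcomm G a b) c"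
  using assms by (simp add: gcomm_def word_simps)

lemma conj_eq_mult_gcomm:
  assumes "a \<in> carrier G" "b \<in> carrier G"
  shows "inv b \<otimes> a \<otimes> b = a \<otimes> gcomm G a b"
  using assms by (simp add: gcomm_def word_simps)

text \<open>The Hall-Witt identity. The conjugate of \<open>c\<close> by \<open>a\<close> is spelled
  \<open>c \<otimes> gcomm G c a\<close>, so that each entry can be placed in a term of the lower
  central series by closure under products.\<close>

lemma hall_witt:
  assumes "a \<in> carrier G" "b \<in> carrier G" "c \<in> carrier G"
  shows "gcomm G (gcomm G a b) (c \<otimes> gcomm G c a) \<otimes> gcomm G (gcomm G c a) (b \<otimes> gcomm G b c)
     \<otimes> gcomm G (gcomm G b c) (a \<otimes> gcomm G a b) = \<one>"
  using assms by (simp add: gcomm_def word_simps)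

lemma normal_gcomm_left:
  assumes "N \<lhd> G" "a \<in> N" "b \<in> carrier G"
  shows "gcomm G a b \<in> N"
proof -
  interpret normal N G by fact
  have "gcomm G a b = inv a \<otimes> (inv b \<otimes> a \<otimes> b)"
    using assms by (simp add: gcomm_def word_simps subset[THEN subsetD])
  then show ?thesis
    using assms inv_op_closed1 by auto
qed

lemma normal_gcomm_right:
  assumes "N \<lhd> G" "a \<in> N" "b \<in> carrier G"
  shows "gcomm G b a \<in> N"
proof -
  interpret normal N G by fact
  show ?thesis
    using normal_gcomm_left[OF assms] inv_gcomm[of a b] assms(2,3) subset m_inv_closed
    by (metis subsetD)
qed

lemma lcs_normal: "lcs G k \<lhd> G"
proof (induction k)
  case 0
  show ?case by (simp add: normal_self)
next
  case (Suc k)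
  show ?case
  proof (cases k)
    case 0
    then show ?thesis by (simp add: normal_self)
  next
    case (Suc n)
    let ?S = "{gcomm G a b | a b. a \<in> lcs G (Suc n) \<and> b \<in> carrier G}"
    interpret N: normal "lcs G (Suc n)" G
      using Suc.IH Suc by simp
    have "generate G ?S \<lhd> G"
    proof (rule normal_generateI)
      show "?S \<subseteq> carrier G"
        using N.subset by auto
    next
      fix h g assume h: "h \<in> ?S" and g: "g \<in> carrier G"
      then obtain a b where ab: "h = gcomm G a b" "a \<in> lcs G (Suc n)" "b \<in> carrier G"
        by blast
      then have a: "a \<in> carrier G" using N.subset by blast
      have "g \<otimes> h \<otimes> inv g = gcomm G (g \<otimes> a \<otimes> inv g) (g \<otimes> b \<otimes> inv g)"
        using a ab g by (simp add: gcomm_def word_simps)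
      then show "g \<otimes> h \<otimes> inv g \<in> ?S"
        using N.inv_op_closed2 ab g by blast
    qed
    then show ?thesis using Suc by simp
  qed
qed

lemma lcs_subgroup: "subgroup (lcs G k) G"
  using lcs_normal normal_imp_subgroup by blast

lemma lcs_carrier [simp]: "a \<in> lcs G k \<Longrightarrow> a \<in> carrier G"
  using lcs_subgroup subgroup.subset by blast

lemma lcs_one [simp]: "\<one> \<in> lcs G k"
  by (rule subgroup.one_closed[OF lcs_subgroup])

lemma lcs_mult [simp]: "a \<in> lcs G k \<Longrightarrow> b \<in> lcs G k \<Longrightarrow> a \<otimes> b \<in> lcs G k"
  by (rule subgroup.m_closed[OF lcs_subgroup])

lemma lcs_inv [simp]: "a \<in> lcs G k \<Longrightarrow> inv a \<in> lcs G k"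
  by (rule subgroup.m_inv_closed[OF lcs_subgroup])

lemma lcs_pow [simp]: "a \<in> lcs G k \<Longrightarrow> a [^] (n::nat) \<in> lcs G k"
  by (induction n) auto

lemma lcs_Suc_eq:
  "1 \<le> k \<Longrightarrow> lcs G (Suc k) = generate G {gcomm G a b | a b. a \<in> lcs G k \<and> b \<in> carrier G}"
  by (cases k) auto

lemma gcomm_in_lcs_Suc:
  assumes "a \<in> lcs G k" "b \<in> carrier G"
  shows "gcomm G a b \<in> lcs G (Suc k)"
proof (cases "k = 0")
  case False
  then have "1 \<le> k" by simp
  then show ?thesis
    unfolding lcs_Suc_eq[OF \<open>1 \<le> k\<close>] using assms by (intro generate.incl) blast
qed (use assms in auto)

lemma lcs_Suc_subset: "lcs G (Suc k) \<subseteq> lcs G k"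
proof (cases "k = 0")
  case False
  then have "1 \<le> k" by simp
  show ?thesis
    unfolding lcs_Suc_eq[OF \<open>1 \<le> k\<close>]
    by (intro generate_subgroup_incl lcs_subgroup) (auto intro: normal_gcomm_left[OF lcs_normal])
qed auto

lemma lcs_antimono: "i \<le> j \<Longrightarrow> lcs G j \<subseteq> lcs G i"
  using lcs_Suc_subset by (rule lift_Suc_antimono_le)

lemma lcs_antimonoD: "a \<in> lcs G j \<Longrightarrow> i \<le> j \<Longrightarrow> a \<in> lcs G i"
  using lcs_antimono by blast

text \<open>The centraliser of \<open>b\<close> modulo \<open>N\<close>, cut down to
  \<open>A\<close>. As it is a subgroup, containments of commutators can be checked on
  generators.\<close>

lemma normal_gcomm_subgroup:
  assumes "N \<lhd> G" "subgroup A G" "b \<in> carrier G"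
  shows "subgroup {a \<in> A. gcomm G a b \<in> N} G"
proof -
  interpret N: normal N G by fact
  interpret A: subgroup A G by fact
  show ?thesis
  proof (rule subgroupI)
    show "{a \<in> A. gcomm G a b \<in> N} \<noteq> {}"
      using A.one_closed N.one_closed gcomm_one(2)[OF assms(3)] by (metis (mono_tags, lifting) empty_iff mem_Collect_eq)
  next
    fix a assume "a \<in> {a \<in> A. gcomm G a b \<in> N}"
    then have a: "a \<in> A" "a \<in> carrier G" "gcomm G a b \<in> N" by simp_all
    have "gcomm G (inv a) b = a \<otimes> inv (gcomm G a b) \<otimes> inv a"
      using a(2) assms(3) by (simp add: gcomm_def word_simps)
    also have "\<dots> \<in> N"
      using a by (intro N.inv_op_closed2 N.m_inv_closed)
    finally show "inv a \<in> {a \<in> A. gcomm G a b \<in> N}"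
      using a(1) by simp
  next
    fix a a' assume "a \<in> {a \<in> A. gcomm G a b \<in> N}" "a' \<in> {a \<in> A. gcomm G a b \<in> N}"
    then have a: "a \<in> A" "a \<in> carrier G" "gcomm G a b \<in> N"
      "a' \<in> A" "a' \<in> carrier G" "gcomm G a' b \<in> N" by simp_all
    have "gcomm G (a \<otimes> a') b \<in> N"
      unfolding gcomm_mult_left[OF a(2,5) assms(3)]
      by (rule N.m_closed[OF N.m_closed[OF a(3) normal_gcomm_left[OF assms(1) a(3,5)]] a(6)])
    then show "a \<otimes> a' \<in> {a \<in> A. gcomm G a b \<in> N}"
      using a by simp
  qed (use A.subset in blast)
qed

text \<open>The three subgroups argument, by induction on \<open>j\<close>: for a generator
  \<open>gcomm G b c\<close> of the next term, Hall-Witt expresses its commutator with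
  \<open>a\<close> through two brackets covered by the induction hypothesis.\<close>

lemma gcomm_lcs:
  assumes "a \<in> lcs G i" "b \<in> lcs G j" "1 \<le> i" "1 \<le> j"
  shows "gcomm G a b \<in> lcs G (i + j)"
  using assms(4,1-3)
proof (induction j arbitrary: a b i rule: dec_induct)
  case base
  then show ?case using gcomm_in_lcs_Suc by auto
next
  case (step j)
  let ?N = "lcs G (i + Suc j)"
  have sub: "subgroup {g \<in> carrier G. gcomm G g a \<in> ?N} G"
    using step.prems by (intro normal_gcomm_subgroup lcs_normal subgroup_self) auto
  have "lcs G (Suc j) \<subseteq> {g \<in> carrier G. gcomm G g a \<in> ?N}"
    unfolding lcs_Suc_eq[OF step.hyps(1)]
  proof (rule generate_subgroup_incl[OF _ sub], clarify)
    fix b c assume b: "b \<in> lcs G j" and c: "c \<in> carrier G"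
    have cb: "b \<in> carrier G" "a \<in> carrier G"
      using b step.prems by auto
    \<comment> \<open>The conjugate is chosen so that the entry
      \<open>a' \<otimes> gcomm G a' b\<close> of the Hall-Witt identity is \<open>a\<close>
      itself.\<close>
    define a' where "a' = b \<otimes> a \<otimes> inv b"
    have a'1: "a' \<in> lcs G i"
      unfolding a'_def by (rule normal.inv_op_closed2[OF lcs_normal cb(1) step.prems(1)])
    then have a'2: "a' \<in> carrier G" by (rule lcs_carrier)
    have aa': "a' \<otimes> gcomm G a' b = a"
      using cb by (simp add: a'_def gcomm_def word_simps)
    have "gcomm G a' b \<in> lcs G (i + j)"
      using step.IH[OF a'1 b step.prems(3)] .
    then have 1: "gcomm G (gcomm G a' b) (c \<otimes> gcomm G c a') \<in> ?N"
      using gcomm_in_lcs_Suc[of "gcomm G a' b" "i + j"] c a'2 by simp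
    have "gcomm G c a' \<in> lcs G (Suc i)"
      using lcs_inv[OF gcomm_in_lcs_Suc[OF a'1 c]] unfolding inv_gcomm[OF a'2 c] .
    from step.IH[OF this lcs_mult[OF b normal_gcomm_left[OF lcs_normal b c]]]
    have 2: "gcomm G (gcomm G c a') (b \<otimes> gcomm G b c) \<in> ?N" by simp
    have cl: "gcomm G (gcomm G b c) a \<in> carrier G"
      using cb c by simp
    have "inv (gcomm G (gcomm G b c) a)
        = gcomm G (gcomm G a' b) (c \<otimes> gcomm G c a') \<otimes> gcomm G (gcomm G c a') (b \<otimes> gcomm G b c)"
      using hall_witt[OF a'2 cb(1) c, unfolded aa'] cl lcs_carrier[OF lcs_mult[OF 1 2]]
      by (rule inv_equality)
    then have "gcomm G (gcomm G b c) a \<in> ?N"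
      using lcs_inv[OF lcs_mult[OF 1 2]] inv_inv[OF cl] by simp
    then show "gcomm G b c \<in> carrier G \<and> gcomm G (gcomm G b c) a \<in> ?N"
      using cb c by simp
  qed
  then have "gcomm G b a \<in> ?N"
    using step.prems(2) by blast
  from lcs_inv[OF this] show ?case
    using inv_gcomm[of b a] step.prems by simp
qed

lemma pow_eq_one_coprime:
  assumes "a \<in> carrier G" "a [^] (m::nat) = \<one>" "a [^] (n::nat) = \<one>" "coprime m n"
  shows "a = \<one>"
proof -
  have "ord a dvd m" "ord a dvd n"
    using assms by (simp_all add: pow_eq_id)
  then have "ord a = 1"
    using assms(4) by (meson coprime_common_divisor_nat is_unit_gcd_iff nat_dvd_1_iff_1 coprime_def)
  then show ?thesis
    using assms(1) ord_eq_1 by blast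
qed

end

lemma (in group_hom) hom_gcomm:
  "a \<in> carrier G \<Longrightarrow> b \<in> carrier G \<Longrightarrow> h (gcomm G a b) = gcomm H (h a) (h b)"
  by (simp add: gcomm_def)

lemma (in group_hom) image_lcs:
  assumes "h ` carrier G = carrier H"
  shows "h ` lcs G k = lcs H k"
proof (induction k)
  case (Suc k)
  show ?case
  proof (cases "k = 0")
    case False
    then have k: "1 \<le> k" by simp
    let ?S = "{gcomm G a b | a b. a \<in> lcs G k \<and> b \<in> carrier G}"
    have "h ` ?S = {gcomm H a b | a b. a \<in> lcs H k \<and> b \<in> carrier H}"
      (is "?L = ?R")
    proof (intro equalityI subsetI)
      fix y assume "y \<in> ?L"
      then obtain a b where "y = h (gcomm G a b)" "a \<in> lcs G k" "b \<in> carrier G"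
        by blast
      then have "y = gcomm H (h a) (h b)" "h a \<in> lcs H k" "h b \<in> carrier H"
        using Suc.IH hom_gcomm[OF G.lcs_carrier] by auto
      then show "y \<in> ?R" by blast
    next
      fix y assume "y \<in> ?R"
      then obtain a b where ab: "y = gcomm H a b" "a \<in> lcs H k" "b \<in> carrier H"
        by blast
      then obtain a' b' where "a = h a'" "a' \<in> lcs G k" "b = h b'" "b' \<in> carrier G"
        using Suc.IH assms by (metis imageE)
      then have "y = h (gcomm G a' b')" "gcomm G a' b' \<in> ?S"
        using ab hom_gcomm[OF G.lcs_carrier] by auto
      then show "y \<in> ?L" by (rule image_eqI)
    qed
    moreover have "?S \<subseteq> carrier G"
      using G.gcomm_closed G.lcs_carrier by blast
    ultimately show ?thesis
      unfolding H.lcs_Suc_eq[OF k] G.lcs_Suc_eq[OF k] by (simp flip: generate_img)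
  qed (use assms in simp)
qed (use assms in simp)

text \<open>Used to carry the bound on the class over to the subgroup generated by two
  elements.\<close>

lemma (in group) lcs_subgroup_mono:
  assumes "subgroup K G"
  shows "lcs (G\<lparr>carrier := K\<rparr>) k \<subseteq> lcs G k"
proof (induction k)
  case 0
  then show ?case using subgroup.subset[OF assms] by simp
next
  case (Suc k)
  interpret K: group "G\<lparr>carrier := K\<rparr>"
    using assms by (rule subgroup_imp_group)
  show ?case
  proof (cases "k = 0")
    case False
    then have k: "1 \<le> k" by simp
    let ?S = "{gcomm (G\<lparr>carrier := K\<rparr>) a b | a b. a \<in> lcs (G\<lparr>carrier := K\<rparr>) k \<and> b \<in> K}"
    have *: "?S \<subseteq> lcs G (Suc k) \<inter> K"
    proof
      fix y assume "y \<in> ?S"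
      then obtain a b where y: "y = gcomm (G\<lparr>carrier := K\<rparr>) a b"
        and ab: "a \<in> lcs (G\<lparr>carrier := K\<rparr>) k" "b \<in> K"
        by blast
      have aK: "a \<in> K"
        using K.lcs_carrier[OF ab(1)] by simp
      have "y \<in> K"
        using K.gcomm_closed[of a b] y aK ab by simp
      moreover have "y = gcomm G a b"
        using y aK ab by (simp add: gcomm_def m_inv_consistent[OF assms])
      moreover have "gcomm G a b \<in> lcs G (Suc k)"
        using ab Suc.IH subgroup.subset[OF assms] by (intro gcomm_in_lcs_Suc) auto
      ultimately show "y \<in> lcs G (Suc k) \<inter> K" by simp
    qed
    then have "generate (G\<lparr>carrier := K\<rparr>) ?S = generate G ?S"
      by (intro generate_consistent[OF _ assms]) blast
    also have "\<dots> \<subseteq> lcs G (Suc k)"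
      using * by (intro generate_subgroup_incl lcs_subgroup) blast
    finally show ?thesis
      using K.lcs_Suc_eq[OF k] by simp
  qed (use subgroup.subset[OF assms] in simp)
qed

section \<open>Polynomial sequences in nilpotent groups\<close>

text \<open>Following Leibman, a polynomial sequence has its iterated differences in the expected terms of
  the lower central series. Allowing left and right differences makes the notion stable under
  inversion at once, so that products and commutators can be treated by one downward induction.\<close>

definition seq_diff :: "('a, 'b) monoid_scheme \<Rightarrow> bool \<Rightarrow> (nat \<Rightarrow> 'a) \<Rightarrow> nat \<Rightarrow> 'a" where
  "seq_diff G right f n =
     (if right then f (Suc n) \<otimes>\<^bsub>G\<^esub> inv\<^bsub>G\<^esub> f n else inv\<^bsub>G\<^esub> f n \<otimes>\<^bsub>G\<^esub> f (Suc n))"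

definition poly_seq :: "('a, 'b) monoid_scheme \<Rightarrow> nat \<Rightarrow> (nat \<Rightarrow> 'a) \<Rightarrow> bool" where
  "poly_seq G j f \<longleftrightarrow> (\<forall>ds n. fold (seq_diff G) ds f n \<in> lcs G (j + length ds))"

lemma poly_seq_iff:
  "poly_seq G j f \<longleftrightarrow> (\<forall>n. f n \<in> lcs G j) \<and> (\<forall>d. poly_seq G (Suc j) (seq_diff G d f))"
proof
  assume f: "poly_seq G j f"
  have "f n \<in> lcs G j" for n
    using f[unfolded poly_seq_def, rule_format, of "[]" n] by simp
  moreover have "fold (seq_diff G) ds (seq_diff G d f) n \<in> lcs G (Suc j + length ds)" for d ds n
    using f[unfolded poly_seq_def, rule_format, of "d # ds" n] by simp
  ultimately show "(\<forall>n. f n \<in> lcs G j) \<and> (\<forall>d. poly_seq G (Suc j) (seq_diff G d f))"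
    by (auto simp: poly_seq_def)
next
  assume f: "(\<forall>n. f n \<in> lcs G j) \<and> (\<forall>d. poly_seq G (Suc j) (seq_diff G d f))"
  have "fold (seq_diff G) ds f n \<in> lcs G (j + length ds)" for ds n
  proof (cases ds)
    case (Cons d ds')
    then show ?thesis
      using f[THEN conjunct2, rule_format, of d, unfolded poly_seq_def, rule_format, of ds' n] by simp
  qed (use f in simp)
  then show "poly_seq G j f" by (simp add: poly_seq_def)
qed

lemma poly_seq_in_lcs: "poly_seq G j f \<Longrightarrow> f n \<in> lcs G j"
  by (subst (asm) poly_seq_iff) simp

lemma poly_seq_diff: "poly_seq G j f \<Longrightarrow> poly_seq G (Suc j) (seq_diff G d f)"
  by (subst (asm) poly_seq_iff) simp

lemma poly_seq_shift: "poly_seq G j f \<Longrightarrow> poly_seq G j (\<lambda>n. f (Suc n))"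
proof -
  have "fold (seq_diff G) ds (\<lambda>n. f (Suc n)) n = fold (seq_diff G) ds f (Suc n)" for ds n
  proof (induction ds arbitrary: f)
    case (Cons d ds)
    have "seq_diff G d (\<lambda>n. f (Suc n)) = (\<lambda>n. seq_diff G d f (Suc n))"
      by (simp add: seq_diff_def fun_eq_iff)
    then show ?case by (simp add: Cons)
  qed simp
  then show "poly_seq G j f \<Longrightarrow> ?thesis"
    unfolding poly_seq_def by simp
qed

context group
begin

lemma poly_seq_carrier: "poly_seq G j f \<Longrightarrow> f n \<in> carrier G"
  using poly_seq_in_lcs lcs_carrier by blast

lemma poly_seq_one: "poly_seq G j (\<lambda>n. \<one>)"
proof -
  have "seq_diff G d (\<lambda>n. \<one>) = (\<lambda>n. \<one>)" for d
    by (simp add: seq_diff_def fun_eq_iff)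
  then have "fold (seq_diff G) ds (\<lambda>n. \<one>) = (\<lambda>n. \<one>)" for ds
    by (induction ds) simp_all
  then show ?thesis by (simp add: poly_seq_def)
qed

lemma poly_seq_inv:
  assumes "poly_seq G j f"
  shows "poly_seq G j (\<lambda>n. inv f n)"
proof -
  have *: "seq_diff G d (\<lambda>n. inv f n) = (\<lambda>n. inv (seq_diff G (\<not> d) f n))"
    if "\<And>n. f n \<in> carrier G" for d f
    using that by (simp add: seq_diff_def fun_eq_iff inv_mult_group)
  have "fold (seq_diff G) ds (\<lambda>n. inv f n) n = inv (fold (seq_diff G) (map Not ds) f n)"
    if "\<And>n. f n \<in> carrier G" for ds n f
    using that
  proof (induction ds arbitrary: f)
    case (Cons d ds)
    have "seq_diff G d' f n \<in> carrier G" for d' n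
      using Cons.prems by (simp add: seq_diff_def)
    then show ?case
      by (simp add: *[OF Cons.prems] Cons.IH)
  qed simp
  then show ?thesis
    using assms poly_seq_carrier[OF assms] unfolding poly_seq_def
    by (metis lcs_inv length_map)
qed

text \<open>By Pascal's rule a difference lowers the index \<open>i\<close> of the binomial
  coefficient by one. These sequences are the monomials of the Taylor expansion in
  \<open>poly_seq_eq_one\<close>.\<close>

lemma poly_seq_binomial:
  assumes "h \<in> lcs G (j + i)"
  shows "poly_seq G j (\<lambda>n. h [^] (n choose i))"
  using assms
proof (induction i arbitrary: j)
  case 0
  have "seq_diff G d (\<lambda>n. h [^] (n choose 0)) = (\<lambda>n. \<one>)" for d
    using lcs_carrier[OF 0] by (simp add: seq_diff_def fun_eq_iff)
  then show ?case
    using 0 by (subst poly_seq_iff) (simp add: poly_seq_one)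
next
  case (Suc i)
  have h: "h \<in> carrier G" using Suc.prems by simp
  have "seq_diff G d (\<lambda>n. h [^] (n choose Suc i)) = (\<lambda>n. h [^] (n choose i))" for d
  proof
    fix n
    define a b where "a = h [^] (n choose i)" and "b = h [^] (n choose Suc i)"
    have ab: "a \<in> carrier G" "b \<in> carrier G" using h by (simp_all add: a_def b_def)
    have "h [^] (Suc n choose Suc i) = a \<otimes> b" "a \<otimes> b = b \<otimes> a"
      using h by (simp_all add: a_def b_def nat_pow_mult add.commute)
    then show "seq_diff G d (\<lambda>n. h [^] (n choose Suc i)) n = h [^] (n choose i)"
      using ab unfolding seq_diff_def a_def[symmetric] b_def[symmetric]
      by (cases d) (metis inv_solve_right m_closed, metis inv_solve_left m_closed)
  qed
  moreover have "h [^] (n choose Suc i) \<in> lcs G j" for n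
    using Suc.prems by (intro lcs_pow) (auto intro: lcs_antimonoD)
  ultimately show ?case
    using Suc.IH[of "Suc j"] Suc.prems by (subst poly_seq_iff) simp
qed

lemma poly_seq_trivial:
  assumes "lcs G (Suc c) = {\<one>}" "c < j" "\<And>n. f n \<in> lcs G j"
  shows "poly_seq G j f"
proof -
  have "f = (\<lambda>n. \<one>)"
    using assms lcs_antimono[of "Suc c" j] by (intro ext) auto
  then show ?thesis by (simp add: poly_seq_one)
qed

lemma gcomm_lcs_add:
  assumes "a \<in> lcs G i" "b \<in> lcs G j"
  shows "gcomm G a b \<in> lcs G (i + j)"
proof (cases "i = 0 \<or> j = 0")
  case True
  then show ?thesis
    using assms normal_gcomm_left[OF lcs_normal, of a i b] normal_gcomm_right[OF lcs_normal, of b j a]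
    by auto
qed (use assms gcomm_lcs in simp)

lemma poly_seq_antimono:
  assumes "poly_seq G j f" "i \<le> j"
  shows "poly_seq G i f"
  using assms unfolding poly_seq_def by (meson add_le_mono1 lcs_antimonoD)

text \<open>Both claims are proved together by downward induction on the degree \<open>s\<close>,
  where \<open>d\<close> bounds the distance to the class; beyond the class every sequence is
  constantly trivial. The differences of a product or a commutator of degree \<open>s\<close> are
  built from conjugates in degree \<open>Suc s\<close>, and \<open>conj_eq_mult_gcomm\<close> makes
  a conjugate into a product with a commutator, so the two claims depend on each other.\<close>

lemma poly_seq_closed:
  assumes c: "lcs G (Suc c) = {\<one>}"
  shows "c < s + d \<Longrightarrow>
    (\<forall>i j f g. s \<le> i + j \<longrightarrow> poly_seq G i f \<longrightarrow> poly_seq G j g \<longrightarrow>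
       poly_seq G (i + j) (\<lambda>n. gcomm G (f n) (g n))) \<and>
    (\<forall>j f g. s \<le> j \<longrightarrow> poly_seq G j f \<longrightarrow> poly_seq G j g \<longrightarrow> poly_seq G j (\<lambda>n. f n \<otimes> g n))"
    (is "_ \<Longrightarrow> ?A s \<and> ?B s")
proof (induction d arbitrary: s)
  case 0
  have "?A s"
  proof (intro allI impI)
    fix i j f g assume *: "s \<le> i + j" "poly_seq G i f" "poly_seq G j g"
    show "poly_seq G (i + j) (\<lambda>n. gcomm G (f n) (g n))"
    proof (rule poly_seq_trivial[OF c])
      show "gcomm G (f n) (g n) \<in> lcs G (i + j)" for n
        by (rule gcomm_lcs_add[OF *(2,3)[THEN poly_seq_in_lcs]])
    qed (use 0 * in simp)
  qed
  moreover have "?B s"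
  proof (intro allI impI)
    fix j f g assume *: "s \<le> j" "poly_seq G j f" "poly_seq G j g"
    show "poly_seq G j (\<lambda>n. f n \<otimes> g n)"
    proof (rule poly_seq_trivial[OF c])
      show "f n \<otimes> g n \<in> lcs G j" for n
        by (rule lcs_mult[OF *(2,3)[THEN poly_seq_in_lcs]])
    qed (use 0 * in simp)
  qed
  ultimately show ?case by blast
next
  case (Suc d)
  then have IH: "?A (Suc s)" "?B (Suc s)"
    using Suc.IH[of "Suc s"] by auto
  have comm: "poly_seq G (i + j) (\<lambda>n. gcomm G (f n) (g n))"
    if "Suc s \<le> i + j" "poly_seq G i f" "poly_seq G j g" for i j f g
    using IH(1) that by blast
  have mult: "poly_seq G j (\<lambda>n. f n \<otimes> g n)"
    if "Suc s \<le> j" "poly_seq G j f" "poly_seq G j g" for j f g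
    using IH(2) that by blast
  have conj: "poly_seq G t (\<lambda>n. inv (f n) \<otimes> K n \<otimes> f n)"
    if "Suc s \<le> t" "poly_seq G t K" "poly_seq G i f" for t K i f
  proof -
    have "poly_seq G t (\<lambda>n. K n \<otimes> gcomm G (K n) (f n))"
      using comm[OF _ that(2,3)] that(1)
      by (intro mult[OF that(1,2)] poly_seq_antimono[of "t + i" _ t]) simp_all
    then show ?thesis
      using that by (simp add: conj_eq_mult_gcomm poly_seq_carrier)
  qed
  have conj': "poly_seq G t (\<lambda>n. f n \<otimes> K n \<otimes> inv (f n))"
    if "Suc s \<le> t" "poly_seq G t K" "poly_seq G i f" for t K i f
    using conj[OF that(1,2) poly_seq_inv[OF that(3)]] that(3) by (simp add: poly_seq_carrier)
  have diff: "poly_seq G (Suc t) (seq_diff G b f)" if "poly_seq G t f" for t f b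
    using that by (rule poly_seq_diff)
  have "poly_seq G (i + j) (\<lambda>n. gcomm G (f n) (g n))" (is "poly_seq G _ ?h")
    if ij: "i + j = s" and f: "poly_seq G i f" and g: "poly_seq G j g" for i j f g
  proof -
    note cl = f[THEN poly_seq_carrier] g[THEN poly_seq_carrier]
    have le: "Suc s \<le> Suc (i + j)" using ij by simp
    let ?F = "seq_diff G True f" and ?E = "seq_diff G True g"
    have 1: "poly_seq G (Suc (i + j)) (\<lambda>n. inv (f n) \<otimes> gcomm G (?F n) (g (Suc n)) \<otimes> f n)"
      using comm[OF _ diff[OF f] poly_seq_shift[OF g]] le by (intro conj[OF le _ f]) simp
    have 2: "poly_seq G (Suc (i + j)) (\<lambda>n. inv (g n) \<otimes> gcomm G (f n) (?E n) \<otimes> g n)"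
      using comm[OF _ f diff[OF g]] le by (intro conj[OF le _ g]) simp
    \<comment> \<open>Conjugation by \<open>gcomm G (f n) (g n)\<close> is wanted, but that this is
      a polynomial sequence is the very claim. It is therefore factored into four conjugations by
      \<open>f n\<close>, \<open>g n\<close> and their inverses, as \<open>conj_comm\<close>
      verifies.\<close>
    have 3: "poly_seq G (Suc (i + j)) (\<lambda>n. inv (f n) \<otimes> (inv (g n) \<otimes> (f n \<otimes> (g n \<otimes>
        (inv (g n) \<otimes> gcomm G (f n) (?E n) \<otimes> g n) \<otimes> inv (g n)) \<otimes> inv (f n)) \<otimes> g n) \<otimes> f n)"
      by (rule conj[OF le conj[OF le conj'[OF le conj'[OF le 2 g] f] g] f])
    have conj_comm: "inv a \<otimes> (inv b \<otimes> (a \<otimes> (b \<otimes> x \<otimes> inv b) \<otimes> inv a) \<otimes> b) \<otimes> a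
        = gcomm G a b \<otimes> x \<otimes> inv gcomm G a b"
      if "a \<in> carrier G" "b \<in> carrier G" "x \<in> carrier G" for a b x
      using that by (simp add: gcomm_def word_simps)
    have right: "poly_seq G (Suc (i + j)) (seq_diff G True ?h)"
    proof -
      have "seq_diff G True ?h n = (inv (f n) \<otimes> gcomm G (?F n) (g (Suc n)) \<otimes> f n) \<otimes>
        (inv (f n) \<otimes> (inv (g n) \<otimes> (f n \<otimes> (g n \<otimes>
        (inv (g n) \<otimes> gcomm G (f n) (?E n) \<otimes> g n) \<otimes> inv (g n)) \<otimes> inv (f n)) \<otimes> g n) \<otimes> f n)" for n
      proof -
        have F: "?F n \<in> carrier G" "f (Suc n) = ?F n \<otimes> f n"
          and E: "?E n \<in> carrier G" "g (Suc n) = ?E n \<otimes> g n"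
          using cl by (simp_all add: seq_diff_def m_assoc)
        have "gcomm G (f (Suc n)) (g (Suc n)) = (inv (f n) \<otimes> gcomm G (?F n) (g (Suc n)) \<otimes> f n) \<otimes>
            gcomm G (f n) (g (Suc n))"
          unfolding F(2) using F(1) cl by (simp add: gcomm_def word_simps)
        moreover have "gcomm G (f n) (g (Suc n)) = gcomm G (f n) (g n) \<otimes> (inv (g n) \<otimes> gcomm G (f n) (?E n) \<otimes> g n)"
          unfolding E(2) using E(1) cl by (simp add: gcomm_def word_simps)
        ultimately show ?thesis
          using cl E(1) F(1) by (simp add: conj_comm) (simp add: seq_diff_def m_assoc)
      qed
      then have "seq_diff G True ?h = (\<lambda>n. (inv (f n) \<otimes> gcomm G (?F n) (g (Suc n)) \<otimes> f n) \<otimes>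
        (inv (f n) \<otimes> (inv (g n) \<otimes> (f n \<otimes> (g n \<otimes>
        (inv (g n) \<otimes> gcomm G (f n) (?E n) \<otimes> g n) \<otimes> inv (g n)) \<otimes> inv (f n)) \<otimes> g n) \<otimes> f n))"
        by blast
      then show ?thesis
        using mult[OF le 1 3] by simp
    qed
    \<comment> \<open>The left difference is the conjugate of the right one by
      \<open>gcomm G (f n) (g n)\<close>, up to the direction of conjugation; the same factorisation
      is used with \<open>f\<close> and \<open>g\<close> exchanged.\<close>
    have 4: "poly_seq G (Suc (i + j)) (\<lambda>n. inv (g n) \<otimes> (inv (f n) \<otimes> (g n \<otimes> (f n \<otimes>
        seq_diff G True ?h n \<otimes> inv (f n)) \<otimes> inv (g n)) \<otimes> f n) \<otimes> g n)"
      by (rule conj[OF le conj[OF le conj'[OF le conj'[OF le right f] g] f] g])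
    have "seq_diff G False ?h n = inv (g n) \<otimes> (inv (f n) \<otimes> (g n \<otimes> (f n \<otimes>
        seq_diff G True ?h n \<otimes> inv (f n)) \<otimes> inv (g n)) \<otimes> f n) \<otimes> g n" for n
    proof -
      define a b where "a = gcomm G (f n) (g n)" and "b = gcomm G (f (Suc n)) (g (Suc n))"
      have ab: "a \<in> carrier G" "b \<in> carrier G" "gcomm G (g n) (f n) = inv a"
        using cl by (simp_all add: a_def b_def inv_gcomm)
      have d: "seq_diff G True ?h n = b \<otimes> inv a" "seq_diff G False ?h n = inv a \<otimes> b"
        by (simp_all add: seq_diff_def a_def b_def)
      show ?thesis
        unfolding d conj_comm[OF cl(2,1) m_closed[OF ab(2) inv_closed[OF ab(1)]]]
        using ab by (simp add: m_assoc)
    qed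
    then have "seq_diff G False ?h = (\<lambda>n. inv (g n) \<otimes> (inv (f n) \<otimes> (g n \<otimes> (f n \<otimes>
        seq_diff G True ?h n \<otimes> inv (f n)) \<otimes> inv (g n)) \<otimes> f n) \<otimes> g n)"
      by blast
    with 4 have "poly_seq G (Suc (i + j)) (seq_diff G False ?h)" by simp
    with right have "poly_seq G (Suc (i + j)) (seq_diff G b ?h)" for b
      by (cases b) simp_all
    then show ?thesis
      using f g by (subst poly_seq_iff) (auto intro: gcomm_lcs_add poly_seq_in_lcs)
  qed
  then have "?A s"
    using comm by (metis not_less_eq_eq le_antisym)
  moreover have "poly_seq G s (\<lambda>n. f n \<otimes> g n)"
    if f: "poly_seq G s f" and g: "poly_seq G s g" for f g
  proof -
    note cl = f[THEN poly_seq_carrier] g[THEN poly_seq_carrier]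
    have "poly_seq G (Suc s) (\<lambda>n. seq_diff G True f n \<otimes> (f n \<otimes> seq_diff G True g n \<otimes> inv (f n)))"
      by (rule mult[OF le_refl diff[OF f] conj'[OF le_refl diff[OF g] f]])
    moreover have "seq_diff G True (\<lambda>n. f n \<otimes> g n)
        = (\<lambda>n. seq_diff G True f n \<otimes> (f n \<otimes> seq_diff G True g n \<otimes> inv (f n)))"
      using cl by (simp add: fun_eq_iff seq_diff_def word_simps)
    ultimately have 1: "poly_seq G (Suc s) (seq_diff G True (\<lambda>n. f n \<otimes> g n))" by simp
    have "poly_seq G (Suc s) (\<lambda>n. (inv (g n) \<otimes> seq_diff G False f n \<otimes> g n) \<otimes> seq_diff G False g n)"
      by (rule mult[OF le_refl conj[OF le_refl diff[OF f] g] diff[OF g]])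
    moreover have "seq_diff G False (\<lambda>n. f n \<otimes> g n)
        = (\<lambda>n. (inv (g n) \<otimes> seq_diff G False f n \<otimes> g n) \<otimes> seq_diff G False g n)"
      using cl by (simp add: fun_eq_iff seq_diff_def word_simps)
    ultimately have 2: "poly_seq G (Suc s) (seq_diff G False (\<lambda>n. f n \<otimes> g n))" by simp
    have "poly_seq G (Suc s) (seq_diff G b (\<lambda>n. f n \<otimes> g n))" for b
      using 1 2 by (cases b) simp_all
    then show ?thesis
      using f g by (subst poly_seq_iff) (auto intro: lcs_mult poly_seq_in_lcs)
  qed
  then have "?B s"
    using mult by (metis not_less_eq_eq le_antisym)
  ultimately show ?case by blast
qed

context
  fixes c assumes c: "lcs G (Suc c) = {\<one>}"
begin

lemma poly_seq_gcomm:
  "poly_seq G i f \<Longrightarrow> poly_seq G j g \<Longrightarrow> poly_seq G (i + j) (\<lambda>n. gcomm G (f n) (g n))"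
  using poly_seq_closed[OF c, of 0 "Suc c"] by simp

lemma poly_seq_mult:
  "poly_seq G j f \<Longrightarrow> poly_seq G j g \<Longrightarrow> poly_seq G j (\<lambda>n. f n \<otimes> g n)"
  using poly_seq_closed[OF c, of 0 "Suc c"] by simp

text \<open>As \<open>f\<close> is trivial before \<open>m\<close>, the value \<open>f m\<close> is
  itself an \<open>m\<close>-fold difference.\<close>

lemma poly_seq_vanishing:
  assumes "poly_seq G j f" "\<And>k. k < m \<Longrightarrow> f k = \<one>"
  shows "f m \<in> lcs G (j + m)"
  using assms
proof (induction m arbitrary: j f)
  case 0
  then show ?case using poly_seq_in_lcs by fastforce
next
  case (Suc m)
  have "seq_diff G True f m \<in> lcs G (Suc j + m)"
    using Suc.prems by (intro Suc.IH poly_seq_diff) (simp_all add: seq_diff_def)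
  moreover have "seq_diff G True f m = f (Suc m)"
    using Suc.prems poly_seq_carrier[OF Suc.prems(1)] by (simp add: seq_diff_def)
  ultimately show ?case by simp
qed

text \<open>The proof strips off the Taylor coefficients of \<open>f\<close> at \<open>0\<close> one at a time.\<close>

lemma poly_seq_eq_one:
  assumes "poly_seq G j f" "\<And>k. k < m \<Longrightarrow> f k = \<one>"
    and "\<And>i h. m \<le> i \<Longrightarrow> h \<in> lcs G (j + i) \<Longrightarrow> h [^] (n choose i) = \<one>"
  shows "f n = \<one>"
proof -
  have main: "c < j + m + d \<Longrightarrow> f n = \<one>"
    if "poly_seq G j f" "\<And>k. k < m \<Longrightarrow> f k = \<one>"
      "\<And>i h. m \<le> i \<Longrightarrow> h \<in> lcs G (j + i) \<Longrightarrow> h [^] (n choose i) = \<one>" for d f m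
    using that
  proof (induction d arbitrary: f m)
    case 0
    have "f k = \<one>" for k
    proof (induction k rule: less_induct)
      case (less k)
      show ?case
      proof (cases "k < m")
        case False
        have "f k \<in> lcs G (j + k)"
          by (rule poly_seq_vanishing[OF 0(2) less])
        then have "f k \<in> lcs G (Suc c)"
          using False 0(1) by (auto intro: lcs_antimonoD)
        then show ?thesis using c by simp
      qed (use 0 in blast)
    qed
    then show ?case .
  next
    case (Suc d)
    define h where "h = f m"
    define g where "g = (\<lambda>n. inv (h [^] (n choose m)) \<otimes> f n)"
    have h: "h \<in> lcs G (j + m)"
      unfolding h_def using Suc.prems by (intro poly_seq_vanishing) auto
    then have hc: "h \<in> carrier G" by simp
    have "poly_seq G j g"
      unfolding g_def using h by (intro poly_seq_mult poly_seq_inv poly_seq_binomial Suc.prems)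
    moreover have "g k = \<one>" if "k < Suc m" for k
      using that hc Suc.prems(3)[of k] by (cases "k = m") (simp_all add: g_def h_def binomial_eq_0)
    moreover have "a [^] (n choose i) = \<one>" if "Suc m \<le> i" "a \<in> lcs G (j + i)" for i a
      using Suc.prems(4) that by simp
    ultimately have "g n = \<one>"
      using Suc.prems(1) by (intro Suc.IH[of "Suc m" g]) auto
    then show ?case
      using Suc.prems(4)[OF le_refl h] hc poly_seq_carrier[OF Suc.prems(2)] by (simp add: g_def)
  qed
  show ?thesis
    by (rule main[where d = "Suc c" and f = f and m = m]) (use assms in auto)
qed

end

end

section \<open>Left-normed commutators and exponents\<close>

declare lcs.simps(3) [simp del]

context group
begin

lemma foldl_gcomm_closed:
  "a \<in> carrier G \<Longrightarrow> set t \<subseteq> carrier G \<Longrightarrow> foldl (gcomm G) a t \<in> carrier G"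
  by (induction t arbitrary: a) auto

lemma foldl_gcomm_one: "set t \<subseteq> carrier G \<Longrightarrow> foldl (gcomm G) \<one> t = \<one>"
  by (induction t) auto

lemma foldl_gcomm_in_lcs:
  "a \<in> lcs G k \<Longrightarrow> set t \<subseteq> carrier G \<Longrightarrow> foldl (gcomm G) a t \<in> lcs G (k + length t)"
proof (induction t arbitrary: a k)
  case (Cons b t)
  then show ?case
    using Cons.IH[of "gcomm G a b" "Suc k"] gcomm_in_lcs_Suc by simp
qed simp

lemma normal_gcomm_subgroup_right:
  assumes "N \<lhd> G" "a \<in> carrier G"
  shows "subgroup {b \<in> carrier G. gcomm G a b \<in> N} G"
proof -
  have "gcomm G a b \<in> N \<longleftrightarrow> gcomm G b a \<in> N" if "b \<in> carrier G" for b
    using that assms inv_gcomm subgroup.m_inv_closed[OF normal_imp_subgroup[OF assms(1)]] by metis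
  then have "{b \<in> carrier G. gcomm G a b \<in> N} = {b \<in> carrier G. gcomm G b a \<in> N}"
    by blast
  then show ?thesis
    using normal_gcomm_subgroup[OF assms(1) subgroup_self assms(2)] by simp
qed

text \<open>Modulo the next term, which \<open>T\<close> contains, a commutator is multiplicative in
  both entries, so commutators of generators suffice. The two subgroups \<open>?U\<close> of the
  induction step exploit this first in the left and then in the right entry.\<close>

lemma lcs_subset_of_generators:
  assumes "S \<subseteq> carrier G" "generate G S = carrier G" "subgroup T G"
    and "lcs G (Suc (Suc n)) \<subseteq> T"
    and "\<And>a t. a \<in> S \<Longrightarrow> set t \<subseteq> S \<Longrightarrow> length t = n \<Longrightarrow> foldl (gcomm G) a t \<in> T"
  shows "lcs G (Suc n) \<subseteq> T"
  using assms(3-)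
proof (induction n arbitrary: T)
  case 0
  then show ?case
    using assms(2) generate_subgroup_incl[of S T] by force
next
  case (Suc n)
  interpret T: subgroup T G by fact
  have TE: "gcomm G (gcomm G a b) c \<in> T" if "a \<in> lcs G (Suc n)" "b \<in> carrier G" "c \<in> carrier G" for a b c
    using Suc.prems(2) gcomm_in_lcs_Suc[OF gcomm_in_lcs_Suc[OF that(1,2)] that(3)] by blast
  have x: "gcomm G a x \<in> T" if "a \<in> lcs G (Suc n)" "x \<in> S" for a x
  proof -
    let ?U = "{a \<in> lcs G (Suc n). gcomm G a x \<in> T}"
    have x: "x \<in> carrier G" using that assms(1) by blast
    have "subgroup ?U G"
    proof (rule subgroupI)
      show "?U \<subseteq> carrier G" using lcs_carrier by blast
      have "\<one> \<in> ?U" using x by simp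
      then show "?U \<noteq> {}" by blast
    next
      fix a assume "a \<in> ?U"
      then have a: "a \<in> lcs G (Suc n)" "gcomm G a x \<in> T" by simp_all
      then have ac: "a \<in> carrier G" by simp
      have "gcomm G (inv a) x = inv (gcomm G a x \<otimes> gcomm G (gcomm G a x) (inv a))"
        using ac x by (simp add: gcomm_def word_simps)
      then show "inv a \<in> ?U"
        using a TE[OF a(1) x, of "inv a"] ac lcs_inv by simp
    next
      fix a b assume "a \<in> ?U" "b \<in> ?U"
      then have a: "a \<in> lcs G (Suc n)" "gcomm G a x \<in> T" and b: "b \<in> lcs G (Suc n)" "gcomm G b x \<in> T"
        by simp_all
      then show "a \<otimes> b \<in> ?U"
        using TE[OF a(1) x, of b] x lcs_carrier[OF a(1)] lcs_carrier[OF b(1)]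
        by (simp add: gcomm_mult_left)
    qed
    then have "lcs G (Suc n) \<subseteq> ?U"
    proof (rule Suc.IH)
      show "lcs G (Suc (Suc n)) \<subseteq> ?U"
      proof
        fix a assume a: "a \<in> lcs G (Suc (Suc n))"
        then have "gcomm G a x \<in> T"
          using Suc.prems(2) gcomm_in_lcs_Suc[OF a x] by blast
        moreover have "a \<in> lcs G (Suc n)" using a by (rule lcs_antimonoD) simp
        ultimately show "a \<in> ?U" by blast
      qed
    next
      fix a t assume *: "a \<in> S" "set t \<subseteq> S" "length t = n"
      have "foldl (gcomm G) a t \<in> lcs G (Suc n)"
        using foldl_gcomm_in_lcs[of a 1 t] * assms(1) by auto
      then show "foldl (gcomm G) a t \<in> ?U"
        using Suc.prems(3)[of a "t @ [x]"] * that(2) by simp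
    qed
    then show ?thesis using that(1) by blast
  qed
  have "gcomm G a b \<in> T" if a: "a \<in> lcs G (Suc n)" and b: "b \<in> carrier G" for a b
  proof -
    let ?U = "{b \<in> carrier G. gcomm G a b \<in> T}"
    have ac: "a \<in> carrier G" using a by simp
    have "subgroup ?U G"
    proof (rule subgroupI)
      show "?U \<subseteq> carrier G" by blast
      have "\<one> \<in> ?U" using ac by simp
      then show "?U \<noteq> {}" by blast
    next
      fix b assume "b \<in> ?U"
      then have b: "b \<in> carrier G" "gcomm G a b \<in> T" by simp_all
      have "gcomm G a (inv b) = inv (gcomm G a b \<otimes> gcomm G (gcomm G a b) (inv b))"
        using ac b by (simp add: gcomm_def word_simps)
      then show "inv b \<in> ?U"
        using b TE[OF a b(1), of "inv b"] by simp
    next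
      fix b b' assume "b \<in> ?U" "b' \<in> ?U"
      then have b: "b \<in> carrier G" "gcomm G a b \<in> T" "b' \<in> carrier G" "gcomm G a b' \<in> T"
        by simp_all
      then show "b \<otimes> b' \<in> ?U"
        using TE[OF a b(1,3)] ac by (simp add: gcomm_mult_right)
    qed
    moreover have "S \<subseteq> ?U" using x[OF a] assms(1) by blast
    ultimately have "generate G S \<subseteq> ?U" by (rule generate_subgroup_incl[rotated])
    then show ?thesis using b assms(2) by blast
  qed
  then show ?case
    unfolding lcs.simps(3) by (intro generate_subgroup_incl T.subgroup_axioms) blast
qed

end

lemma prime_power_dvd_binomial:
  fixes p :: nat
  assumes "Factorial_Ring.prime p" "0 < i" "i < p"
  shows "p ^ b dvd (p ^ b choose i)"
proof -
  have "i * (p ^ b choose i) = p ^ b * ((p ^ b - 1) choose (i - 1))"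
    using assms by (simp add: times_binomial_minus1_eq)
  moreover have "coprime (p ^ b) i"
    using assms by (simp add: prime_imp_coprime_nat nat_dvd_not_less)
  ultimately show ?thesis
    by (metis coprime_dvd_mult_right_iff dvd_triv_left)
qed

text \<open>At \<open>i = p\<close> the argument of \<open>prime_power_dvd_binomial\<close> loses
  exactly one factor \<open>p\<close>; starting from \<open>Suc b\<close> leaves
  \<open>p ^ b\<close>.\<close>

lemma prime_power_dvd_binomial_Suc:
  fixes p :: nat
  assumes "Factorial_Ring.prime p" "0 < i" "i \<le> p"
  shows "p ^ b dvd (p ^ Suc b choose i)"
proof (cases "i = p")
  case True
  have "p * (p ^ Suc b choose p) = p ^ Suc b * ((p ^ Suc b - 1) choose (p - 1))"
    using prime_gt_0_nat[OF assms(1)] by (simp add: times_binomial_minus1_eq)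
  then show ?thesis
    using True prime_gt_0_nat[OF assms(1)] by simp
next
  case False
  then have "p ^ Suc b dvd (p ^ Suc b choose i)"
    using assms by (intro prime_power_dvd_binomial) auto
  then show ?thesis by (meson dvd_trans le_SucI le_imp_power_dvd order_refl)
qed

section \<open>Exponents of the lower central terms of two-generator groups\<close>

context group
begin

lemma pow_eq_one_dvd: "h \<in> carrier G \<Longrightarrow> h [^] (m::nat) = \<one> \<Longrightarrow> m dvd n \<Longrightarrow> h [^] n = \<one>"
  by (auto elim!: dvdE simp flip: nat_pow_pow)

lemma poly_seq_const:
  assumes "h \<in> lcs G j"
  shows "poly_seq G j (\<lambda>n. h)"
  using poly_seq_binomial[of h j 0] assms by simp

context
  fixes c assumes c: "lcs G (Suc c) = {\<one>}"
begin

lemma poly_seq_foldl_gcomm: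
  "poly_seq G i f \<Longrightarrow> set t \<subseteq> carrier G \<Longrightarrow> poly_seq G (i + length t) (\<lambda>n. foldl (gcomm G) (f n) t)"
proof (induction t arbitrary: f i)
  case (Cons b t)
  have "poly_seq G (i + 1) (\<lambda>n. gcomm G (f n) b)"
    using Cons.prems by (intro poly_seq_gcomm[OF c] poly_seq_const) simp_all
  then show ?case using Cons by fastforce
qed simp

text \<open>A left-normed commutator \<open>h\<close> in \<open>x\<close> and \<open>y\<close> is
  trivial unless \<open>y\<close> is among its first two entries. Replacing this \<open>y\<close> by
  \<open>y [^] n\<close> gives a polynomial sequence with value \<open>h\<close> at \<open>1\<close>
  and trivial values at \<open>0\<close> and \<open>N\<close>. It agrees with \<open>h [^] n\<close>
  at \<open>0\<close> and \<open>1\<close>, so their quotient involves only coefficients of index at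
  least \<open>2\<close>, and \<open>binom\<close> makes these vanish at \<open>N\<close>. Hence
  \<open>h [^] N\<close> is trivial.\<close>

lemma lcs_exponent_step:
  assumes gen: "generate G {x, y} = carrier G" and xy: "x \<in> carrier G" "y \<in> carrier G"
    and y: "y [^] (N::nat) = \<one>"
    and higher: "\<And>h. h \<in> lcs G (Suc (Suc (Suc k))) \<Longrightarrow> h [^] N = \<one>"
    and binom: "\<And>h i. 2 \<le> i \<Longrightarrow> h \<in> lcs G (Suc k + i) \<Longrightarrow> h [^] (N choose i) = \<one>"
    and g: "g \<in> lcs G (Suc (Suc k))"
  shows "g [^] N = \<one>"
proof -
  let ?T = "{g \<in> lcs G (Suc (Suc k)). g [^] N = \<one>}"
  \<comment> \<open>The degree is one less than the weight of \<open>h\<close>, since the exponent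
    \<open>n\<close> accounts for one difference.\<close>
  have pow_seq: "poly_seq G (Suc k) (\<lambda>n. h [^] n)" if "h \<in> lcs G (Suc (Suc k))" for h
    using poly_seq_binomial[of h "Suc k" 1] that by simp
  have vanish: "f N = \<one>" if "poly_seq G (Suc k) f" "f 0 = \<one>" "f 1 = \<one>" for f
  proof (rule poly_seq_eq_one[OF c that(1), where m = 2])
    show "f n = \<one>" if "n < 2" for n
      using \<open>f 0 = \<one>\<close> \<open>f 1 = \<one>\<close> that by (cases n) (auto simp: less_2_cases_iff)
  qed (use binom in auto)
  have T: "subgroup ?T G"
  proof (rule subgroupI)
    show "?T \<subseteq> carrier G" using lcs_carrier by blast
    have "\<one> \<in> ?T" by simp
    then show "?T \<noteq> {}" by blast
  next
    fix a assume "a \<in> ?T"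
    then show "inv a \<in> ?T" using nat_pow_inv[of a N] by auto
  next
    fix a b assume "a \<in> ?T" "b \<in> ?T"
    then have a: "a \<in> lcs G (Suc (Suc k))" "a [^] N = \<one>" and b: "b \<in> lcs G (Suc (Suc k))" "b [^] N = \<one>"
      by simp_all
    \<comment> \<open>This \<open>f\<close> measures how far the power \<open>n\<close> is from
      being multiplicative; it is trivial at \<open>0\<close> and \<open>1\<close>, hence at
      \<open>N\<close>.\<close>
    define f where "f = (\<lambda>n::nat. inv (b [^] n) \<otimes> (inv (a [^] n) \<otimes> (a \<otimes> b) [^] n))"
    have "poly_seq G (Suc k) f"
      unfolding f_def using a b
      by (intro poly_seq_mult[OF c] poly_seq_inv pow_seq lcs_mult)
    moreover have "f 0 = \<one>" "f 1 = \<one>"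
      using lcs_carrier[OF a(1)] lcs_carrier[OF b(1)] by (simp_all add: f_def)
    ultimately have "f N = \<one>" by (rule vanish)
    then have "(a \<otimes> b) [^] N = \<one>"
      using a b lcs_carrier[OF a(1)] lcs_carrier[OF b(1)] by (simp add: f_def)
    then show "a \<otimes> b \<in> ?T"
      using a b by simp
  qed
  have "lcs G (Suc (Suc k)) \<subseteq> ?T"
  proof (rule lcs_subset_of_generators[OF _ gen T])
    show "lcs G (Suc (Suc (Suc k))) \<subseteq> ?T"
      using higher by (auto intro: lcs_antimonoD)
  next
    fix a t assume at: "a \<in> {x, y}" "set t \<subseteq> {x, y}" "length t = Suc k"
    define h where "h = foldl (gcomm G) a t"
    have t: "set t \<subseteq> carrier G" using at xy by auto
    have h: "h \<in> lcs G (Suc (Suc k))"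
      unfolding h_def using foldl_gcomm_in_lcs[of a 1 t] at xy t by auto
    have y_seq: "poly_seq G 0 (\<lambda>n. y [^] n)"
      using poly_seq_binomial[of y 0 1] xy by simp
    have "h = \<one> \<or> (\<exists>f. poly_seq G (Suc k) f \<and> f 0 = \<one> \<and> f 1 = h \<and> f N = \<one>)"
    proof (cases "a = y")
      case True
      have "poly_seq G (Suc k) (\<lambda>n. foldl (gcomm G) (y [^] n) t)"
        using poly_seq_foldl_gcomm[OF y_seq t] at by simp
      then show ?thesis
        using foldl_gcomm_one[OF t] xy y True unfolding h_def
        by (intro disjI2 exI[of _ "\<lambda>n. foldl (gcomm G) (y [^] n) t"]) simp
    next
      case False
      then have [simp]: "a = x" using at by simp
      obtain b t' where bt: "t = b # t'" using at by (cases t) auto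
      show ?thesis
      proof (cases "b = y")
        case True
        have "poly_seq G (1 + 0) (\<lambda>n. gcomm G x (y [^] n))"
          using xy by (intro poly_seq_gcomm[OF c] poly_seq_const y_seq) simp
        then have "poly_seq G (Suc k) (\<lambda>n. foldl (gcomm G) (gcomm G x (y [^] n)) t')"
          using poly_seq_foldl_gcomm[of 1 "\<lambda>n. gcomm G x (y [^] n)" t'] t at bt by simp
        then show ?thesis
          using foldl_gcomm_one[of t'] xy y t bt True unfolding h_def
          by (intro disjI2 exI[of _ "\<lambda>n. foldl (gcomm G) (gcomm G x (y [^] n)) t'"]) simp
      next
        case False
        then have "b = x" using at bt by simp
        then show ?thesis
          using foldl_gcomm_one[of t'] t bt xy by (simp add: h_def)
      qed
    qed
    then have "h [^] N = \<one>"
    proof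
      assume "\<exists>f. poly_seq G (Suc k) f \<and> f 0 = \<one> \<and> f 1 = h \<and> f N = \<one>"
      then obtain f where f: "poly_seq G (Suc k) f" "f 0 = \<one>" "f 1 = h" "f N = \<one>" by blast
      have "inv (h [^] N) \<otimes> f N = \<one>"
        by (rule vanish[of "\<lambda>n. inv (h [^] n) \<otimes> f n"])
          (use f h in \<open>simp_all add: poly_seq_mult[OF c] poly_seq_inv pow_seq\<close>)
      then show ?thesis
        using f h lcs_carrier[OF h] by (metis inv_closed inv_inv inv_one nat_pow_closed r_one)
    qed simp
    then show "foldl (gcomm G) a t \<in> ?T"
      using h by (simp add: h_def)
  qed (use xy in auto)
  then show ?thesis using g by blast
qed

end

lemma gcomm_prime_power_eq_one_of_generate:
  assumes p: "Factorial_Ring.prime p" and c: "lcs G (Suc (Suc p)) = {\<one>}"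
    and gen: "generate G {x, y} = carrier G" and xy: "x \<in> carrier G" "y \<in> carrier G"
    and y: "y [^] (p ^ b) = \<one>"
  shows "gcomm G y (x [^] (p ^ Suc b)) = \<one>"
proof -
  have one: "h = \<one>" if "h \<in> lcs G k" "Suc p < k" for h k
    using lcs_antimonoD[OF that(1), of "Suc (Suc p)"] that(2) c by simp
  have three: "g [^] (p ^ b) = \<one>" if "g \<in> lcs G (Suc (Suc (Suc k)))" for g k
  proof -
    have "g [^] (p ^ b) = \<one>" if "p \<le> k + d" "g \<in> lcs G (Suc (Suc (Suc k)))" for d k g
      using that
    proof (induction d arbitrary: k g)
      case 0
      then show ?case using one[OF 0(2)] by simp
    next
      case (Suc d)
      show ?case
      proof (rule lcs_exponent_step[OF c gen xy y _ _ Suc.prems(2)])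
        fix h assume "h \<in> lcs G (Suc (Suc (Suc (Suc k))))"
        then show "h [^] p ^ b = \<one>" using Suc.IH[of "Suc k" h] Suc.prems(1) by simp
      next
        fix h i assume hi: "2 \<le> i" "h \<in> lcs G (Suc (Suc k) + i)"
        show "h [^] (p ^ b choose i) = \<one>"
        \<comment> \<open>For \<open>p \<le> i\<close> the weight \<open>Suc (Suc k) + i\<close>
          exceeds \<open>p + 1\<close>, so the index \<open>p\<close>, at which divisibility by
          \<open>p ^ b\<close> may fail, does not arise.\<close>
        proof (cases "i < p")
          case True
          have "h \<in> lcs G (Suc (Suc (Suc (Suc k))))" using hi by (auto intro: lcs_antimonoD)
          then have "h [^] p ^ b = \<one>" using Suc.IH[of "Suc k" h] Suc.prems(1) by simp
          then show ?thesis
            using hi True by (intro pow_eq_one_dvd[OF _ _ prime_power_dvd_binomial[OF p]]) auto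
        next
          case False
          then show ?thesis using one[OF hi(2)] by simp
        qed
      qed
    qed
    from this[of k p g] that show ?thesis by simp
  qed
  have y': "y [^] (p ^ Suc b) = \<one>"
    using y xy by (intro pow_eq_one_dvd[OF _ y]) auto
  \<comment> \<open>In weight \<open>p + 1\<close> the index \<open>i = p\<close> does arise.
    Divisibility by \<open>p ^ b\<close> is what remains there, and this is exactly the exponent
    supplied by \<open>three\<close>.\<close>
  have binom: "h [^] (p ^ Suc b choose i) = \<one>" if "2 \<le> i" "h \<in> lcs G (Suc 0 + i)" for h i
  proof (cases "i \<le> p")
    case True
    have "h \<in> lcs G (Suc (Suc (Suc 0)))" using that by (auto intro: lcs_antimonoD)
    then have "h [^] p ^ b = \<one>" using three by blast
    then show ?thesis
      using that True lcs_carrier[OF that(2)]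
      by (intro pow_eq_one_dvd[OF _ _ prime_power_dvd_binomial_Suc[OF p]]) auto
  next
    case False
    then show ?thesis using one[OF that(2)] by simp
  qed
  have two: "g [^] (p ^ Suc b) = \<one>" if "g \<in> lcs G (Suc (Suc 0))" for g
  proof (rule lcs_exponent_step[OF c gen xy y' _ binom that])
    fix h assume h: "h \<in> lcs G (Suc (Suc (Suc 0)))"
    show "h [^] p ^ Suc b = \<one>"
      by (rule pow_eq_one_dvd[OF lcs_carrier[OF h] three[OF h]]) simp
  qed
  have seq: "poly_seq G (1 + 0) (\<lambda>n. gcomm G y (x [^] n))"
    using poly_seq_binomial[of x 0 1] xy by (intro poly_seq_gcomm[OF c] poly_seq_const) simp_all
  show ?thesis
  proof (rule poly_seq_eq_one[OF c seq, where m = 1])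
    show "gcomm G y (x [^] k) = \<one>" if "k < 1" for k :: nat
      using that xy by simp
  next
    fix i h assume i: "1 \<le> i" and h: "h \<in> lcs G (1 + 0 + i)"
    show "h [^] (p ^ Suc b choose i) = \<one>"
    proof (cases "i = 1")
      case True
      then show ?thesis using two h by simp
    next
      case False
      then show ?thesis using binom[of i h] i h by simp
    qed
  qed
qed

text \<open>The exponent bounds come from commutators in \<open>x\<close> and \<open>y\<close>
  alone, so the argument takes place in the subgroup \<open>K\<close> generated by these two
  elements.\<close>

lemma gcomm_prime_power_eq_one:
  assumes p: "Factorial_Ring.prime p" and c: "lcs G (Suc (Suc p)) = {\<one>}"
    and xy: "x \<in> carrier G" "y \<in> carrier G" and y: "y [^] (p ^ b) = \<one>"
  shows "gcomm G y (x [^] (p ^ Suc b)) = \<one>"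
proof -
  define K where "K = generate G {x, y}"
  have K: "subgroup K G" unfolding K_def using xy by (intro generate_is_subgroup) simp
  let ?K = "G\<lparr>carrier := K\<rparr>"
  interpret K: group ?K using K by (rule subgroup_imp_group)
  have xyK: "{x, y} \<subseteq> K" unfolding K_def by (auto intro: generate.incl)
  have "gcomm ?K y (x [^]\<^bsub>?K\<^esub> (p ^ Suc b)) = \<one>\<^bsub>?K\<^esub>"
  proof (rule K.gcomm_prime_power_eq_one_of_generate[OF p])
    show "lcs ?K (Suc (Suc p)) = {\<one>\<^bsub>?K\<^esub>}"
      using lcs_subgroup_mono[OF K, of "Suc (Suc p)"] c K.lcs_one[of "Suc (Suc p)"] by auto
    show "generate ?K {x, y} = carrier ?K"
      using generate_consistent[OF xyK K] by (simp add: K_def)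
    show "y [^]\<^bsub>?K\<^esub> (p ^ b) = \<one>\<^bsub>?K\<^esub>"
      using y by (simp add: nat_pow_consistent[symmetric])
  qed (use xyK in auto)
  moreover have "x [^]\<^bsub>?K\<^esub> (p ^ Suc b) = x [^] (p ^ Suc b)"
    by (simp add: nat_pow_consistent[symmetric])
  moreover have "x [^] (p ^ Suc b) \<in> K"
    using K.nat_pow_closed[of x "p ^ Suc b"] xyK calculation(2) by simp
  ultimately show ?thesis
    using xyK by (simp add: gcomm_def m_inv_consistent[OF K])
qed

end

section \<open>Noncommutative power series and the Magnus map\<close>

text \<open>The Cauchy product over all cuts of a word into two; see
  \<open>word_conv_eq_sum\<close>. In this recursive form the ring laws are inductions on the word
  with \<open>f\<close> generalised.\<close>

fun word_conv :: "(nat list \<Rightarrow> int) \<Rightarrow> (nat list \<Rightarrow> int) \<Rightarrow> nat list \<Rightarrow> int" where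
  "word_conv f g [] = f [] * g []"
| "word_conv f g (i # u) = f [] * g (i # u) + word_conv (\<lambda>v. f (i # v)) g u"

lemma word_conv_eq_sum:
  "word_conv f g u = (\<Sum>k\<le>length u. f (take k u) * g (drop k u))"
  by (induction u arbitrary: f) (simp_all add: sum.atMost_Suc_shift del: sum.atMost_Suc)

lemma word_conv_add_left:
  "word_conv (\<lambda>v. f v + g v) h u = word_conv f h u + word_conv g h u"
  by (induction u arbitrary: f g) (simp_all add: algebra_simps)

lemma word_conv_add_right:
  "word_conv f (\<lambda>v. g v + h v) u = word_conv f g u + word_conv f h u"
  by (induction u arbitrary: f) (simp_all add: algebra_simps)

lemma word_conv_scale:
  "word_conv (\<lambda>v. c * f v) g u = c * word_conv f g u"
  by (induction u arbitrary: f) (simp_all add: algebra_simps)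

lemma word_conv_zero_left: "word_conv (\<lambda>v. 0) g u = 0"
  by (induction u) simp_all

lemma word_conv_assoc:
  "word_conv (word_conv f g) h u = word_conv f (word_conv g h) u"
  by (induction u arbitrary: f)
    (simp_all add: word_conv_add_left word_conv_scale algebra_simps)

text \<open>Formal power series in noncommuting indeterminates \<open>X_i\<close>, given by the coefficient of each word.\<close>

typedef ncseries = "UNIV :: (nat list \<Rightarrow> int) set"
  morphisms nc_coeff Abs_ncseries
  by simp

lemma nc_coeff_Abs [simp]: "nc_coeff (Abs_ncseries f) = f"
  by (simp add: Abs_ncseries_inverse)

lemma ncseries_eqI: "(\<And>u. nc_coeff P u = nc_coeff Q u) \<Longrightarrow> P = Q"
  by (metis ext nc_coeff_inject)

instantiation ncseries :: ring_1
begin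

definition "0 = Abs_ncseries (\<lambda>u. 0)"
definition "1 = Abs_ncseries (\<lambda>u. if u = [] then 1 else 0)"
definition "P + Q = Abs_ncseries (\<lambda>u. nc_coeff P u + nc_coeff Q u)"
definition "P - Q = Abs_ncseries (\<lambda>u. nc_coeff P u - nc_coeff Q u)"
definition "- P = Abs_ncseries (\<lambda>u. - nc_coeff P u)"
definition "P * Q = Abs_ncseries (word_conv (nc_coeff P) (nc_coeff Q))"

lemma nc_coeff_0 [simp]: "nc_coeff 0 u = 0"
  and nc_coeff_1: "nc_coeff 1 u = (if u = [] then 1 else 0)"
  and nc_coeff_add [simp]: "nc_coeff (P + Q) u = nc_coeff P u + nc_coeff Q u"
  and nc_coeff_diff [simp]: "nc_coeff (P - Q) u = nc_coeff P u - nc_coeff Q u"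
  and nc_coeff_minus [simp]: "nc_coeff (- P) u = - nc_coeff P u"
  and nc_coeff_mult: "nc_coeff (P * Q) u = word_conv (nc_coeff P) (nc_coeff Q) u"
  by (simp_all add: zero_ncseries_def one_ncseries_def plus_ncseries_def minus_ncseries_def
      uminus_ncseries_def times_ncseries_def)

instance
proof
  fix P Q R :: ncseries
  have one: "word_conv (\<lambda>u. if u = [] then 1 else 0) f u = f u" for f u
    by (cases u) (simp_all add: word_conv_zero_left)
  have one': "word_conv f (\<lambda>u. if u = [] then 1 else 0) u = f u" for f u
    by (induction u arbitrary: f) simp_all
  show "1 * P = P" "P * 1 = P"
    by (rule ncseries_eqI, simp add: nc_coeff_mult nc_coeff_1[abs_def] one one')+
  have fn: "nc_coeff (P + Q) = (\<lambda>u. nc_coeff P u + nc_coeff Q u)"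
    "nc_coeff (P * Q) = word_conv (nc_coeff P) (nc_coeff Q)" for P Q
    by (simp_all add: fun_eq_iff nc_coeff_mult)
  show "P * Q * R = P * (Q * R)" "(P + Q) * R = P * R + Q * R" "P * (Q + R) = P * Q + P * R"
    by (rule ncseries_eqI,
        simp add: nc_coeff_mult fn word_conv_assoc word_conv_add_left word_conv_add_right)+
  have "nc_coeff (0 :: ncseries) [] \<noteq> nc_coeff 1 []"
    by (simp add: nc_coeff_1)
  then show "(0 :: ncseries) \<noteq> 1" by metis
qed (rule ncseries_eqI, simp)+

end

lemma nc_coeff_mult_eq_sum:
  "nc_coeff (P * Q) u = (\<Sum>k\<le>length u. nc_coeff P (take k u) * nc_coeff Q (drop k u))"
  by (simp add: nc_coeff_mult word_conv_eq_sum)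

lemma nc_coeff_mult_Nil [simp]: "nc_coeff (P * Q) [] = nc_coeff P [] * nc_coeff Q []"
  by (simp add: nc_coeff_mult)

definition nc_X :: "nat \<Rightarrow> ncseries" where
  "nc_X i = Abs_ncseries (\<lambda>u. if u = [i] then 1 else 0)"

lemma nc_coeff_X: "nc_coeff (nc_X i) u = (if u = [i] then 1 else 0)"
  by (simp add: nc_X_def)

lemma nc_coeff_X_mult:
  "nc_coeff (nc_X i * P) u = (case u of [] \<Rightarrow> 0 | j # v \<Rightarrow> if j = i then nc_coeff P v else 0)"
proof (cases u)
  case (Cons j v)
  have "(\<lambda>v. nc_coeff (nc_X i) (j # v)) = (\<lambda>v. if v = [] then (if j = i then 1 else 0) else 0)"
    by (simp add: nc_coeff_X fun_eq_iff)
  moreover have "word_conv (\<lambda>v. if v = [] then c else 0) f v = c * f v" for c f v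
    by (cases v) (simp_all add: word_conv_zero_left)
  ultimately show ?thesis
    using Cons by (simp add: nc_coeff_mult) (simp add: nc_coeff_X)
qed (simp add: nc_coeff_X)

lemma nc_coeff_mult_X:
  "nc_coeff (P * nc_X i) u = (if u \<noteq> [] \<and> last u = i then nc_coeff P (butlast u) else 0)"
proof -
  have "word_conv f (nc_coeff (nc_X i)) u = (if u \<noteq> [] \<and> last u = i then f (butlast u) else 0)" for f
  proof (induction u arbitrary: f)
    case (Cons j u)
    show ?case
      by (simp add: Cons, cases u) (simp_all add: nc_coeff_X)
  qed (simp add: nc_coeff_X)
  then show ?thesis by (simp add: nc_coeff_mult)
qed

definition nc_order_ge :: "nat \<Rightarrow> ncseries \<Rightarrow> bool" where
  "nc_order_ge k P \<longleftrightarrow> (\<forall>u. length u < k \<longrightarrow> nc_coeff P u = 0)"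

lemma nc_order_ge_add: "nc_order_ge k P \<Longrightarrow> nc_order_ge k Q \<Longrightarrow> nc_order_ge k (P + Q)"
  and nc_order_ge_diff: "nc_order_ge k P \<Longrightarrow> nc_order_ge k Q \<Longrightarrow> nc_order_ge k (P - Q)"
  and nc_order_ge_X: "nc_order_ge 1 (nc_X i)"
  and nc_order_ge_0: "nc_order_ge 0 P"
  by (auto simp: nc_order_ge_def nc_coeff_X)

lemma nc_order_ge_mono: "nc_order_ge k P \<Longrightarrow> l \<le> k \<Longrightarrow> nc_order_ge l P"
  by (auto simp: nc_order_ge_def)

lemma nc_order_ge_mult:
  assumes "nc_order_ge k P" "nc_order_ge l Q"
  shows "nc_order_ge (k + l) (P * Q)"
  unfolding nc_order_ge_def nc_coeff_mult_eq_sum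
proof (intro allI impI sum.neutral ballI)
  fix u :: "nat list" and n assume u: "length u < k + l" and n: "n \<in> {..length u}"
  show "nc_coeff P (take n u) * nc_coeff Q (drop n u) = 0"
  proof (cases "n < k")
    case True
    then show ?thesis using assms(1) n by (simp add: nc_order_ge_def)
  next
    case False
    then have "length (drop n u) < l" using u n by simp
    then show ?thesis using assms(2) by (simp add: nc_order_ge_def)
  qed
qed

lemma nc_order_ge_mult_left: "nc_order_ge k P \<Longrightarrow> nc_order_ge k (Q * P)"
  using nc_order_ge_mult[OF nc_order_ge_0, of k P Q] by simp

lemma nc_order_ge_mult_right: "nc_order_ge k P \<Longrightarrow> nc_order_ge k (P * Q)"
  using nc_order_ge_mult[OF _ nc_order_ge_0, of k P Q] by simp

lemma nc_coeff_one_plus_X_power: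
  "nc_coeff ((1 + nc_X i) ^ n) u = (if set u \<subseteq> {i} then int (n choose length u) else 0)"
proof (induction n arbitrary: u)
  case 0
  then show ?case by (cases u) (simp_all add: nc_coeff_1)
next
  case (Suc n)
  show ?case
    by (cases u) (simp_all add: Suc distrib_right nc_coeff_X_mult nc_coeff_X)
qed

definition nc_X_inverse :: "nat \<Rightarrow> ncseries" where
  "nc_X_inverse i = Abs_ncseries (\<lambda>u. if set u \<subseteq> {i} then (- 1) ^ length u else 0)"

lemma nc_X_inverse:
  "(1 + nc_X i) * nc_X_inverse i = 1" "nc_X_inverse i * (1 + nc_X i) = 1"
proof -
  show "(1 + nc_X i) * nc_X_inverse i = 1"
  proof (rule ncseries_eqI)
    fix u show "nc_coeff ((1 + nc_X i) * nc_X_inverse i) u = nc_coeff 1 u"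
      by (cases u) (auto simp: distrib_right nc_coeff_X_mult nc_X_inverse_def nc_coeff_1 nc_coeff_X)
  qed
  show "nc_X_inverse i * (1 + nc_X i) = 1"
  proof (rule ncseries_eqI)
    fix u show "nc_coeff (nc_X_inverse i * (1 + nc_X i)) u = nc_coeff 1 u"
      by (cases u rule: rev_cases)
        (auto simp: distrib_left nc_coeff_mult_X nc_X_inverse_def nc_coeff_1 nc_coeff_X)
  qed
qed

definition magnus :: "word \<Rightarrow> ncseries" where
  "magnus w = prod_list (map (\<lambda>a. if snd a then 1 + nc_X (fst a) else nc_X_inverse (fst a)) w)"

lemma magnus_Nil [simp]: "magnus [] = 1"
  and magnus_Cons: "magnus ((i, b) # w) = (if b then 1 + nc_X i else nc_X_inverse i) * magnus w"
  by (simp_all add: magnus_def)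

lemma magnus_push_letter: "magnus (push_letter a w) = magnus [a] * magnus w"
proof (induction a w rule: push_letter.induct)
  case (2 a b w)
  obtain i s where a: "a = (i, s)" by (cases a)
  show ?case
  proof (cases "b = inv_letter a")
    case True
    have "magnus [a] * magnus (b # w) = (magnus [a] * magnus [b]) * magnus w"
      by (cases b) (simp add: magnus_Cons mult.assoc)
    also have "magnus [a] * magnus [b] = 1"
      using a True by (simp add: magnus_Cons inv_letter_def nc_X_inverse)
    finally show ?thesis using True by simp
  qed (simp add: a magnus_Cons)
qed simp

lemma magnus_foldr_push: "magnus (foldr push_letter u v) = magnus u * magnus v"
proof (induction u)
  case (Cons a u)
  then show ?case
    by (cases a) (simp add: magnus_push_letter magnus_Cons mult.assoc)
qed simp

text \<open>The left-normed Lie bracket of indeterminates, which by \<open>M_left_normed\<close> is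
  the leading term of the Magnus series of the corresponding group commutator.\<close>

definition lie_series :: "nat \<Rightarrow> nat list \<Rightarrow> ncseries" where
  "lie_series i t = foldl (\<lambda>P j. P * nc_X j - nc_X j * P) (nc_X i) t"

lemma lie_series_Nil [simp]: "lie_series i [] = nc_X i"
  and lie_series_snoc:
    "lie_series i (t @ [j]) = lie_series i t * nc_X j - nc_X j * lie_series i t"
  by (simp_all add: lie_series_def)

lemma nc_coeff_lie_series_snoc:
  "nc_coeff (lie_series i (t @ [j])) u =
     (if u \<noteq> [] \<and> last u = j then nc_coeff (lie_series i t) (butlast u) else 0) -
     (if u \<noteq> [] \<and> hd u = j then nc_coeff (lie_series i t) (tl u) else 0)"
  by (cases u) (simp_all add: lie_series_snoc nc_coeff_mult_X nc_coeff_X_mult)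

text \<open>Multihomogeneity of the bracket, which later keeps the multidegrees apart.\<close>

lemma nc_coeff_lie_series_eq_0:
  "mset u \<noteq> mset (i # t) \<Longrightarrow> nc_coeff (lie_series i t) u = 0"
proof (induction t arbitrary: u rule: rev_induct)
  case (snoc j t)
  have "nc_coeff (lie_series i t) (butlast u) = 0" if "u \<noteq> []" "last u = j"
  proof (rule snoc.IH)
    have "mset u = mset (butlast u) + {#j#}"
      using that by (metis append_butlast_last_id mset_append mset_single_iff_right mset.simps)
    then show "mset (butlast u) \<noteq> mset (i # t)" using snoc.prems by auto
  qed
  moreover have "nc_coeff (lie_series i t) (tl u) = 0" if "u \<noteq> []" "hd u = j"
  proof (rule snoc.IH)
    have "mset u = add_mset j (mset (tl u))"
      using that by (metis list.collapse mset.simps(2))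
    then show "mset (tl u) \<noteq> mset (i # t)" using snoc.prems by auto
  qed
  ultimately show ?case by (simp add: nc_coeff_lie_series_snoc)
qed (auto simp: nc_coeff_X)

lemma nc_order_ge_lie_series: "nc_order_ge (Suc (length t)) (lie_series i t)"
  unfolding nc_order_ge_def
proof (intro allI impI)
  fix u :: "nat list" assume "length u < Suc (length t)"
  then have "mset u \<noteq> mset (i # t)" by (metis length_Cons less_irrefl mset_eq_length)
  then show "nc_coeff (lie_series i t) u = 0" by (rule nc_coeff_lie_series_eq_0)
qed

text \<open>Subtract \<open>f' * g' * (g * f) = 1\<close>; the additive commutator of
  \<open>f\<close> and \<open>g\<close> does not change when \<open>1\<close> is taken from
  both.\<close>

lemma commutator_minus_one:
  fixes f g f' g' :: "'a :: ring_1"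
  assumes "f' * f = 1" "g' * g = 1"
  shows "f' * g' * f * g - 1 = f' * g' * ((f - 1) * (g - 1) - (g - 1) * (f - 1))"
proof -
  have "f' * g' * (g * f) = f' * (g' * g) * f" by (simp add: mult.assoc)
  then have "f' * g' * (g * f) = 1" using assms by simp
  then show ?thesis by (simp add: algebra_simps)
qed

lemma nc_order_ge_commutator:
  assumes "f' * f = 1" "g' * g = 1" "nc_order_ge k (f - 1)" "nc_order_ge l (g - 1)"
  shows "nc_order_ge (k + l) (f' * g' * f * g - 1)"
  unfolding commutator_minus_one[OF assms(1,2)]
  using nc_order_ge_mult[OF assms(3,4)] nc_order_ge_mult[OF assms(4,3), unfolded add.commute[of l]]
  by (rule nc_order_ge_mult_left[OF nc_order_ge_diff])

lemma nc_order_ge_inverse: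
  fixes f f' :: ncseries
  assumes "f' * f = 1" "nc_order_ge k (f - 1)"
  shows "nc_order_ge k (f' - 1)"
proof -
  have "f' - 1 = - 1 * (f' * (f - 1))"
    using assms(1) by (simp add: algebra_simps)
  then show ?thesis using assms(2) by (metis nc_order_ge_mult_left)
qed

text \<open>The factor \<open>f' * g'\<close> differs from \<open>1\<close> by positive order, and
  the bracket with \<open>nc_X j\<close> raises the order of the error \<open>E\<close> by one, so
  both contributions lie beyond order \<open>Suc k\<close>.\<close>

lemma nc_commutator_leading_term:
  fixes f f' g' L :: ncseries
  assumes inv: "f' * f = 1" "g' * (1 + nc_X j) = 1"
    and L: "nc_order_ge k L" "nc_order_ge (Suc k) (f - 1 - L)" and k: "1 \<le> k"
  shows "nc_order_ge (Suc (Suc k)) (f' * g' * f * (1 + nc_X j) - 1 - (L * nc_X j - nc_X j * L))"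
proof -
  define E where "E = f - 1 - L"
  define W where "W = (f - 1) * nc_X j - nc_X j * (f - 1)"
  have "nc_order_ge k (E + L)"
    using nc_order_ge_mono[OF L(2)] L(1) by (intro nc_order_ge_add) (simp_all add: E_def)
  then have f: "nc_order_ge k (f - 1)" by (simp add: E_def)
  have "nc_order_ge 1 (f' - 1)" "nc_order_ge 1 (g' - 1)"
    using nc_order_ge_inverse[OF inv(1) f] nc_order_ge_inverse[OF inv(2), of 1] k nc_order_ge_X
    by (auto intro: nc_order_ge_mono)
  then have "nc_order_ge 1 ((f' - 1) * g' + (g' - 1))"
    by (intro nc_order_ge_add nc_order_ge_mult_right)
  then have fg: "nc_order_ge 1 (f' * g' - 1)" by (simp add: algebra_simps)
  have W: "nc_order_ge (Suc k) W"
    unfolding W_def using nc_order_ge_mult[OF f nc_order_ge_X] nc_order_ge_mult[OF nc_order_ge_X f]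
    by (intro nc_order_ge_diff) simp_all
  have "f' * g' * f * (1 + nc_X j) - 1 = f' * g' * W"
    using commutator_minus_one[OF inv] by (simp add: W_def)
  then have "f' * g' * f * (1 + nc_X j) - 1 - (L * nc_X j - nc_X j * L)
      = (f' * g' - 1) * W + (E * nc_X j - nc_X j * E)"
    by (simp add: W_def E_def algebra_simps)
  moreover have "nc_order_ge (Suc (Suc k)) (E * nc_X j - nc_X j * E)"
    using nc_order_ge_mult[OF L(2) nc_order_ge_X] nc_order_ge_mult[OF nc_order_ge_X L(2)]
    by (intro nc_order_ge_diff) (simp_all add: E_def)
  ultimately show ?thesis
    using nc_order_ge_mult[OF fg W] by (auto intro: nc_order_ge_add)
qed

section \<open>Brackets in the top term of the lower central series\<close>

text \<open>The entries of the list lie in terms of the lower central series whose indices add up to \<open>n\<close>.\<close>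

inductive weighted :: "('a, 'b) monoid_scheme \<Rightarrow> nat \<Rightarrow> 'a list \<Rightarrow> bool" for G where
  Nil: "weighted G 0 []"
| Cons: "1 \<le> k \<Longrightarrow> b \<in> lcs G k \<Longrightarrow> weighted G n t \<Longrightarrow> weighted G (k + n) (b # t)"

context group
begin

lemma weighted_carrier: "weighted G n t \<Longrightarrow> set t \<subseteq> carrier G"
  by (induction rule: weighted.induct) auto

lemma weighted_length:
  assumes "set t \<subseteq> carrier G"
  shows "weighted G (length t) t"
  using assms
proof (induction t)
  case (Cons b t)
  then show ?case
    using weighted.Cons[of 1 b G "length t" t] by simp
qed (simp add: weighted.Nil)

lemma weighted_append: "weighted G m s \<Longrightarrow> weighted G n t \<Longrightarrow> weighted G (m + n) (s @ t)"
  by (induction rule: weighted.induct) (simp_all add: add.assoc weighted.Cons)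

lemma foldl_gcomm_weighted:
  "weighted G n t \<Longrightarrow> a \<in> lcs G i \<Longrightarrow> foldl (gcomm G) a t \<in> lcs G (i + n)"
proof (induction arbitrary: a i rule: weighted.induct)
  case (Cons k b n t)
  then show ?case
    using Cons.IH[OF gcomm_lcs_add[OF Cons.prems Cons.hyps(2)]] by (simp add: add.assoc)
qed simp

context
  fixes w assumes w: "lcs G (Suc w) = {\<one>}"
begin

lemma lcs_trivial: "a \<in> lcs G k \<Longrightarrow> w < k \<Longrightarrow> a = \<one>"
  using lcs_antimonoD[of a k "Suc w"] w by simp

lemma lcs_central: "a \<in> lcs G k \<Longrightarrow> w \<le> k \<Longrightarrow> b \<in> carrier G \<Longrightarrow> a \<otimes> b = b \<otimes> a"
  using lcs_trivial[OF gcomm_in_lcs_Suc[of a k b]] gcomm_eq_one_iff by simp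

lemma foldl_gcomm_trivial:
  "weighted G n t \<Longrightarrow> a \<in> lcs G i \<Longrightarrow> w < i + n \<Longrightarrow> foldl (gcomm G) a t = \<one>"
  using foldl_gcomm_weighted lcs_trivial by blast

text \<open>The correction term in \<open>gcomm_mult_left\<close> has both \<open>a\<close> and
  \<open>b\<close> as entries. Once it is continued along \<open>t\<close>, its weight exceeds
  \<open>w\<close>.\<close>

lemma foldl_gcomm_mult:
  assumes "weighted G n t" "a \<in> lcs G i" "b \<in> lcs G i" "1 \<le> i" "w \<le> i + n"
  shows "foldl (gcomm G) (a \<otimes> b) t = foldl (gcomm G) a t \<otimes> foldl (gcomm G) b t"
  using assms
proof (induction arbitrary: a b i rule: weighted.induct)
  case (Cons k x n t)
  have x: "x \<in> carrier G" and ab: "a \<in> carrier G" "b \<in> carrier G"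
    using Cons by simp_all
  have ax: "gcomm G a x \<in> lcs G (i + k)" and bx: "gcomm G b x \<in> lcs G (i + k)"
    using Cons by (simp_all add: gcomm_lcs_add)
  have e: "gcomm G (gcomm G a x) b \<in> lcs G (i + k + i)"
    using gcomm_lcs_add[OF ax] Cons by simp
  have e': "gcomm G (gcomm G a x) b \<in> lcs G (i + k)"
    using e by (rule lcs_antimonoD) simp
  have "foldl (gcomm G) (gcomm G (gcomm G a x) b) t = \<one>"
    by (rule foldl_gcomm_trivial[OF Cons.hyps(3) e]) (use Cons.prems(3,4) Cons.hyps(1) in linarith)
  moreover have le: "1 \<le> i + k" "w \<le> i + k + n" using Cons by simp_all
  ultimately show ?case
    using Cons.IH[OF lcs_mult[OF ax e'] bx le] Cons.IH[OF ax e' le]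
      foldl_gcomm_closed[of _ t] weighted_carrier[OF Cons.hyps(3)] x ab
    by (simp add: gcomm_mult_left)
qed simp

lemma foldl_gcomm_inv:
  assumes "weighted G n t" "a \<in> lcs G i" "1 \<le> i" "w \<le> i + n"
  shows "foldl (gcomm G) (inv a) t = inv (foldl (gcomm G) a t)"
proof -
  have "foldl (gcomm G) (inv a) t \<otimes> foldl (gcomm G) a t = \<one>"
    using foldl_gcomm_mult[OF assms(1) lcs_inv[OF assms(2)] assms(2-)] assms
      foldl_gcomm_one weighted_carrier by simp
  then show ?thesis
    using assms weighted_carrier by (intro inv_equality[symmetric]) (auto simp: foldl_gcomm_closed)
qed

lemma foldl_gcomm_mult_second:
  assumes "weighted G n t" "a \<in> lcs G i" "b \<in> lcs G k" "b' \<in> lcs G k" "1 \<le> i" "1 \<le> k" "w \<le> i + k + n"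
  shows "foldl (gcomm G) a ((b \<otimes> b') # t) = foldl (gcomm G) a (b # t) \<otimes> foldl (gcomm G) a (b' # t)"
proof -
  have ab: "gcomm G a b \<in> lcs G (i + k)" and ab': "gcomm G a b' \<in> lcs G (i + k)"
    using assms by (simp_all add: gcomm_lcs_add)
  have e: "gcomm G (gcomm G a b) b' \<in> lcs G (i + k + k)"
    using gcomm_lcs_add[OF ab assms(4)] .
  then have e': "gcomm G (gcomm G a b) b' \<in> lcs G (i + k)"
    by (rule lcs_antimonoD) simp
  have le: "1 \<le> i + k" using assms by simp
  have cl: "foldl (gcomm G) (gcomm G a b) t \<in> lcs G (i + k + n)"
    "foldl (gcomm G) (gcomm G a b') t \<in> lcs G (i + k + n)"
    using assms(1) ab ab' by (simp_all add: foldl_gcomm_weighted)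
  have "foldl (gcomm G) (gcomm G (gcomm G a b) b') t = \<one>"
    using assms by (intro foldl_gcomm_trivial[OF assms(1) e]) simp
  then have "foldl (gcomm G) (gcomm G a b' \<otimes> gcomm G a b \<otimes> gcomm G (gcomm G a b) b') t
      = foldl (gcomm G) (gcomm G a b') t \<otimes> foldl (gcomm G) (gcomm G a b) t"
    using foldl_gcomm_mult[OF assms(1) lcs_mult[OF ab' ab] e' le assms(7)]
      foldl_gcomm_mult[OF assms(1) ab' ab le assms(7)] lcs_carrier[OF cl(1)] lcs_carrier[OF cl(2)] by simp
  also have "\<dots> = foldl (gcomm G) (gcomm G a b) t \<otimes> foldl (gcomm G) (gcomm G a b') t"
    by (rule lcs_central[OF cl(2) assms(7) lcs_carrier[OF cl(1)]])
  finally show ?thesis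
    using lcs_carrier[OF assms(2)] lcs_carrier[OF assms(3)] lcs_carrier[OF assms(4)]
    by (simp add: gcomm_mult_right)
qed

lemma foldl_gcomm_swap:
  assumes "weighted G n t" "a \<in> lcs G i" "b \<in> lcs G k" "1 \<le> i" "1 \<le> k" "w \<le> i + k + n"
  shows "foldl (gcomm G) (gcomm G b a) t = inv (foldl (gcomm G) (gcomm G a b) t)"
  using foldl_gcomm_inv[OF assms(1) gcomm_lcs_add[OF assms(2,3)]] assms
  by (simp add: inv_gcomm lcs_carrier[OF assms(2)] lcs_carrier[OF assms(3)])

text \<open>Hall-Witt becomes the Jacobi identity when weights above \<open>w\<close> are trivial:
  \<open>hw\<close> replaces each conjugate \<open>z \<otimes> gcomm G z x\<close> by
  \<open>z\<close>, and \<open>foldl_gcomm_mult\<close> separates the three factors.\<close>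

lemma foldl_gcomm_jacobi:
  assumes t: "weighted G n t" and a: "a \<in> lcs G i" and b: "b \<in> lcs G j" and c: "c \<in> lcs G k"
    and pos: "1 \<le> i" "1 \<le> j" "1 \<le> k" and le: "w \<le> i + j + k + n"
  shows "foldl (gcomm G) a (gcomm G b c # t)
    = foldl (gcomm G) a (b # c # t) \<otimes> inv (foldl (gcomm G) a (c # b # t))"
proof -
  have cl: "a \<in> carrier G" "b \<in> carrier G" "c \<in> carrier G" using a b c by simp_all
  note ct = weighted_carrier[OF t]
  have hw: "foldl (gcomm G) (gcomm G x y) ((z \<otimes> gcomm G z x) # t) = foldl (gcomm G) (gcomm G (gcomm G x y) z) t"
    "gcomm G (gcomm G x y) (z \<otimes> gcomm G z x) \<in> lcs G (i + j + k)"
    if x: "x \<in> lcs G l" and y: "y \<in> lcs G m" and z: "z \<in> lcs G r"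
      and s: "l + m + r = i + j + k" "1 \<le> l" "1 \<le> m" "1 \<le> r" for x y z l m r
  proof -
    have xy: "gcomm G x y \<in> lcs G (l + m)" using gcomm_lcs_add[OF x y] .
    have zx: "gcomm G z x \<in> lcs G (r + l)" using gcomm_lcs_add[OF z x] .
    then have zx': "gcomm G z x \<in> lcs G r" by (rule lcs_antimonoD) simp
    have "foldl (gcomm G) (gcomm G x y) (gcomm G z x # t) = \<one>"
      using s le foldl_gcomm_trivial[OF t gcomm_lcs_add[OF xy zx]] by simp
    then show "foldl (gcomm G) (gcomm G x y) ((z \<otimes> gcomm G z x) # t) = foldl (gcomm G) (gcomm G (gcomm G x y) z) t"
      using foldl_gcomm_mult_second[OF t xy z zx'] s le x y z ct
      by (simp add: foldl_gcomm_closed)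
    show "gcomm G (gcomm G x y) (z \<otimes> gcomm G z x) \<in> lcs G (i + j + k)"
      using gcomm_lcs_add[OF xy lcs_mult[OF z zx']] s(1) by simp
  qed
  note 1 = hw[OF a b c] and 2 = hw[OF c a b] and 3 = hw[OF b c a]
  let ?A = "foldl (gcomm G) (gcomm G (gcomm G a b) c) t"
  let ?B = "foldl (gcomm G) (gcomm G (gcomm G a c) b) t"
  let ?C = "foldl (gcomm G) (gcomm G a (gcomm G b c)) t"
  have ABC: "?A \<in> lcs G w" "?B \<in> lcs G w" "?C \<in> lcs G w"
    using foldl_gcomm_weighted[OF t gcomm_lcs_add[OF gcomm_lcs_add[OF a b] c]]
      foldl_gcomm_weighted[OF t gcomm_lcs_add[OF gcomm_lcs_add[OF a c] b]]
      foldl_gcomm_weighted[OF t gcomm_lcs_add[OF a gcomm_lcs_add[OF b c]]] le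
    by (auto intro: lcs_antimonoD)
  note cABC = ABC[THEN lcs_carrier]
  have le1: "1 \<le> i + j + k" "w \<le> i + j + k + n" using pos le by simp_all
  have "foldl (gcomm G) (gcomm G (gcomm G a b) (c \<otimes> gcomm G c a) \<otimes> gcomm G (gcomm G c a) (b \<otimes> gcomm G b c)
     \<otimes> gcomm G (gcomm G b c) (a \<otimes> gcomm G a b)) t = \<one>"
    using hall_witt[OF cl] foldl_gcomm_one[OF ct] by simp
  then have "foldl (gcomm G) (gcomm G (gcomm G a b) (c \<otimes> gcomm G c a)) t
     \<otimes> foldl (gcomm G) (gcomm G (gcomm G c a) (b \<otimes> gcomm G b c)) t
     \<otimes> foldl (gcomm G) (gcomm G (gcomm G b c) (a \<otimes> gcomm G a b)) t = \<one>"
    using 1 2 3 pos foldl_gcomm_mult[OF t _ _ le1] by (simp add: add_ac)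
  then have "?A \<otimes> foldl (gcomm G) (gcomm G (gcomm G c a) b) t \<otimes> foldl (gcomm G) (gcomm G (gcomm G b c) a) t = \<one>"
    using 1(1) 2(1) 3(1) pos by (simp add: add_ac)
  moreover have "foldl (gcomm G) (gcomm G (gcomm G c a) b) t = inv ?B"
  proof -
    have ac: "gcomm G a c \<in> lcs G (i + k)" using gcomm_lcs_add[OF a c] .
    have "foldl (gcomm G) (gcomm G (gcomm G c a) b) t = foldl (gcomm G) (inv (gcomm G a c)) (b # t)"
      using cl by (simp add: inv_gcomm)
    also have "\<dots> = inv (foldl (gcomm G) (gcomm G a c) (b # t))"
      using foldl_gcomm_inv[OF weighted.Cons[OF pos(2) b t] ac] pos le by (simp add: add_ac)
    finally show ?thesis by simp
  qed
  moreover have "foldl (gcomm G) (gcomm G (gcomm G b c) a) t = inv ?C"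
    using foldl_gcomm_swap[OF t a gcomm_lcs_add[OF b c]] pos le by (simp add: add_ac)
  ultimately have "?A \<otimes> inv ?B \<otimes> inv ?C = \<one>" by simp
  then have "?A \<otimes> inv ?B = ?C"
    using cABC by (metis inv_closed inv_equality inv_inv m_closed)
  then show ?thesis by simp
qed

lemma foldl_gcomm_pow:
  assumes "weighted G n t" "a \<in> lcs G i" "1 \<le> i" "w \<le> i + n"
  shows "foldl (gcomm G) (a [^] (m::nat)) t = foldl (gcomm G) a t [^] m"
proof (induction m)
  case 0
  then show ?case using foldl_gcomm_one weighted_carrier[OF assms(1)] by simp
next
  case (Suc m)
  then show ?case
    using foldl_gcomm_mult[OF assms(1) lcs_pow[OF assms(2), of m] assms(2-4)] by simp
qed

lemma foldl_gcomm_pow_second: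
  assumes "weighted G n t" "a \<in> lcs G i" "b \<in> lcs G k" "1 \<le> i" "1 \<le> k" "w \<le> i + k + n"
  shows "foldl (gcomm G) a (b [^] (m::nat) # t) = foldl (gcomm G) a (b # t) [^] m"
proof (induction m)
  case 0
  then show ?case using foldl_gcomm_one weighted_carrier[OF assms(1)] assms(2) by simp
next
  case (Suc m)
  then show ?case
    using foldl_gcomm_mult_second[OF assms(1,2) lcs_pow[OF assms(3), of m] assms(3-6)] by simp
qed

text \<open>The bracket has the top weight \<open>w\<close> and is multiplicative in every entry, so
  the exponent can be moved onto \<open>b\<close>.\<close>

lemma foldl_gcomm_pow_eq_one:
  assumes t: "set (a # t) \<subseteq> carrier G" "w = Suc (length t)"
    and b: "b \<in> set (a # t)" "b [^] (m::nat) = \<one>"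
  shows "foldl (gcomm G) a t [^] m = \<one>"
proof (cases "b = a")
  case True
  then show ?thesis
    using foldl_gcomm_pow[OF weighted_length[of t], of a 1 m] foldl_gcomm_one[of t] assms by simp
next
  case False
  then obtain s s' where s: "t = s @ b # s'" using b by (auto dest: split_list)
  have "foldl (gcomm G) a s \<in> lcs G (1 + length s)"
    using foldl_gcomm_in_lcs[of a 1 s] t s by simp
  then have "foldl (gcomm G) (foldl (gcomm G) a s) (b [^] m # s')
      = foldl (gcomm G) (foldl (gcomm G) a s) (b # s') [^] m"
    using t s by (intro foldl_gcomm_pow_second[OF weighted_length, where k = 1]) auto
  then show ?thesis
    using s t b foldl_gcomm_one[of s'] foldl_gcomm_closed[of a s] by simp
qed

end

end

section \<open>Dynkin operators with values in the top term\<close>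

definition words :: "nat set \<Rightarrow> nat \<Rightarrow> nat list set" where
  "words I n = {u. set u \<subseteq> I \<and> length u = n}"

lemma finite_words [simp]: "finite I \<Longrightarrow> finite (words I n)"
  unfolding words_def by (rule finite_lists_length_eq)

text \<open>In additive language: \<open>F\<close> is extended linearly from words to polynomials
  and evaluated at the Lie polynomial \<open>lie_series i t\<close>.\<close>

definition lie_sum :: "('a, 'b) monoid_scheme \<Rightarrow> nat set \<Rightarrow> (nat list \<Rightarrow> 'a) \<Rightarrow> nat \<Rightarrow> nat list \<Rightarrow> 'a" where
  "lie_sum G I F i t =
     finprod G (\<lambda>u. F u [^]\<^bsub>G\<^esub> nc_coeff (lie_series i t) u) (words I (Suc (length t)))"

context comm_group
begin

lemma finprod_inv:
  "f \<in> A \<rightarrow> carrier G \<Longrightarrow> finprod G (\<lambda>x. inv (f x)) A = inv (finprod G f A)"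
proof (induction A rule: infinite_finite_induct)
  case (insert x A)
  then have "f x \<in> carrier G" "f \<in> A \<rightarrow> carrier G" by auto
  moreover from this have "(\<lambda>x. inv (f x)) \<in> A \<rightarrow> carrier G" by auto
  ultimately show ?case using insert by (simp add: inv_mult)
qed simp_all

lemma finprod_words_reindex:
  assumes "finite I" "inj h" "h ` words I n \<subseteq> words I m"
    and "\<And>u. u \<in> words I m \<Longrightarrow> u \<notin> h ` words I n \<Longrightarrow> f u = \<one>"
    and "f \<in> words I m \<rightarrow> carrier G"
  shows "finprod G f (words I m) = finprod G (\<lambda>v. f (h v)) (words I n)"
proof -
  have "finprod G f (words I m) = finprod G f (h ` words I n)"
    using assms by (intro finprod_mono_neutral_cong_right) auto
  also have "\<dots> = finprod G (\<lambda>v. f (h v)) (words I n)"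
    using assms by (intro finprod_reindex) (auto intro: inj_on_subset)
  finally show ?thesis .
qed

lemma lie_sum_Nil:
  assumes "finite I" "i \<in> I" "F \<in> words I 1 \<rightarrow> carrier G"
  shows "lie_sum G I F i [] = F [i]"
proof -
  have i: "[i] \<in> words I 1" using assms by (simp add: words_def)
  have "lie_sum G I F i [] = finprod G (\<lambda>u. if [i] = u then F u else \<one>) (words I 1)"
    unfolding lie_sum_def using assms
    by (intro finprod_cong') (auto simp: nc_coeff_X Pi_iff)
  also have "\<dots> = F [i]"
    using i assms finite_words[OF assms(1)] by (intro finprod_singleton)
  finally show ?thesis .
qed

text \<open>Expands the outermost bracket: words ending in \<open>j\<close> count positively, words
  beginning with \<open>j\<close> negatively.\<close>

lemma lie_sum_snoc:
  assumes I: "finite I" "j \<in> I" and F: "F \<in> words I (Suc (Suc (length t))) \<rightarrow> carrier G"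
  shows "lie_sum G I F i (t @ [j])
    = lie_sum G I (\<lambda>u. F (u @ [j])) i t \<otimes> inv (lie_sum G I (\<lambda>u. F (j # u)) i t)"
proof -
  let ?W = "words I (Suc (Suc (length t)))"
  define c where "c = nc_coeff (lie_series i t)"
  define A where "A u = (if u \<noteq> [] \<and> last u = j then c (butlast u) else 0)" for u
  define B where "B u = (if u \<noteq> [] \<and> hd u = j then c (tl u) else 0)" for u
  have AB: "nc_coeff (lie_series i (t @ [j])) u = A u - B u" for u
    by (simp add: nc_coeff_lie_series_snoc A_def B_def c_def)
  have "lie_sum G I F i (t @ [j]) = finprod G (\<lambda>u. F u [^] A u \<otimes> inv (F u [^] B u)) ?W"
    unfolding lie_sum_def AB using F
    by (intro finprod_cong') (auto simp: Pi_iff int_pow_diff)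
  also have "\<dots> = finprod G (\<lambda>u. F u [^] A u) ?W \<otimes> inv (finprod G (\<lambda>u. F u [^] B u) ?W)"
    using F by (subst finprod_multf) (auto simp: Pi_iff finprod_inv)
  also have "finprod G (\<lambda>u. F u [^] A u) ?W = finprod G (\<lambda>v. F (v @ [j]) [^] A (v @ [j])) (words I (Suc (length t)))"
  proof (rule finprod_words_reindex)
    fix u assume u: "u \<in> ?W" "u \<notin> (\<lambda>v. v @ [j]) ` words I (Suc (length t))"
    have "\<not> (u \<noteq> [] \<and> last u = j)"
    proof
      assume *: "u \<noteq> [] \<and> last u = j"
      then have "u = butlast u @ [j]" by (metis append_butlast_last_id)
      moreover have "butlast u \<in> words I (Suc (length t))"
        using u(1) by (auto simp: words_def dest: in_set_butlastD)
      ultimately show False using u(2) by blast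
    qed
    then show "F u [^] A u = \<one>" by (auto simp: A_def)
  qed (use I F in \<open>auto simp: inj_def words_def Pi_iff\<close>)
  also have "\<dots> = lie_sum G I (\<lambda>u. F (u @ [j])) i t"
    unfolding lie_sum_def by (simp add: A_def c_def)
  also have "finprod G (\<lambda>u. F u [^] B u) ?W = finprod G (\<lambda>v. F (j # v) [^] B (j # v)) (words I (Suc (length t)))"
  proof (rule finprod_words_reindex)
    fix u assume u: "u \<in> ?W" "u \<notin> (\<lambda>v. j # v) ` words I (Suc (length t))"
    have "\<not> (u \<noteq> [] \<and> hd u = j)"
    proof
      assume *: "u \<noteq> [] \<and> hd u = j"
      then have "u = j # tl u" by (metis list.collapse)
      moreover have "tl u \<in> words I (Suc (length t))"
        using u(1) * by (cases u) (auto simp: words_def)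
      ultimately show False using u(2) by blast
    qed
    then show "F u [^] B u = \<one>" by (auto simp: B_def)
  qed (use I F in \<open>auto simp: inj_def words_def Pi_iff\<close>)
  also have "\<dots> = lie_sum G I (\<lambda>u. F (j # u)) i t"
    unfolding lie_sum_def by (simp add: B_def c_def)
  finally show ?thesis .
qed

end

context group
begin

context
  fixes w assumes w: "lcs G (Suc w) = {\<one>}"
begin

lemma lcs_comm_group: "comm_group (G\<lparr>carrier := lcs G w\<rparr>)"
proof -
  interpret H: group "G\<lparr>carrier := lcs G w\<rparr>"
    using lcs_subgroup by (rule subgroup_imp_group)
  show ?thesis
    by (rule H.group_comm_groupI) (use lcs_central[OF w] lcs_carrier in auto)
qed

context
  fixes I :: "nat set" and x :: "nat \<Rightarrow> 'a"
  assumes I: "finite I" and x: "\<And>i. i \<in> I \<Longrightarrow> x i \<in> carrier G"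
begin

abbreviation (input) "left_normed i t \<equiv> foldl (gcomm G) (x i) (map x t)"

lemma map_carrier: "set u \<subseteq> I \<Longrightarrow> set (map x u) \<subseteq> carrier G"
  using x by auto

lemma weighted_map: "set u \<subseteq> I \<Longrightarrow> weighted G (length u) (map x u)"
  using weighted_length[OF map_carrier] by simp

lemma left_normed_in_lcs: "set (i # t) \<subseteq> I \<Longrightarrow> left_normed i t \<in> lcs G (Suc (length t))"
  using foldl_gcomm_in_lcs[of "x i" 1 "map x t"] map_carrier[of t] x by simp

text \<open>This is where the Jacobi identity enters.\<close>

lemma lie_sum_adjoint:
  assumes "a \<in> lcs G s" "1 \<le> s" "weighted G n \<tau>" "s + Suc (length t) + n = w" "set (i # t) \<subseteq> I"
  shows "lie_sum (G\<lparr>carrier := lcs G w\<rparr>) I (\<lambda>u. foldl (gcomm G) a (map x u @ \<tau>)) i t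
    = foldl (gcomm G) a (left_normed i t # \<tau>)"
  using assms
\<comment> \<open>Splitting off the last letter \<open>j\<close> moves it either behind the word, to
  the head of \<open>\<tau>\<close>, or in front of it, into \<open>a\<close>; hence both are
  generalised.\<close>
proof (induction t arbitrary: a s n \<tau> rule: rev_induct)
  case Nil
  interpret H: comm_group "G\<lparr>carrier := lcs G w\<rparr>" by (rule lcs_comm_group)
  have "(\<lambda>u. foldl (gcomm G) a (map x u @ \<tau>)) \<in> words I 1 \<rightarrow> lcs G w"
  proof
    fix u assume u: "u \<in> words I 1"
    then show "foldl (gcomm G) a (map x u @ \<tau>) \<in> lcs G w"
      using foldl_gcomm_weighted[OF weighted_append[OF weighted_map Nil(3)] Nil(1), of u] Nil(4)
      by (simp add: words_def add_ac)
  qed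
  then show ?case
    using Nil I by (subst H.lie_sum_Nil) auto
next
  case (snoc j t)
  interpret H: comm_group "G\<lparr>carrier := lcs G w\<rparr>" by (rule lcs_comm_group)
  have j: "j \<in> I" "x j \<in> lcs G 1" "x j \<in> carrier G" and it: "set (i # t) \<subseteq> I"
    using snoc.prems x by auto
  have "(\<lambda>u. foldl (gcomm G) a (map x u @ \<tau>)) \<in> words I (Suc (Suc (length t))) \<rightarrow> lcs G w"
  proof
    fix u assume u: "u \<in> words I (Suc (Suc (length t)))"
    then show "foldl (gcomm G) a (map x u @ \<tau>) \<in> lcs G w"
      using foldl_gcomm_weighted[OF weighted_append[OF weighted_map snoc.prems(3)] snoc.prems(1), of u]
        snoc.prems(4)
      by (simp add: words_def add_ac)
  qed
  then have "lie_sum (G\<lparr>carrier := lcs G w\<rparr>) I (\<lambda>u. foldl (gcomm G) a (map x u @ \<tau>)) i (t @ [j])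
    = lie_sum (G\<lparr>carrier := lcs G w\<rparr>) I (\<lambda>u. foldl (gcomm G) a (map x u @ (x j # \<tau>))) i t
      \<otimes> inv\<^bsub>G\<lparr>carrier := lcs G w\<rparr>\<^esub>
        lie_sum (G\<lparr>carrier := lcs G w\<rparr>) I (\<lambda>u. foldl (gcomm G) (gcomm G a (x j)) (map x u @ \<tau>)) i t"
    using H.lie_sum_snoc[OF I j(1), of "\<lambda>u. foldl (gcomm G) a (map x u @ \<tau>)" t i] by simp
  also have "lie_sum (G\<lparr>carrier := lcs G w\<rparr>) I (\<lambda>u. foldl (gcomm G) a (map x u @ (x j # \<tau>))) i t
      = foldl (gcomm G) a (left_normed i t # x j # \<tau>)"
    using snoc.prems weighted.Cons[OF _ j(2) snoc.prems(3)] it by (intro snoc.IH) auto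
  also have "lie_sum (G\<lparr>carrier := lcs G w\<rparr>) I (\<lambda>u. foldl (gcomm G) (gcomm G a (x j)) (map x u @ \<tau>)) i t
      = foldl (gcomm G) (gcomm G a (x j)) (left_normed i t # \<tau>)"
    using snoc.prems gcomm_in_lcs_Suc[OF snoc.prems(1) j(3)] it
    by (intro snoc.IH[of _ "Suc s" n]) auto
  also have "inv\<^bsub>G\<lparr>carrier := lcs G w\<rparr>\<^esub> foldl (gcomm G) (gcomm G a (x j)) (left_normed i t # \<tau>)
      = inv foldl (gcomm G) (gcomm G a (x j)) (left_normed i t # \<tau>)"
  proof (rule m_inv_consistent[OF lcs_subgroup])
    have "foldl (gcomm G) (gcomm G a (x j)) (left_normed i t # \<tau>) \<in> lcs G (Suc s + (Suc (length t) + n))"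
      using left_normed_in_lcs[OF it] snoc.prems(3) gcomm_in_lcs_Suc[OF snoc.prems(1) j(3)]
      by (intro foldl_gcomm_weighted weighted.Cons) auto
    then show "foldl (gcomm G) (gcomm G a (x j)) (left_normed i t # \<tau>) \<in> lcs G w"
      using snoc.prems(4) by (simp add: add_ac)
  qed
  also have "foldl (gcomm G) a (left_normed i t # x j # \<tau>) \<otimes> inv foldl (gcomm G) (gcomm G a (x j)) (left_normed i t # \<tau>)
      = foldl (gcomm G) a (gcomm G (left_normed i t) (x j) # \<tau>)"
    using foldl_gcomm_jacobi[OF w snoc.prems(3,1) left_normed_in_lcs[OF it] j(2)] snoc.prems by simp
  finally show ?case by simp
qed

text \<open>A variant of the Dynkin--Specht--Wever identity which counts the occurrences of one letter only.
  The usual form has the weight as its factor, which is useless in weight \<open>p\<close>.\<close>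

lemma lie_sum_dynkin:
  assumes "weighted G n \<tau>" "Suc (length t) + n = w" "set (i # t) \<subseteq> I" "k \<in> I"
  shows "lie_sum (G\<lparr>carrier := lcs G w\<rparr>) I
      (\<lambda>u. if hd u = k then foldl (gcomm G) (x k) (map x (tl u) @ \<tau>) else \<one>) i t
    = foldl (gcomm G) (left_normed i t) \<tau> [^]\<^bsub>G\<lparr>carrier := lcs G w\<rparr>\<^esub> int (count (mset (i # t)) k)"
  using assms
proof (induction t arbitrary: n \<tau> rule: rev_induct)
  case Nil
  interpret H: comm_group "G\<lparr>carrier := lcs G w\<rparr>" by (rule lcs_comm_group)
  have "foldl (gcomm G) (x k) \<tau> \<in> lcs G w"
    using foldl_gcomm_weighted[OF Nil(1), of "x k" 1] x[OF Nil(4)] Nil(2) by simp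
  then have "lie_sum (G\<lparr>carrier := lcs G w\<rparr>) I
      (\<lambda>u. if hd u = k then foldl (gcomm G) (x k) (map x (tl u) @ \<tau>) else \<one>) i []
    = (if i = k then foldl (gcomm G) (x k) \<tau> else \<one>)"
    using Nil I by (subst H.lie_sum_Nil) (auto simp: words_def length_Suc_conv)
  also have "\<dots> = foldl (gcomm G) (x i) \<tau> [^]\<^bsub>G\<lparr>carrier := lcs G w\<rparr>\<^esub> (if i = k then 1 else 0 :: int)"
    using \<open>foldl (gcomm G) (x k) \<tau> \<in> lcs G w\<close> by auto
  finally show ?case by simp
next
  case (snoc j t)
  interpret H: comm_group "G\<lparr>carrier := lcs G w\<rparr>" by (rule lcs_comm_group)
  let ?H = "G\<lparr>carrier := lcs G w\<rparr>"
  let ?F = "\<lambda>u. if hd u = k then foldl (gcomm G) (x k) (map x (tl u) @ \<tau>) else \<one>"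
  have j: "j \<in> I" "x j \<in> lcs G 1" "x j \<in> carrier G" and it: "set (i # t) \<subseteq> I"
    using snoc.prems x by auto
  have xk: "x k \<in> lcs G 1" using x snoc.prems by simp
  let ?X = "foldl (gcomm G) (gcomm G (left_normed i t) (x j)) \<tau>"
  have X: "?X \<in> lcs G w"
    using foldl_gcomm_weighted[OF snoc.prems(1) gcomm_in_lcs_Suc[OF left_normed_in_lcs[OF it] j(3)]]
      snoc.prems(2) by simp
  have F: "?F \<in> words I (Suc (Suc (length t))) \<rightarrow> lcs G w"
  proof
    fix u assume u: "u \<in> words I (Suc (Suc (length t)))"
    then have "foldl (gcomm G) (x k) (map x (tl u) @ \<tau>) \<in> lcs G (1 + (length (tl u) + n))"
      using snoc.prems(1) xk
      by (intro foldl_gcomm_weighted weighted_append weighted_map)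
         (cases u; auto simp: words_def)+
    then show "?F u \<in> lcs G w"
      using u snoc.prems(2) by (simp add: words_def)
  qed
  have "lie_sum ?H I ?F i (t @ [j])
    = lie_sum ?H I (\<lambda>u. ?F (u @ [j])) i t \<otimes> inv\<^bsub>?H\<^esub> lie_sum ?H I (\<lambda>u. ?F (j # u)) i t"
    using H.lie_sum_snoc[OF I j(1), of ?F t i] F by simp
  also have "lie_sum ?H I (\<lambda>u. ?F (u @ [j])) i t
      = lie_sum ?H I (\<lambda>u. if hd u = k then foldl (gcomm G) (x k) (map x (tl u) @ (x j # \<tau>)) else \<one>) i t"
    unfolding lie_sum_def
  proof (rule H.finprod_cong')
    fix u assume "u \<in> words I (Suc (length t))"
    then have "u \<noteq> []" by (auto simp: words_def)
    then show "?F (u @ [j]) [^]\<^bsub>?H\<^esub> nc_coeff (lie_series i t) u =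
         (if hd u = k then foldl (gcomm G) (x k) (map x (tl u) @ x j # \<tau>) else \<one>) [^]\<^bsub>?H\<^esub> nc_coeff (lie_series i t) u"
      by simp
  next
    show "(\<lambda>u. (if hd u = k then foldl (gcomm G) (x k) (map x (tl u) @ x j # \<tau>) else \<one>) [^]\<^bsub>?H\<^esub> nc_coeff (lie_series i t) u)
      \<in> words I (Suc (length t)) \<rightarrow> carrier ?H"
    proof
      fix u assume u: "u \<in> words I (Suc (length t))"
      then have "u @ [j] \<in> words I (Suc (Suc (length t)))" "u \<noteq> []"
        using j by (auto simp: words_def)
      then have "(if hd u = k then foldl (gcomm G) (x k) (map x (tl u) @ x j # \<tau>) else \<one>) \<in> carrier ?H"
        using F[THEN funcset_mem, of "u @ [j]"] by (cases "hd u = k") simp_all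
      then show "(if hd u = k then foldl (gcomm G) (x k) (map x (tl u) @ x j # \<tau>) else \<one>)
          [^]\<^bsub>?H\<^esub> nc_coeff (lie_series i t) u \<in> carrier ?H"
        by (rule H.int_pow_closed)
    qed
  qed simp
  also have "\<dots> = ?X [^]\<^bsub>?H\<^esub> int (count (mset (i # t)) k)"
    using snoc.IH[OF weighted.Cons[OF _ j(2) snoc.prems(1)]] snoc.prems it by simp
  \<comment> \<open>Words beginning with \<open>j\<close> contribute only if \<open>j = k\<close>.
    Then \<open>lie_sum_adjoint\<close> gives the bracket of \<open>x k\<close> with the whole Lie
    element, which is the inverse of \<open>?X\<close>; inverting it accounts for the additional
    occurrence of \<open>k\<close>.\<close>
  also have "inv\<^bsub>?H\<^esub> lie_sum ?H I (\<lambda>u. ?F (j # u)) i t = (if j = k then ?X else \<one>)"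
  proof (cases "j = k")
    case True
    then have "lie_sum ?H I (\<lambda>u. ?F (j # u)) i t = foldl (gcomm G) (x k) (left_normed i t # \<tau>)"
      using lie_sum_adjoint[OF xk _ snoc.prems(1) _ it] snoc.prems(2) by simp
    also have "\<dots> = inv ?X"
      using foldl_gcomm_swap[OF w snoc.prems(1) left_normed_in_lcs[OF it] xk] snoc.prems(2) True by simp
    also have "\<dots> = inv\<^bsub>?H\<^esub> ?X"
      using m_inv_consistent[OF lcs_subgroup X] by simp
    finally show ?thesis using True X H.inv_inv[of ?X] by simp
  next
    case False
    then have "lie_sum ?H I (\<lambda>u. ?F (j # u)) i t = \<one>"
      unfolding lie_sum_def using H.finprod_one_eqI[of "words I (Suc (length t))"] H.int_pow_one by simp
    then show ?thesis using False H.inv_one by simp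
  qed
  also have "?X [^]\<^bsub>?H\<^esub> int (count (mset (i # t)) k) \<otimes> (if j = k then ?X else \<one>)
      = ?X [^]\<^bsub>?H\<^esub> (int (count (mset (i # t)) k) + (if j = k then 1 else 0))"
  proof -
    have "?X [^]\<^bsub>?H\<^esub> (m + (if j = k then 1 else 0)) = ?X [^]\<^bsub>?H\<^esub> m \<otimes> (if j = k then ?X else \<one>)" for m :: int
    proof -
      have "?X [^]\<^bsub>?H\<^esub> (m + 1) = ?X [^]\<^bsub>?H\<^esub> m \<otimes> ?X"
        using H.int_pow_mult[of ?X m 1] H.int_pow_1[of ?X] X by simp
      moreover have "?X [^]\<^bsub>?H\<^esub> m \<in> carrier G"
        using H.int_pow_closed[of ?X m] X lcs_carrier by simp
      ultimately show ?thesis by (cases "j = k") simp_all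
    qed
    then show ?thesis by simp
  qed
  also have "int (count (mset (i # t)) k) + (if j = k then 1 else 0) = int (count (mset (i # t @ [j])) k)"
    by simp
  finally show ?case by simp
qed

end

end

end

lemma (in group_hom) hom_foldl_gcomm:
  "a \<in> carrier G \<Longrightarrow> set t \<subseteq> carrier G \<Longrightarrow>
    h (foldl (gcomm G) a t) = foldl (gcomm H) (h a) (map h t)"
  by (induction t arbitrary: a) (simp_all add: hom_gcomm)

section \<open>Magnus series on the lower central series\<close>

locale magnus_group = group G for G (structure) +
  fixes I :: "nat set" and e :: "nat \<Rightarrow> 'a" and M :: "'a \<Rightarrow> ncseries"
  assumes finite_I: "finite I"
    and gen_closed: "\<And>i. i \<in> I \<Longrightarrow> e i \<in> carrier G"
    and generate_gens: "generate G (e ` I) = carrier G"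
    and M_mult: "\<And>a b. a \<in> carrier G \<Longrightarrow> b \<in> carrier G \<Longrightarrow> M (a \<otimes> b) = M a * M b"
    and M_one: "M \<one> = 1"
    and M_gen: "\<And>i. i \<in> I \<Longrightarrow> M (e i) = 1 + nc_X i"
begin

lemma M_inv: "a \<in> carrier G \<Longrightarrow> M (inv a) * M a = 1"
  using M_mult[of "inv a" a] M_one by simp

lemma M_gcomm:
  "a \<in> carrier G \<Longrightarrow> b \<in> carrier G \<Longrightarrow> M (gcomm G a b) = M (inv a) * M (inv b) * M a * M b"
  by (simp add: gcomm_def M_mult)

lemma subgroup_order: "subgroup {a \<in> carrier G. nc_order_ge k (M a - 1)} G" (is "subgroup ?S G")
proof (rule subgroupI)
  have "\<one> \<in> ?S" by (simp add: M_one nc_order_ge_def)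
  then show "?S \<noteq> {}" by blast
next
  fix a assume "a \<in> ?S"
  then show "inv a \<in> ?S" using nc_order_ge_inverse[OF M_inv[of a]] by simp
next
  fix a b assume ab: "a \<in> ?S" "b \<in> ?S"
  then have "M (a \<otimes> b) - 1 = (M a - 1) * M b + (M b - 1)"
    by (simp add: M_mult algebra_simps)
  moreover have "nc_order_ge k ((M a - 1) * M b + (M b - 1))"
    using ab by (intro nc_order_ge_add nc_order_ge_mult_right) simp_all
  ultimately have "nc_order_ge k (M (a \<otimes> b) - 1)" by (simp only:)
  then show "a \<otimes> b \<in> ?S" using ab by simp
qed blast

lemma order_M_carrier: "a \<in> carrier G \<Longrightarrow> nc_order_ge 1 (M a - 1)"
proof -
  have "generate G (e ` I) \<subseteq> {a \<in> carrier G. nc_order_ge 1 (M a - 1)}"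
    by (rule generate_subgroup_incl[OF _ subgroup_order]) (auto simp: gen_closed M_gen nc_order_ge_X[unfolded One_nat_def])
  then show "a \<in> carrier G \<Longrightarrow> nc_order_ge 1 (M a - 1)"
    unfolding generate_gens by blast
qed

lemma order_M_lcs:
  assumes "1 \<le> k" "a \<in> lcs G k"
  shows "nc_order_ge k (M a - 1)"
  using assms
proof (induction k arbitrary: a rule: dec_induct)
  case base
  then show ?case using order_M_carrier by simp
next
  case (step k)
  have "generate G {gcomm G a b | a b. a \<in> lcs G k \<and> b \<in> carrier G}
      \<subseteq> {a \<in> carrier G. nc_order_ge (Suc k) (M a - 1)}"
  proof (rule generate_subgroup_incl[OF _ subgroup_order], clarify)
    fix a b assume ab: "a \<in> lcs G k" "b \<in> carrier G"
    then have "nc_order_ge (k + 1) (M (inv a) * M (inv b) * M a * M b - 1)"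
      by (intro nc_order_ge_commutator M_inv step.IH order_M_carrier) simp_all
    then show "gcomm G a b \<in> carrier G \<and> nc_order_ge (Suc k) (M (gcomm G a b) - 1)"
      using ab by (simp add: M_gcomm)
  qed
  then show ?case
    using step.prems lcs_Suc_eq[OF step.hyps(1)] by blast
qed

lemma coeff_M_lcs_mult:
  assumes "1 \<le> k" "a \<in> lcs G k" "b \<in> lcs G k" "u \<noteq> []" "length u \<le> k"
  shows "nc_coeff (M (a \<otimes> b)) u = nc_coeff (M a) u + nc_coeff (M b) u"
proof -
  have "M (a \<otimes> b) = (M a - 1) * (M b - 1) + M a + M b - 1"
    using assms by (simp add: M_mult algebra_simps)
  moreover have "nc_order_ge (k + k) ((M a - 1) * (M b - 1))"
    using assms by (intro nc_order_ge_mult order_M_lcs)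
  ultimately show ?thesis
    using assms by (simp add: nc_order_ge_def nc_coeff_1)
qed

lemma coeff_M_lcs_inv:
  assumes "1 \<le> k" "a \<in> lcs G k" "u \<noteq> []" "length u \<le> k"
  shows "nc_coeff (M (inv a)) u = - nc_coeff (M a) u"
  using coeff_M_lcs_mult[OF assms(1,2) lcs_inv[OF assms(2)] assms(3,4)] assms(2,3)
  by (simp add: M_one nc_coeff_1)

lemma coeff_M_lcs_eq_0:
  assumes "1 \<le> k" "a \<in> lcs G k" "u \<noteq> []" "length u < k"
  shows "nc_coeff (M a) u = 0"
  using order_M_lcs[OF assms(1,2)] assms(3,4) by (simp add: nc_order_ge_def nc_coeff_1)

lemma M_left_normed:
  assumes "set (i # t) \<subseteq> I"
  shows "nc_order_ge (Suc (Suc (length t))) (M (foldl (gcomm G) (e i) (map e t)) - 1 - lie_series i t)"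
  using assms
proof (induction t rule: rev_induct)
  case Nil
  then show ?case by (simp add: M_gen nc_order_ge_def)
next
  case (snoc j t)
  let ?f = "foldl (gcomm G) (e i) (map e t)"
  have cl: "?f \<in> carrier G" "e j \<in> carrier G"
    using snoc.prems by (auto intro!: foldl_gcomm_closed gen_closed)
  have "nc_order_ge (Suc (Suc (Suc (length t))))
      (M (inv ?f) * M (inv (e j)) * M ?f * (1 + nc_X j) - 1
       - (lie_series i t * nc_X j - nc_X j * lie_series i t))"
    using snoc M_inv[OF cl(1)] M_inv[OF cl(2)]
    by (intro nc_commutator_leading_term nc_order_ge_lie_series) (simp_all add: M_gen)
  then show ?case
    using snoc.prems cl by (simp add: M_gcomm M_gen lie_series_snoc)
qed

lemma coeff_M_left_normed:
  assumes "set (i # t) \<subseteq> I" "length u = Suc (length t)"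
  shows "nc_coeff (M (foldl (gcomm G) (e i) (map e t))) u = nc_coeff (lie_series i t) u"
proof -
  have "u \<noteq> []" using assms(2) by auto
  then show ?thesis
    using M_left_normed[OF assms(1), unfolded nc_order_ge_def, rule_format, of u] assms(2)
    by (simp add: nc_coeff_1)
qed

text \<open>The bridge from coefficients back to group elements. For \<open>f\<close> in
  \<open>lcs G w\<close> the image \<open>q f\<close> is a product of components \<open>Z d\<close>
  over the multidegrees \<open>d\<close>. The operator \<open>T d k\<close> sees only Magnus
  coefficients, yet returns \<open>Z d\<close> to the power of the multiplicity of \<open>k\<close>
  in \<open>d\<close>. Coefficients divisible by \<open>m d\<close> make \<open>T d k f\<close>
  trivial by torsion, and a multiplicity prime to \<open>m d\<close> then makes \<open>Z d\<close>
  trivial.\<close>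

lemma dynkin_criterion:
  fixes Q (structure) and m :: "nat multiset \<Rightarrow> nat"
  assumes q: "group_hom G Q q" "q ` carrier G = carrier Q"
    and class_Q: "lcs Q (Suc w) = {\<one>\<^bsub>Q\<^esub>}" and w: "1 \<le> w"
    and f: "f \<in> lcs G w"
    and torsion: "\<And>u. u \<in> words I w \<Longrightarrow>
      foldl (gcomm Q) (q (e (hd u))) (map (\<lambda>i. q (e i)) (tl u)) [^]\<^bsub>Q\<^esub> m (mset u) = \<one>\<^bsub>Q\<^esub>"
    and divides: "\<And>u. u \<in> words I w \<Longrightarrow> int (m (mset u)) dvd nc_coeff (M f) u"
    and coprime: "\<And>u. u \<in> words I w \<Longrightarrow> \<exists>k \<in> set u. coprime (count (mset u) k) (m (mset u))"
  shows "q f = \<one>\<^bsub>Q\<^esub>"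
proof -
  interpret q: group_hom G Q q by fact
  let ?H = "Q\<lparr>carrier := lcs Q w\<rparr>"
  interpret H: comm_group ?H by (rule q.H.lcs_comm_group[OF class_Q])
  define x where "x i = q (e i)" for i
  define C where "C u = foldl (gcomm Q) (x (hd u)) (map x (tl u))" for u
  define D where "D = mset ` words I w"
  define T where "T d k f = finprod ?H (\<lambda>u. C u [^]\<^bsub>?H\<^esub> nc_coeff (M f) u)
    {u \<in> words I w. mset u = d \<and> hd u = k}" for d k f
  have x: "x i \<in> carrier Q" if "i \<in> I" for i
    using that gen_closed by (simp add: x_def)
  have finD: "finite D" by (simp add: D_def finite_I)
  have words_neq: "u \<noteq> []" "length u = w" "set u \<subseteq> I" if "u \<in> words I w" for u
    using that w by (auto simp: words_def)
  have C_closed: "C u \<in> lcs Q w" if "u \<in> words I w" for u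
    using q.H.left_normed_in_lcs[OF class_Q finite_I x, where i = "hd u" and t = "tl u"] words_neq[OF that] w
    by (cases u) (auto simp: C_def)
  then have C_pow: "(\<lambda>u. C u [^]\<^bsub>?H\<^esub> g u) \<in> {u \<in> words I w. P u} \<rightarrow> carrier ?H" for P and g :: "nat list \<Rightarrow> int"
    using H.int_pow_closed by (simp add: Pi_iff)
  have q_lcs: "q a \<in> lcs Q w" if "a \<in> lcs G w" for a
    using q.image_lcs[OF q(2), of w] that by blast
  have torsion': "C u [^]\<^bsub>?H\<^esub> m (mset u) = \<one>\<^bsub>Q\<^esub>" if "u \<in> words I w" for u
    using torsion[OF that] by (simp add: C_def x_def[abs_def] q.H.nat_pow_consistent[symmetric])
  have T_closed: "T d k a \<in> carrier ?H" for d k a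
    unfolding T_def by (rule H.finprod_closed[OF C_pow])
  have T_mult: "T d k (a \<otimes> b) = T d k a \<otimes>\<^bsub>?H\<^esub> T d k b" if ab: "a \<in> lcs G w" "b \<in> lcs G w" for d k a b
  proof -
    have "T d k (a \<otimes> b) = finprod ?H (\<lambda>u. C u [^]\<^bsub>?H\<^esub> nc_coeff (M a) u \<otimes>\<^bsub>?H\<^esub> C u [^]\<^bsub>?H\<^esub> nc_coeff (M b) u)
      {u \<in> words I w. mset u = d \<and> hd u = k}"
      unfolding T_def
    proof (rule H.finprod_cong')
      fix u assume "u \<in> {u \<in> words I w. mset u = d \<and> hd u = k}"
      then have u: "u \<in> words I w" by simp
      then have "nc_coeff (M (a \<otimes> b)) u = nc_coeff (M a) u + nc_coeff (M b) u"
        using coeff_M_lcs_mult[OF w ab] words_neq by simp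
      then show "C u [^]\<^bsub>?H\<^esub> nc_coeff (M (a \<otimes> b)) u
          = C u [^]\<^bsub>?H\<^esub> nc_coeff (M a) u \<otimes>\<^bsub>?H\<^esub> C u [^]\<^bsub>?H\<^esub> nc_coeff (M b) u"
        using H.int_pow_mult[of "C u"] C_closed[OF u] by simp
    qed (use C_closed H.int_pow_closed H.m_closed in \<open>auto simp: Pi_iff\<close>)
    also have "\<dots> = T d k a \<otimes>\<^bsub>?H\<^esub> T d k b"
      unfolding T_def by (rule H.finprod_multf[OF C_pow C_pow])
    finally show ?thesis .
  qed
  have T_one: "T d k \<one> = \<one>\<^bsub>?H\<^esub>" for d k
    unfolding T_def
    by (rule H.finprod_one_eqI) (auto simp: M_one nc_coeff_1 words_neq)
  have T_inv: "T d k (inv a) = inv\<^bsub>?H\<^esub> T d k a" if a: "a \<in> lcs G w" for d k a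
  proof -
    have "T d k (inv a) \<otimes>\<^bsub>?H\<^esub> T d k a = \<one>\<^bsub>?H\<^esub>"
      using T_mult[OF lcs_inv[OF a] a] T_one a by simp
    then show ?thesis
      using H.inv_equality[OF _ T_closed T_closed] by metis
  qed
  \<comment> \<open>\<open>Z d\<close> is the component of \<open>q f\<close> of multidegree \<open>d\<close>.\<close>
  define good where "good f Z \<longleftrightarrow> (\<forall>d\<in>D. Z d \<in> lcs Q w \<and> Z d [^]\<^bsub>?H\<^esub> m d = \<one>\<^bsub>?H\<^esub>) \<and>
      q f = finprod ?H Z D \<and> (\<forall>d\<in>D. \<forall>k\<in>I. T d k f = Z d [^]\<^bsub>?H\<^esub> count d k)" for f Z
  \<comment> \<open>Only the existence of components is asserted. This property passes to products
    and inverses, so it can be tested on left-normed commutators of generators.\<close>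
  define S where "S = {f \<in> lcs G w. \<exists>Z. good f Z}"
  have S: "subgroup S G"
  proof (rule subgroupI)
    show "S \<subseteq> carrier G" unfolding S_def using lcs_carrier by blast
    have "good \<one> (\<lambda>d. \<one>\<^bsub>?H\<^esub>)"
      using T_one H.nat_pow_one H.finprod_one_eqI[of D "\<lambda>d. \<one>\<^bsub>?H\<^esub>"] unfolding good_def by simp
    then have "\<one> \<in> S" unfolding S_def by auto
    then show "S \<noteq> {}" by blast
  next
    fix a assume "a \<in> S"
    then obtain Z where a: "a \<in> lcs G w" and Z: "good a Z" unfolding S_def by blast
    have ZD: "Z \<in> D \<rightarrow> carrier ?H" using Z by (auto simp: good_def)
    have "good (inv a) (\<lambda>d. inv\<^bsub>?H\<^esub> Z d)"
      unfolding good_def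
    proof (intro conjI ballI)
      fix d assume d: "d \<in> D"
      then have Zd: "Z d \<in> carrier ?H" using ZD by blast
      show "inv\<^bsub>?H\<^esub> Z d \<in> lcs Q w" using H.inv_closed[OF Zd] by simp
      show "inv\<^bsub>?H\<^esub> Z d [^]\<^bsub>?H\<^esub> m d = \<one>\<^bsub>?H\<^esub>"
        using H.nat_pow_inv[OF Zd] Z d H.inv_one unfolding good_def by metis
      fix k assume k: "k \<in> I"
      show "T d k (inv a) = inv\<^bsub>?H\<^esub> Z d [^]\<^bsub>?H\<^esub> count d k"
        using H.nat_pow_inv[OF Zd] Z d k T_inv[OF a] unfolding good_def by metis
    next
      have "finprod ?H Z D \<in> lcs Q w" using H.finprod_closed[OF ZD] by simp
      then show "q (inv a) = finprod ?H (\<lambda>d. inv\<^bsub>?H\<^esub> Z d) D"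
        using H.finprod_inv[OF ZD] Z a q.hom_inv[of a] q.H.m_inv_consistent[OF q.H.lcs_subgroup]
        unfolding good_def by simp
    qed
    then show "inv a \<in> S" using a unfolding S_def by auto
  next
    fix a b assume "a \<in> S" "b \<in> S"
    then obtain Z Y where a: "a \<in> lcs G w" "good a Z" and b: "b \<in> lcs G w" "good b Y"
      unfolding S_def by blast
    have ZD: "Z \<in> D \<rightarrow> carrier ?H" "Y \<in> D \<rightarrow> carrier ?H"
      using a b by (auto simp: good_def)
    have "good (a \<otimes> b) (\<lambda>d. Z d \<otimes>\<^bsub>?H\<^esub> Y d)"
      unfolding good_def
    proof (intro conjI ballI)
      fix d assume d: "d \<in> D"
      then have Zd: "Z d \<in> carrier ?H" "Y d \<in> carrier ?H" using ZD by blast+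
      show "Z d \<otimes>\<^bsub>?H\<^esub> Y d \<in> lcs Q w" using H.m_closed[OF Zd] by simp
      show "(Z d \<otimes>\<^bsub>?H\<^esub> Y d) [^]\<^bsub>?H\<^esub> m d = \<one>\<^bsub>?H\<^esub>"
        using H.nat_pow_distrib[OF Zd] a b d H.r_one[OF H.one_closed] unfolding good_def by metis
      fix k assume k: "k \<in> I"
      show "T d k (a \<otimes> b) = (Z d \<otimes>\<^bsub>?H\<^esub> Y d) [^]\<^bsub>?H\<^esub> count d k"
        using H.nat_pow_distrib[OF Zd] a b d k T_mult[OF a(1) b(1)] unfolding good_def by metis
    next
      show "q (a \<otimes> b) = finprod ?H (\<lambda>d. Z d \<otimes>\<^bsub>?H\<^esub> Y d) D"
        using H.finprod_multf[OF ZD] a b q.hom_mult[of a b] unfolding good_def by simp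
    qed
    then show "a \<otimes> b \<in> S" using a(1) b(1) unfolding S_def by auto
  qed
  obtain n where n: "w = Suc n" using w by (cases w) auto
  have "lcs G (Suc n) \<subseteq> S"
  proof (rule lcs_subset_of_generators[OF _ generate_gens S])
    show "e ` I \<subseteq> carrier G" using gen_closed by blast
    show "lcs G (Suc (Suc n)) \<subseteq> S"
    proof
      fix a assume a: "a \<in> lcs G (Suc (Suc n))"
      then have a': "a \<in> lcs G w" unfolding n by (rule lcs_antimonoD) simp
      have "nc_coeff (M a) u = 0" if "u \<in> words I w" for u
        using coeff_M_lcs_eq_0[OF _ a] words_neq[OF that] n by simp
      then have "T d k a = \<one>\<^bsub>?H\<^esub>" for d k
        unfolding T_def by (intro H.finprod_one_eqI) simp
      moreover have "q a = \<one>\<^bsub>?H\<^esub>"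
        using q.image_lcs[OF q(2), of "Suc w"] class_Q a n by auto
      ultimately have "good a (\<lambda>d. \<one>\<^bsub>?H\<^esub>)"
        using H.nat_pow_one H.finprod_one_eqI[of D "\<lambda>d. \<one>\<^bsub>?H\<^esub>"] unfolding good_def by simp
      then show "a \<in> S" using a' unfolding S_def by auto
    qed
  next
    fix a t assume "a \<in> e ` I" "set t \<subseteq> e ` I" and lt: "length t = n"
    then obtain i where i: "i \<in> I" "a = e i" by blast
    have "t \<in> lists (e ` I)" using \<open>set t \<subseteq> e ` I\<close> by blast
    then obtain s where s: "set s \<subseteq> I" "t = map e s" by (auto simp: lists_image)
    have iw: "i # s \<in> words I w" using i s lt n by (simp add: words_def)
    let ?d = "mset (i # s)"
    \<comment> \<open>A left-normed commutator is homogeneous: its only component sits in the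
      multidegree of its entries.\<close>
    define Z where "Z = (\<lambda>d. if ?d = d then C (i # s) else \<one>\<^bsub>?H\<^esub>)"
    have "good (foldl (gcomm G) a t) Z"
      unfolding good_def
    proof (intro conjI ballI)
      fix d assume "d \<in> D"
      show "Z d \<in> lcs Q w" using C_closed[OF iw] by (simp add: Z_def)
      show "Z d [^]\<^bsub>?H\<^esub> m d = \<one>\<^bsub>?H\<^esub>"
        using torsion'[OF iw] H.nat_pow_one by (auto simp: Z_def)
      fix k assume k: "k \<in> I"
      have coeff: "nc_coeff (M (foldl (gcomm G) a t)) u = nc_coeff (lie_series i s) u"
        if "u \<in> words I w" for u
        using coeff_M_left_normed[of i s u] i s that lt n by (simp add: words_def)
      show "T d k (foldl (gcomm G) a t) = Z d [^]\<^bsub>?H\<^esub> count d k"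
      proof (cases "?d = d")
        case False
        have "T d k (foldl (gcomm G) a t) = \<one>\<^bsub>?H\<^esub>"
          unfolding T_def
        proof (rule H.finprod_one_eqI)
          fix u assume u: "u \<in> {u \<in> words I w. mset u = d \<and> hd u = k}"
          then have "mset u \<noteq> mset (i # s)" using False by auto
          from nc_coeff_lie_series_eq_0[OF this] u
          show "C u [^]\<^bsub>?H\<^esub> nc_coeff (M (foldl (gcomm G) a t)) u = \<one>\<^bsub>?H\<^esub>"
            by (simp add: coeff)
        qed
        then show ?thesis using False H.nat_pow_one by (simp add: Z_def)
      next
        case True
        \<comment> \<open>\<open>T d k\<close> runs over the words of multidegree \<open>d\<close>
          with first letter \<open>k\<close>. The bracket vanishes off its multidegree, so the
          product extends to all words and takes the form of \<open>lie_sum_dynkin\<close> with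
          empty \<open>\<tau>\<close>.\<close>
        define F where "F = (\<lambda>u. if hd u = k then foldl (gcomm Q) (x k) (map x (tl u) @ []) else \<one>\<^bsub>Q\<^esub>)"
        have FC: "F u = C u" if "hd u = k" for u
          using that by (simp add: F_def C_def)
        have F_closed: "F u \<in> carrier ?H" if "u \<in> words I w" for u
          using C_closed[OF that] by (auto simp: F_def C_def)
        have "T d k (foldl (gcomm G) a t)
            = finprod ?H (\<lambda>u. F u [^]\<^bsub>?H\<^esub> nc_coeff (lie_series i s) u) (words I w)"
          unfolding T_def
        proof (rule H.finprod_mono_neutral_cong_left)
          fix u assume u: "u \<in> words I w - {u \<in> words I w. mset u = d \<and> hd u = k}"
          then have "mset u \<noteq> mset (i # s) \<or> F u = \<one>\<^bsub>?H\<^esub>"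
            using True by (auto simp: F_def)
          then show "F u [^]\<^bsub>?H\<^esub> nc_coeff (lie_series i s) u = \<one>\<^bsub>?H\<^esub>"
            using nc_coeff_lie_series_eq_0[of u i s] H.int_pow_one by auto
        next
          fix u assume "u \<in> {u \<in> words I w. mset u = d \<and> hd u = k}"
          then show "C u [^]\<^bsub>?H\<^esub> nc_coeff (M (foldl (gcomm G) a t)) u
              = F u [^]\<^bsub>?H\<^esub> nc_coeff (lie_series i s) u"
            by (simp add: coeff FC)
        qed (use finite_I F_closed H.int_pow_closed in auto)
        also have "\<dots> = lie_sum ?H I F i s"
          using lt n s by (simp add: lie_sum_def)
        also have "\<dots> = foldl (gcomm Q) (foldl (gcomm Q) (x i) (map x s)) [] [^]\<^bsub>?H\<^esub> int (count ?d k)"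
          unfolding F_def using i s k lt n
          by (intro q.H.lie_sum_dynkin[OF class_Q finite_I x _ _ _ k, where n = 0]) (auto intro: weighted.Nil)
        finally show ?thesis
          unfolding int_pow_int True using True by (simp add: Z_def C_def)
      qed
    next
      have "?d \<in> D" unfolding D_def using iw by (rule imageI)
      then have "finprod ?H Z D = C (i # s)"
        unfolding Z_def using C_closed[OF iw] finD
        by (intro H.finprod_singleton[where f = "\<lambda>d. C (i # s)"]) auto
      moreover have "q (foldl (gcomm G) a t) = C (i # s)"
        using i s gen_closed
        by (subst q.hom_foldl_gcomm) (auto simp: C_def x_def[abs_def] comp_def)
      ultimately show "q (foldl (gcomm G) a t) = finprod ?H Z D" by simp
    qed
    moreover have "foldl (gcomm G) a t \<in> lcs G w"
      using foldl_gcomm_in_lcs[of a 1 t] i s lt n gen_closed by auto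
    ultimately show "foldl (gcomm G) a t \<in> S" unfolding S_def by blast
  qed
  then obtain Z where Z: "good f Z" using f n unfolding S_def by blast
  have "Z d = \<one>\<^bsub>?H\<^esub>" if dD: "d \<in> D" for d
  proof -
    obtain v where v: "v \<in> words I w" "d = mset v" using dD unfolding D_def by blast
    obtain k where k: "k \<in> set v" "coprime (count d k) (m d)" using coprime[OF v(1)] v(2) by blast
    have "T d k f = \<one>\<^bsub>?H\<^esub>"
      unfolding T_def
    proof (rule H.finprod_one_eqI)
      fix u assume "u \<in> {u \<in> words I w. mset u = d \<and> hd u = k}"
      then have u: "u \<in> words I w" "mset u = d" by simp_all
      obtain c where c: "nc_coeff (M f) u = int (m d) * c" using divides[OF u(1)] u(2) by auto
      have "C u [^]\<^bsub>?H\<^esub> nc_coeff (M f) u = (C u [^]\<^bsub>?H\<^esub> int (m d)) [^]\<^bsub>?H\<^esub> c"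
        unfolding c using C_closed[OF u(1)] by (simp add: H.int_pow_pow)
      also have "C u [^]\<^bsub>?H\<^esub> int (m d) = \<one>\<^bsub>?H\<^esub>"
        using torsion'[OF u(1)] u(2) by (simp add: int_pow_int)
      finally show "C u [^]\<^bsub>?H\<^esub> nc_coeff (M f) u = \<one>\<^bsub>?H\<^esub>" using H.int_pow_one by metis
    qed
    moreover have "k \<in> I" using k(1) words_neq(3)[OF v(1)] by blast
    ultimately have "Z d [^]\<^bsub>?H\<^esub> count d k = \<one>\<^bsub>?H\<^esub>" "Z d [^]\<^bsub>?H\<^esub> m d = \<one>\<^bsub>?H\<^esub>" "Z d \<in> carrier ?H"
      using Z dD unfolding good_def by simp_all
    then show ?thesis using H.pow_eq_one_coprime k(2) by blast
  qed
  then have "finprod ?H Z D = \<one>\<^bsub>?H\<^esub>" by (rule H.finprod_one_eqI)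
  then show ?thesis using Z unfolding good_def by simp
qed

end

section \<open>Free groups and ideals of power series\<close>

lemma inv_letter_inv_letter [simp]: "inv_letter (inv_letter a) = a"
  by (simp add: inv_letter_def)

lemma fst_inv_letter [simp]: "fst (inv_letter a) = fst a"
  by (simp add: inv_letter_def)

lemma reduced_ConsD: "reduced (a # w) \<Longrightarrow> reduced w"
  by (cases w) auto

lemma push_letter_reduced_Cons: "reduced (a # w) \<Longrightarrow> push_letter a w = a # w"
  by (cases w) auto

lemma reduced_push_letter: "reduced w \<Longrightarrow> reduced (push_letter a w)"
  by (cases w) (auto dest: reduced_ConsD)

lemma reduced_foldr_push: "reduced v \<Longrightarrow> reduced (foldr push_letter u v)"
  by (induction u) (auto simp: reduced_push_letter)

lemma set_push_letter: "set (push_letter a w) \<subseteq> insert a (set w)"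
  by (cases w) auto

lemma set_foldr_push: "set (foldr push_letter u v) \<subseteq> set u \<union> set v"
  by (induction u) (use set_push_letter in fastforce)+

lemma push_letter_inv_letter:
  assumes "reduced w"
  shows "push_letter a (push_letter (inv_letter a) w) = w"
proof (cases w)
  case (Cons b w')
  then show ?thesis
    using assms push_letter_reduced_Cons[of a w'] by auto
qed simp

text \<open>Pushing letters is an action on reduced words in which inverse letters act inversely, so
  a cancellation inside the left factor does not change its effect. Associativity of the free group
  rests on this.\<close>

lemma foldr_push_push_letter:
  assumes "reduced w"
  shows "foldr push_letter (push_letter a v) w = push_letter a (foldr push_letter v w)"
  using push_letter_inv_letter[OF reduced_foldr_push[OF assms], of a]
  by (cases v) auto

lemma foldr_push_assoc:
  assumes "reduced w"
  shows "foldr push_letter (foldr push_letter u v) w = foldr push_letter u (foldr push_letter v w)"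
  by (induction u) (simp_all add: foldr_push_push_letter[OF assms])

lemma foldr_push_inverse:
  "reduced u \<Longrightarrow> foldr push_letter (rev (map inv_letter u)) u = []"
proof (induction u)
  case (Cons a u)
  have "push_letter (inv_letter a) (a # u) = u"
    by simp
  then show ?case using Cons reduced_ConsD by auto
qed simp

lemma free_group_group: "group (free_group I)"
proof (rule groupI)
  fix u v assume "u \<in> carrier (free_group I)" "v \<in> carrier (free_group I)"
  then show "u \<otimes>\<^bsub>free_group I\<^esub> v \<in> carrier (free_group I)"
    using set_foldr_push[of u v] by (auto simp: free_group_def reduced_foldr_push)
next
  fix u assume u: "u \<in> carrier (free_group I)"
  let ?v = "foldr push_letter (rev (map inv_letter u)) []"
  have "set ?v \<subseteq> I \<times> UNIV"
    using set_foldr_push[of "rev (map inv_letter u)" "[]"] u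
    by (fastforce simp: free_group_def inv_letter_def)
  then have "?v \<in> carrier (free_group I)"
    by (simp add: free_group_def reduced_foldr_push)
  moreover have "?v \<otimes>\<^bsub>free_group I\<^esub> u = \<one>\<^bsub>free_group I\<^esub>"
    using u by (simp add: free_group_def foldr_push_assoc foldr_push_inverse)
  ultimately show "\<exists>v \<in> carrier (free_group I). v \<otimes>\<^bsub>free_group I\<^esub> u = \<one>\<^bsub>free_group I\<^esub>"
    by blast
qed (simp_all add: free_group_def foldr_push_assoc)

lemma free_gen_carrier: "i \<in> I \<Longrightarrow> free_gen i \<in> carrier (free_group I)"
  by (simp add: free_group_def free_gen_def)

lemma free_group_generate: "generate (free_group I) (free_gen ` I) = carrier (free_group I)"
proof -
  interpret F: group "free_group I" by (rule free_group_group)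
  have sub: "free_gen ` I \<subseteq> carrier (free_group I)"
    using free_gen_carrier by blast
  have "w \<in> generate (free_group I) (free_gen ` I)" if "w \<in> carrier (free_group I)" for w
    using that
  proof (induction w)
    case Nil
    then show ?case using generate.one[of "free_group I"] by (simp add: free_group_def)
  next
    case (Cons a w)
    obtain i b where a: "a = (i, b)" by (cases a)
    have i: "i \<in> I" using Cons.prems a by (simp add: free_group_def)
    have "inv\<^bsub>free_group I\<^esub> free_gen i = [(i, False)]"
      using i by (intro F.inv_equality) (simp_all add: free_group_def free_gen_def inv_letter_def)
    then have "[a] \<in> generate (free_group I) (free_gen ` I)"
      using i a generate.incl[of "free_gen i" "free_gen ` I" "free_group I"]
        generate.inv[of "free_gen i" "free_gen ` I" "free_group I"]
      by (cases b) (auto simp: free_gen_def)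
    moreover have "w \<in> generate (free_group I) (free_gen ` I)"
      using Cons reduced_ConsD by (auto simp: free_group_def)
    moreover have "[a] \<otimes>\<^bsub>free_group I\<^esub> w = a # w"
      using Cons.prems push_letter_reduced_Cons by (simp add: free_group_def)
    ultimately show ?case by (metis generate.eng)
  qed
  then show ?thesis using F.generate_incl[OF sub] by blast
qed

lemma magnus_group_free_group:
  assumes "finite I"
  shows "magnus_group (free_group I) I free_gen magnus"
proof -
  interpret F: group "free_group I" by (rule free_group_group)
  show ?thesis
  proof unfold_locales
    show "magnus (a \<otimes>\<^bsub>free_group I\<^esub> b) = magnus a * magnus b" for a b
      by (simp add: free_group_def magnus_foldr_push)
    show "magnus \<one>\<^bsub>free_group I\<^esub> = 1"
      by (simp add: free_group_def)
    show "magnus (free_gen i) = 1 + nc_X i" for i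
      by (simp add: free_gen_def magnus_Cons)
  qed (use assms free_gen_carrier free_group_generate in auto)
qed

lemma (in group) normal_closure_normal:
  assumes "S \<subseteq> carrier G"
  shows "normal_closure G S \<lhd> G"
  unfolding normal_closure_def
proof (rule normal_generateI)
  show "{g \<otimes> s \<otimes> inv g | g s. g \<in> carrier G \<and> s \<in> S} \<subseteq> carrier G"
    using assms by auto
next
  fix h g assume h: "h \<in> {g \<otimes> s \<otimes> inv g | g s. g \<in> carrier G \<and> s \<in> S}" and g: "g \<in> carrier G"
  then obtain k s where k: "h = k \<otimes> s \<otimes> inv k" "k \<in> carrier G" "s \<in> S" by blast
  then have s: "s \<in> carrier G" using assms by blast
  have "g \<otimes> h \<otimes> inv g = (g \<otimes> k) \<otimes> s \<otimes> inv (g \<otimes> k)"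
    using g k s by (simp add: word_simps)
  then show "g \<otimes> h \<otimes> inv g \<in> {g \<otimes> s \<otimes> inv g | g s. g \<in> carrier G \<and> s \<in> S}"
    using g k by blast
qed

lemma (in group) normal_closure_subset:
  assumes "S \<subseteq> N" "N \<lhd> G"
  shows "normal_closure G S \<subseteq> N"
  unfolding normal_closure_def
  using assms normal.inv_op_closed2[OF assms(2)]
  by (intro generate_subgroup_incl normal_imp_subgroup) auto

lemma (in group) normal_closure_superset:
  assumes "S \<subseteq> carrier G"
  shows "S \<subseteq> normal_closure G S"
proof
  fix s assume s: "s \<in> S"
  then have "s = \<one> \<otimes> s \<otimes> inv \<one>" using assms by auto
  then show "s \<in> normal_closure G S"
    unfolding normal_closure_def using s by (intro generate.incl) blast
qed

lemma (in normal) group_hom_Mod: "group_hom G (G Mod H) (\<lambda>a. H #> a)"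
  by (simp add: group_hom_def group_hom_axioms_def factorgroup_is_group r_coset_hom_Mod group_axioms)

lemma (in normal) coset_eq_one_iff: "a \<in> carrier G \<Longrightarrow> H #> a = \<one>\<^bsub>G Mod H\<^esub> \<longleftrightarrow> a \<in> H"
  using coset_join1[OF _ _ subgroup_axioms] coset_join2[OF _ subgroup_axioms] by auto

section \<open>Two-sided ideals and their congruence subgroups\<close>

definition nc_ideal :: "ncseries set \<Rightarrow> bool" where
  "nc_ideal J \<longleftrightarrow> 0 \<in> J \<and> (\<forall>P\<in>J. \<forall>Q\<in>J. P + Q \<in> J) \<and> (\<forall>P\<in>J. \<forall>Q. Q * P \<in> J \<and> P * Q \<in> J)"

lemma (in magnus_group) ideal_congruence_normal:
  assumes J: "nc_ideal J"
  shows "{a \<in> carrier G. M a - 1 \<in> J} \<lhd> G" (is "?N \<lhd> G")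
proof -
  have add: "P + Q \<in> J" if "P \<in> J" "Q \<in> J" for P Q
    using J that by (simp add: nc_ideal_def)
  have mult: "Q * P \<in> J" "P * Q \<in> J" if "P \<in> J" for P Q
    using J that by (simp_all add: nc_ideal_def)
  have sub: "subgroup ?N G"
  proof (rule subgroupI)
    have "\<one> \<in> ?N" using J by (simp add: M_one nc_ideal_def)
    then show "?N \<noteq> {}" by blast
  next
    fix a assume a: "a \<in> ?N"
    then have "M (inv a) - 1 = - M (inv a) * (M a - 1)"
      using M_inv[of a] by (simp add: algebra_simps)
    also have "\<dots> \<in> J" using a by (intro mult) simp
    finally show "inv a \<in> ?N" using a by simp
  next
    fix a b assume ab: "a \<in> ?N" "b \<in> ?N"
    then have "M (a \<otimes> b) - 1 = (M a - 1) * M b + (M b - 1)"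
      by (simp add: M_mult algebra_simps)
    also have "\<dots> \<in> J" using ab by (intro add mult) simp_all
    finally show "a \<otimes> b \<in> ?N" using ab by simp
  qed blast
  have "g \<otimes> a \<otimes> inv g \<in> ?N" if g: "g \<in> carrier G" and a: "a \<in> ?N" for g a
  proof -
    have "M g * M (inv g) = 1" using M_mult[of g "inv g"] M_one g by simp
    then have "M (g \<otimes> a \<otimes> inv g) - 1 = M g * (M a - 1) * M (inv g)"
      using g a by (simp add: M_mult algebra_simps)
    also have "\<dots> \<in> J" using a by (intro mult) simp
    finally show ?thesis using g a by simp
  qed
  then show ?thesis using sub normal_inv_iff by blast
qed

text \<open>The kernel of the representation by unitriangular matrices along the path \<open>u\<close>, with entries
  modulo \<open>m\<close>.\<close>

definition path_ideal :: "nat list \<Rightarrow> int \<Rightarrow> ncseries set" where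
  "path_ideal u m = {P. \<forall>a s b. u = a @ s @ b \<longrightarrow> m dvd nc_coeff P s}"

lemma path_ideal_ideal: "nc_ideal (path_ideal u m)"
  unfolding nc_ideal_def
proof (intro conjI ballI allI)
  fix P Q assume P: "P \<in> path_ideal u m"
  show "Q * P \<in> path_ideal u m"
    unfolding path_ideal_def
  proof (intro CollectI allI impI)
    fix a s b assume u: "u = a @ s @ b"
    have "m dvd nc_coeff P (drop k s)" for k
    proof -
      have "u = (a @ take k s) @ drop k s @ b" using u by simp
      then show ?thesis using P unfolding path_ideal_def by blast
    qed
    then show "m dvd nc_coeff (Q * P) s"
      unfolding nc_coeff_mult_eq_sum by (intro dvd_sum dvd_mult)
  qed
  show "P * Q \<in> path_ideal u m"
    unfolding path_ideal_def
  proof (intro CollectI allI impI)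
    fix a s b assume u: "u = a @ s @ b"
    have "m dvd nc_coeff P (take k s)" for k
    proof -
      have "u = a @ take k s @ (drop k s @ b)" using u by simp
      then show ?thesis using P unfolding path_ideal_def by blast
    qed
    then show "m dvd nc_coeff (P * Q) s"
      unfolding nc_coeff_mult_eq_sum by (intro dvd_sum dvd_mult2)
  qed
qed (auto simp: path_ideal_def)

lemma path_ideal_order:
  assumes "nc_order_ge k P" "length u < k"
  shows "P \<in> path_ideal u m"
  using assms by (auto simp: path_ideal_def nc_order_ge_def)

lemma path_ideal_power:
  assumes "\<And>a s b. u = a @ s @ b \<Longrightarrow> s \<noteq> [] \<Longrightarrow> set s \<subseteq> {i} \<Longrightarrow> m dvd int (n choose length s)"
  shows "(1 + nc_X i) ^ n - 1 \<in> path_ideal u m"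
  unfolding path_ideal_def
proof (intro CollectI allI impI)
  fix a s b assume "u = a @ s @ b"
  then show "m dvd nc_coeff ((1 + nc_X i) ^ n - 1) s"
    using assms[of a s b] by (cases "s = []") (simp_all add: nc_coeff_one_plus_X_power nc_coeff_1)
qed

lemma path_ideal_coeff: "P \<in> path_ideal u m \<Longrightarrow> m dvd nc_coeff P u"
  unfolding path_ideal_def by (metis (mono_tags, lifting) append_Nil append_Nil2 mem_Collect_eq)

lemma (in group) lcs_quotient:
  "group_hom G (G Mod lcs G k) (\<lambda>a. lcs G k #> a)"
  "(\<lambda>a. lcs G k #> a) ` carrier G = carrier (G Mod lcs G k)"
  "lcs (G Mod lcs G k) k = {\<one>\<^bsub>G Mod lcs G k\<^esub>}"
  "a \<in> carrier G \<Longrightarrow> lcs G k #> a = \<one>\<^bsub>G Mod lcs G k\<^esub> \<longleftrightarrow> a \<in> lcs G k"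
proof -
  interpret N: normal "lcs G k" G by (rule lcs_normal)
  interpret h: group_hom G "G Mod lcs G k" "\<lambda>a. lcs G k #> a" by (rule N.group_hom_Mod)
  show "group_hom G (G Mod lcs G k) (\<lambda>a. lcs G k #> a)" by (rule N.group_hom_Mod)
  show surj: "(\<lambda>a. lcs G k #> a) ` carrier G = carrier (G Mod lcs G k)"
    by (simp add: carrier_FactGroup)
  show iff: "lcs G k #> a = \<one>\<^bsub>G Mod lcs G k\<^esub> \<longleftrightarrow> a \<in> lcs G k" if "a \<in> carrier G" for a
    using that by (rule N.coset_eq_one_iff)
  have "(\<lambda>a. lcs G k #> a) ` lcs G k = (\<lambda>a. \<one>\<^bsub>G Mod lcs G k\<^esub>) ` lcs G k"
    by (rule image_cong[OF refl]) (use iff lcs_carrier in blast)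
  then show "lcs (G Mod lcs G k) k = {\<one>\<^bsub>G Mod lcs G k\<^esub>}"
    using h.image_lcs[OF surj, of k] image_constant[OF lcs_one] by metis
qed

lemma (in group) foldl_gcomm_pow_in_lcs:
  assumes "set (a # t) \<subseteq> carrier G" "b \<in> set (a # t)" "b [^] (m::nat) = \<one>"
  shows "foldl (gcomm G) a t [^] m \<in> lcs G (Suc (Suc (length t)))"
proof -
  let ?N = "lcs G (Suc (Suc (length t)))"
  let ?Q = "G Mod ?N" and ?h = "\<lambda>a. ?N #> a"
  interpret h: group_hom G ?Q ?h by (rule lcs_quotient)
  have cl: "foldl (gcomm G) a t \<in> carrier G"
    using assms by (simp add: foldl_gcomm_closed)
  have "foldl (gcomm ?Q) (?h a) (map ?h t) [^]\<^bsub>?Q\<^esub> m = \<one>\<^bsub>?Q\<^esub>"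
  proof (rule h.H.foldl_gcomm_pow_eq_one)
    show "lcs ?Q (Suc (Suc (length t))) = {\<one>\<^bsub>?Q\<^esub>}" by (rule lcs_quotient)
    show "set (?h a # map ?h t) \<subseteq> carrier ?Q" using assms(1) h.hom_closed by auto
    show "?h b \<in> set (?h a # map ?h t)" using assms(2) by auto
    show "?h b [^]\<^bsub>?Q\<^esub> m = \<one>\<^bsub>?Q\<^esub>"
      using assms h.hom_nat_pow[of b m] h.hom_one by auto
  qed simp
  then have "?h (foldl (gcomm G) a t [^] m) = \<one>\<^bsub>?Q\<^esub>"
    using h.hom_foldl_gcomm[of a t] h.hom_nat_pow[OF cl] assms(1) by simp
  then show ?thesis
    using lcs_quotient(4) cl by simp
qed

context magnus_group
begin

text \<open>Passing to the quotient by the next term turns \<open>dynkin_criterion\<close> into a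
  statement about groups of any class.\<close>

lemma dynkin_criterion_lcs:
  fixes H (structure) and m :: "nat multiset \<Rightarrow> nat"
  assumes q: "group_hom G H q" "q ` carrier G = carrier H"
    and w: "1 \<le> w" and f: "f \<in> lcs G w"
    and torsion: "\<And>u. u \<in> words I w \<Longrightarrow>
      foldl (gcomm H) (q (e (hd u))) (map (\<lambda>i. q (e i)) (tl u)) [^]\<^bsub>H\<^esub> m (mset u) \<in> lcs H (Suc w)"
    and divides: "\<And>u. u \<in> words I w \<Longrightarrow> int (m (mset u)) dvd nc_coeff (M f) u"
    and coprime: "\<And>u. u \<in> words I w \<Longrightarrow> \<exists>k \<in> set u. coprime (count (mset u) k) (m (mset u))"
  shows "q f \<in> lcs H (Suc w)"
proof -
  interpret q: group_hom G H q by fact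
  let ?N = "lcs H (Suc w)"
  let ?Q = "H Mod ?N" and ?h = "\<lambda>a. ?N #>\<^bsub>H\<^esub> a"
  interpret h: group_hom H ?Q ?h by (rule q.H.lcs_quotient)
  have hq: "group_hom G ?Q (\<lambda>a. ?h (q a))"
    by unfold_locales (simp add: hom_def)
  have "?h (q f) = \<one>\<^bsub>?Q\<^esub>"
  proof (rule dynkin_criterion[OF hq _ _ w f _ divides coprime])
    show "(\<lambda>a. ?h (q a)) ` carrier G = carrier ?Q"
      using q(2) q.H.lcs_quotient(2)[of "Suc w"] by (metis image_image)
    show "lcs ?Q (Suc w) = {\<one>\<^bsub>?Q\<^esub>}" by (rule q.H.lcs_quotient)
    fix u assume u: "u \<in> words I w"
    then have uI: "u \<noteq> []" "set u \<subseteq> I" using w by (auto simp: words_def)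
    let ?C = "foldl (gcomm H) (q (e (hd u))) (map (\<lambda>i. q (e i)) (tl u))"
    have cl: "q (e (hd u)) \<in> carrier H" "set (map (\<lambda>i. q (e i)) (tl u)) \<subseteq> carrier H"
      using uI gen_closed by (cases u; auto)+
    then have C: "?C \<in> carrier H" by (rule q.H.foldl_gcomm_closed)
    have "?h (?C [^]\<^bsub>H\<^esub> m (mset u)) = \<one>\<^bsub>?Q\<^esub>"
      using torsion[OF u] q.H.lcs_quotient(4) C by blast
    then show "foldl (gcomm ?Q) (?h (q (e (hd u)))) (map (\<lambda>i. ?h (q (e i))) (tl u)) [^]\<^bsub>?Q\<^esub> m (mset u) = \<one>\<^bsub>?Q\<^esub>"
      using h.hom_foldl_gcomm[OF cl] h.hom_nat_pow[OF C] by (simp add: comp_def)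
  qed
  then show ?thesis
    using q.H.lcs_quotient(4)[of "q f" "Suc w"] lcs_carrier[OF f] by simp
qed

lemma coeff_M_singleton_mult:
  "a \<in> carrier G \<Longrightarrow> b \<in> carrier G \<Longrightarrow> nc_coeff (M (a \<otimes> b)) [i] = nc_coeff (M a) [i] + nc_coeff (M b) [i]"
  using coeff_M_lcs_mult[of 1 a b "[i]"] by simp

lemma coeff_M_singleton_pow:
  assumes "a \<in> carrier G"
  shows "nc_coeff (M (a [^] (z::int))) [i] = z * nc_coeff (M a) [i]"
proof -
  have nat: "nc_coeff (M (a [^] n)) [i] = int n * nc_coeff (M a) [i]" for n :: nat
    using assms by (induction n) (simp_all add: M_one nc_coeff_1 coeff_M_singleton_mult algebra_simps)
  show ?thesis
  proof (cases z rule: int_cases2)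
    case (nonneg n)
    then show ?thesis using nat by (simp add: int_pow_int)
  next
    case (nonpos n)
    have "nc_coeff (M (inv (a [^] n))) [i] = - nc_coeff (M (a [^] n)) [i]"
      using coeff_M_lcs_inv[of 1 "a [^] n" "[i]"] assms by simp
    then show ?thesis using nonpos nat assms by (simp add: int_pow_neg_int)
  qed
qed

end

text \<open>The falling factorial, \<open>fact n\<close> times the binomial coefficient of
  \<open>e\<close> over \<open>n\<close>. Exponent sums may be negative, and keeping the factorial
  avoids division.\<close>

definition falling :: "int \<Rightarrow> nat \<Rightarrow> int" where
  "falling e n = (\<Prod>l<n. e - int l)"

lemma falling_Suc_Suc: "falling (e + 1) (Suc n) = falling e (Suc n) + int (Suc n) * falling e n"
proof -
  have "falling (e + 1) (Suc n) = (e + 1) * falling e n"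
    unfolding falling_def by (subst prod.lessThan_Suc_shift) simp
  moreover have "falling e (Suc n) = falling e n * (e - int n)"
    by (simp add: falling_def)
  ultimately show ?thesis by (simp add: algebra_simps)
qed

text \<open>\<open>A\<close> and \<open>B\<close> play the coefficients of two series related by a
  factor \<open>1 + X\<close>, so their exponents differ by one. The equivalence serves a letter in
  one direction and its inverse in the other.\<close>

lemma falling_step:
  fixes A B :: "nat \<Rightarrow> int"
  assumes A0: "A 0 = 1" and B0: "B 0 = 1" and AB: "\<And>n. A (Suc n) = B (Suc n) + B n"
  shows "(\<forall>n. fact n * A n = falling (A 1) n) \<longleftrightarrow> (\<forall>n. fact n * B n = falling (B 1) n)"
proof -
  have e: "A 1 = B 1 + 1" using AB[of 0] B0 by simp
  show ?thesis
  proof (intro iffI allI)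
    fix n assume B: "\<forall>n. fact n * B n = falling (B 1) n"
    show "fact n * A n = falling (A 1) n"
    proof (cases n)
      case (Suc k)
      have "fact n * A n = fact (Suc k) * B (Suc k) + int (Suc k) * (fact k * B k)"
        by (simp add: Suc AB algebra_simps)
      then show ?thesis
        using B e falling_Suc_Suc[of "B 1" k] Suc by metis
    qed (simp add: A0 falling_def)
  next
    fix n assume A: "\<forall>n. fact n * A n = falling (A 1) n"
    show "fact n * B n = falling (B 1) n"
    proof (induction n)
      case (Suc k)
      have "fact (Suc k) * A (Suc k) = fact (Suc k) * B (Suc k) + int (Suc k) * (fact k * B k)"
        by (simp add: AB algebra_simps)
      then show ?case
        using A e falling_Suc_Suc[of "B 1" k] Suc by (metis add_right_cancel)
    qed (simp add: B0 falling_def)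
  qed
qed

lemma nc_coeff_one_plus_X_mult_replicate:
  "nc_coeff ((1 + nc_X k) * P) (replicate (Suc n) i)
    = nc_coeff P (replicate (Suc n) i) + (if k = i then nc_coeff P (replicate n i) else 0)"
  by (simp add: distrib_right nc_coeff_X_mult)

lemma magnus_coeff_Nil: "nc_coeff (magnus w) [] = 1"
  by (induction w) (auto simp: magnus_Cons nc_coeff_1 nc_coeff_X nc_X_inverse_def)

text \<open>Setting all indeterminates except \<open>X_i\<close> to zero turns
  \<open>magnus w\<close> into the power of \<open>1 + X_i\<close> given by the exponent sum of
  \<open>i\<close> in \<open>w\<close>, whose coefficients are binomial.\<close>

lemma magnus_coeff_replicate:
  "fact n * nc_coeff (magnus w) (replicate n i) = falling (nc_coeff (magnus w) [i]) n"
proof -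
  have "\<forall>n. fact n * nc_coeff (magnus w) (replicate n i) = falling (nc_coeff (magnus w) (replicate 1 i)) n"
  proof (induction w)
    case Nil
    show ?case
    proof
      fix n show "fact n * nc_coeff (magnus []) (replicate n i) = falling (nc_coeff (magnus []) (replicate 1 i)) n"
        by (cases n) (auto simp: nc_coeff_1 falling_def)
    qed
  next
    case (Cons a w)
    obtain k b where a: "a = (k, b)" by (cases a)
    let ?A = "\<lambda>n. nc_coeff (magnus (a # w)) (replicate n i)" and ?B = "\<lambda>n. nc_coeff (magnus w) (replicate n i)"
    show ?case
    proof (cases "k = i")
      case False
      have "?A n = ?B n" for n
      proof (cases b)
        case True
        then show ?thesis
          using False a nc_coeff_one_plus_X_mult_replicate[of k "magnus w" _ i]
          by (cases n) (simp_all add: magnus_Cons magnus_coeff_Nil nc_coeff_X nc_coeff_1)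
      next
        case b: False
        have "(1 + nc_X k) * magnus (a # w) = magnus w"
          using a b by (simp add: magnus_Cons nc_X_inverse flip: mult.assoc)
        then show ?thesis
          using False nc_coeff_one_plus_X_mult_replicate[of k "magnus (a # w)" _ i]
          by (cases n) (simp_all add: magnus_coeff_Nil)
      qed
      then show ?thesis using Cons.IH by (simp only: simp_thms)
    next
      case k: True
      show ?thesis
      proof (cases b)
        case True
        have "(\<forall>n. fact n * ?A n = falling (?A 1) n) \<longleftrightarrow> (\<forall>n. fact n * ?B n = falling (?B 1) n)"
        proof (rule falling_step)
          show "?A (Suc n) = ?B (Suc n) + ?B n" for n
            using True a k nc_coeff_one_plus_X_mult_replicate[of k "magnus w" n i]
            by (simp add: magnus_Cons)
        qed (simp_all add: magnus_coeff_Nil)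
        then show ?thesis using Cons.IH by simp
      next
        case False
        have eq: "(1 + nc_X k) * magnus (a # w) = magnus w"
          using a False by (simp add: magnus_Cons nc_X_inverse flip: mult.assoc)
        have "(\<forall>n. fact n * ?B n = falling (?B 1) n) \<longleftrightarrow> (\<forall>n. fact n * ?A n = falling (?A 1) n)"
        proof (rule falling_step)
          show "?B (Suc n) = ?A (Suc n) + ?A n" for n
            using k nc_coeff_one_plus_X_mult_replicate[of k "magnus (a # w)" n i] unfolding eq by simp
        qed (simp_all add: magnus_coeff_Nil)
        then show ?thesis using Cons.IH by simp
      qed
    qed
  qed
  then show ?thesis by simp
qed

text \<open>\<open>fact p\<close> supplies one factor \<open>p\<close> beyond those of
  \<open>c\<close>. As \<open>p\<close> divides \<open>e\<close>, the remaining factors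
  \<open>e - 1\<close>, ..., \<open>e - (p - 1)\<close> are prime to \<open>p\<close>, so the whole
  power falls on \<open>e\<close>.\<close>

lemma prime_power_Suc_dvd_of_falling:
  fixes p a :: nat and e :: int
  assumes p: "Factorial_Ring.prime p" and a: "1 \<le> a"
    and e: "int (p ^ a) dvd e" and c: "int (p ^ a) dvd c" "fact p * c = falling e p"
  shows "int (p ^ Suc a) dvd e"
proof -
  obtain n where n: "p = Suc n" using prime_gt_0_nat[OF p] by (cases p) auto
  have pp: "Factorial_Ring.prime (int p)" using p by simp
  have "int p dvd int (p ^ a)" using a by simp
  then have pe: "int p dvd e" using e by (rule dvd_trans)
  have "p dvd fact p" using prime_gt_0_nat[OF p] by (intro dvd_fact) simp_all
  then have "int p dvd (fact p :: int)" by (metis int_dvd_int_iff of_nat_fact)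
  then have "int p * int (p ^ a) dvd fact p * c" using c(1) by (rule mult_dvd_mono)
  then have "int (p ^ Suc a) dvd falling e p" using c(2) by simp
  moreover have "falling e p = e * (\<Prod>l<n. e - int (Suc l))"
    unfolding falling_def n by (subst prod.lessThan_Suc_shift) simp
  moreover have "coprime (int (p ^ Suc a)) (\<Prod>l<n. e - int (Suc l))"
  proof (rule prod_coprime_right)
    fix l assume "l \<in> {..<n}"
    then have "\<not> p dvd Suc l" using n by (simp add: nat_dvd_not_less)
    then have "\<not> int p dvd int (Suc l)" by (metis int_dvd_int_iff)
    then have "\<not> int p dvd e - int (Suc l)"
      using pe by (metis dvd_diff_right_iff)
    then have "coprime (int p) (e - int (Suc l))"
      using pp by (simp add: prime_imp_coprime)
    then show "coprime (int (p ^ Suc a)) (e - int (Suc l))"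
      by (metis coprime_power_left_iff of_nat_power)
  qed
  ultimately show ?thesis
    by (metis coprime_dvd_mult_left_iff)
qed

declare One_nat_def [simp del]

section \<open>The nilpotent product of cyclic groups\<close>

definition nil_proj :: "(nat \<Rightarrow> nat) \<Rightarrow> nat \<Rightarrow> nat \<Rightarrow> word \<Rightarrow> word set set" where
  "nil_proj ords r k w =
     r_coset (cyc_free_product ords r) (lcs (cyc_free_product ords r) (k + 1))
       (r_coset (free_group {1..r}) (normal_closure (free_group {1..r}) (cyc_relators ords r)) w)"

lemma nil_proj_gen: "nil_proj ords r k (free_gen i) = cyc_nil_gen ords r k i"
  by (simp add: nil_proj_def cyc_nil_gen_def cyc_free_product_gen_def)

lemma cyc_relators_subset: "cyc_relators ords r \<subseteq> carrier (free_group {1..r})"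
proof -
  interpret F: group "free_group {1..r}" by (rule free_group_group)
  show ?thesis
    unfolding cyc_relators_def using F.nat_pow_closed[OF free_gen_carrier] by blast
qed

lemma cyc_free_product_hom:
  "group_hom (free_group {1..r}) (cyc_free_product ords r)
     (\<lambda>w. normal_closure (free_group {1..r}) (cyc_relators ords r) #>\<^bsub>free_group {1..r}\<^esub> w)"
proof -
  interpret F: group "free_group {1..r}" by (rule free_group_group)
  show ?thesis
    unfolding cyc_free_product_def
    by (intro normal.group_hom_Mod F.normal_closure_normal cyc_relators_subset)
qed

lemma nil_proj_hom:
  "group_hom (free_group {1..r}) (cyc_nil_product ords r k) (nil_proj ords r k)"
  "nil_proj ords r k ` carrier (free_group {1..r}) = carrier (cyc_nil_product ords r k)"
proof -
  let ?R = "normal_closure (free_group {1..r}) (cyc_relators ords r)"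
  interpret \<pi>: group_hom "free_group {1..r}" "cyc_free_product ords r"
    "\<lambda>w. ?R #>\<^bsub>free_group {1..r}\<^esub> w" by (rule cyc_free_product_hom)
  interpret h: group_hom "cyc_free_product ords r" "cyc_nil_product ords r k"
    "\<lambda>a. lcs (cyc_free_product ords r) (k + 1) #>\<^bsub>cyc_free_product ords r\<^esub> a"
    unfolding cyc_nil_product_def by (rule \<pi>.H.lcs_quotient)
  show "group_hom (free_group {1..r}) (cyc_nil_product ords r k) (nil_proj ords r k)"
    using hom_compose[OF \<pi>.homh h.homh]
    by unfold_locales (simp add: nil_proj_def[abs_def] comp_def)
  have "(\<lambda>w. ?R #>\<^bsub>free_group {1..r}\<^esub> w) ` carrier (free_group {1..r}) = carrier (cyc_free_product ords r)"
    by (simp add: cyc_free_product_def carrier_FactGroup)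
  then show "nil_proj ords r k ` carrier (free_group {1..r}) = carrier (cyc_nil_product ords r k)"
    unfolding nil_proj_def cyc_nil_product_def carrier_FactGroup by (metis image_image)
qed

lemma lcs_cyc_nil_product: "lcs (cyc_nil_product ords r k) (k + 1) = {\<one>\<^bsub>cyc_nil_product ords r k\<^esub>}"
proof -
  interpret \<pi>: group_hom "free_group {1..r}" "cyc_free_product ords r"
    "\<lambda>w. normal_closure (free_group {1..r}) (cyc_relators ords r) #>\<^bsub>free_group {1..r}\<^esub> w"
    by (rule cyc_free_product_hom)
  show ?thesis unfolding cyc_nil_product_def by (rule \<pi>.H.lcs_quotient)
qed

text \<open>The kernel of the projection is the product of the normal closure of the relators and
  the term \<open>k + 1\<close>. The lemma is applied to congruence subgroups of ideals.\<close>

lemma nil_proj_eq_one: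
  assumes w: "w \<in> carrier (free_group {1..r})"
    and one: "nil_proj ords r k w = \<one>\<^bsub>cyc_nil_product ords r k\<^esub>"
    and N: "N \<lhd> free_group {1..r}" "cyc_relators ords r \<subseteq> N" "lcs (free_group {1..r}) (k + 1) \<subseteq> N"
  shows "w \<in> N"
proof -
  let ?F = "free_group {1..r}"
  let ?R = "normal_closure ?F (cyc_relators ords r)"
  interpret \<pi>: group_hom ?F "cyc_free_product ords r" "\<lambda>w. ?R #>\<^bsub>?F\<^esub> w"
    by (rule cyc_free_product_hom)
  interpret R: normal ?R ?F by (intro \<pi>.G.normal_closure_normal cyc_relators_subset)
  interpret N: normal N ?F by (rule N)
  have surj: "(\<lambda>w. ?R #>\<^bsub>?F\<^esub> w) ` carrier ?F = carrier (cyc_free_product ords r)"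
    by (simp add: cyc_free_product_def carrier_FactGroup)
  have "?R #>\<^bsub>?F\<^esub> w \<in> lcs (cyc_free_product ords r) (k + 1)"
    using one \<pi>.H.lcs_quotient(4)[OF \<pi>.hom_closed[OF w]] unfolding nil_proj_def cyc_nil_product_def by blast
  then obtain l where l: "l \<in> lcs ?F (k + 1)" "?R #>\<^bsub>?F\<^esub> w = ?R #>\<^bsub>?F\<^esub> l"
    using \<pi>.image_lcs[OF surj, of "k + 1"] by blast
  have "w \<in> ?R #>\<^bsub>?F\<^esub> w" by (rule \<pi>.G.rcos_self[OF w R.subgroup_axioms])
  then have "w \<in> ?R #>\<^bsub>?F\<^esub> l" by (simp only: l(2))
  then have "\<exists>x\<in>?R. w = x \<otimes>\<^bsub>?F\<^esub> l" by (simp add: r_coset_def)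
  then obtain x where x: "x \<in> ?R" "w = x \<otimes>\<^bsub>?F\<^esub> l" ..
  have "x \<in> N" using \<pi>.G.normal_closure_subset[OF N(2,1)] x(1) by (rule subsetD)
  moreover have "l \<in> N" using N(3) l(1) by (rule subsetD)
  ultimately show ?thesis unfolding x(2) by (rule N.m_closed)
qed

lemma nil_proj_gen_pow:
  assumes "i \<in> {1..r}"
  shows "nil_proj ords r k (free_gen i) [^]\<^bsub>cyc_nil_product ords r k\<^esub> ords i = \<one>\<^bsub>cyc_nil_product ords r k\<^esub>"
proof -
  let ?F = "free_group {1..r}"
  let ?R = "normal_closure ?F (cyc_relators ords r)"
  interpret \<pi>: group_hom ?F "cyc_free_product ords r" "\<lambda>w. ?R #>\<^bsub>?F\<^esub> w"
    by (rule cyc_free_product_hom)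
  interpret R: normal ?R ?F by (intro \<pi>.G.normal_closure_normal cyc_relators_subset)
  interpret q: group_hom ?F "cyc_nil_product ords r k" "nil_proj ords r k" by (rule nil_proj_hom)
  have g: "free_gen i \<in> carrier ?F" using assms by (rule free_gen_carrier)
  let ?g = "free_gen i [^]\<^bsub>?F\<^esub> ords i"
  have "?g \<in> ?R"
    using \<pi>.G.normal_closure_superset[OF cyc_relators_subset] assms by (auto simp: cyc_relators_def)
  then have "?R #>\<^bsub>?F\<^esub> ?g = \<one>\<^bsub>cyc_free_product ords r\<^esub>"
    using R.coset_eq_one_iff[of ?g] g unfolding cyc_free_product_def by simp
  then have "nil_proj ords r k ?g = \<one>\<^bsub>cyc_nil_product ords r k\<^esub>"
    using \<pi>.H.lcs_quotient(4)[of "\<one>\<^bsub>cyc_free_product ords r\<^esub>" "k + 1"]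
    unfolding nil_proj_def cyc_nil_product_def by simp
  then show ?thesis using q.hom_nat_pow[OF g] by simp
qed

text \<open>The element \<open>?g\<close> lies in the kernel of the projection, so its series is
  \<open>1\<close> modulo \<open>J\<close>. Multiplying by the series of \<open>?x\<close> times
  \<open>f\<close> clears the inverse, and the summand \<open>magnus f\<close> then cancels.\<close>

lemma central_commutes_mod_ideal:
  assumes J: "nc_ideal J" "\<And>P. nc_order_ge (k + 1) P \<Longrightarrow> P \<in> J"
      "\<And>i. i \<in> {1..r} \<Longrightarrow> (1 + nc_X i) ^ ords i - 1 \<in> J"
    and f: "f \<in> carrier (free_group {1..r})" "nil_proj ords r k f \<in> center (cyc_nil_product ords r k)"
    and j: "j \<in> {1..r}"
  shows "magnus f * nc_X j - nc_X j * magnus f \<in> J"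
proof -
  let ?F = "free_group {1..r}" and ?G = "cyc_nil_product ords r k" and ?q = "nil_proj ords r k"
  interpret F: magnus_group ?F "{1..r}" free_gen magnus
    by (rule magnus_group_free_group) simp
  interpret q: group_hom ?F ?G ?q by (rule nil_proj_hom)
  let ?N = "{a \<in> carrier ?F. magnus a - 1 \<in> J}"
  have N: "?N \<lhd> ?F" using J(1) by (rule F.ideal_congruence_normal)
  have "magnus (free_gen i [^]\<^bsub>?F\<^esub> n) = (1 + nc_X i) ^ n" if "i \<in> {1..r}" for i and n :: nat
    using that by (induction n) (simp_all add: F.M_one F.M_mult F.M_gen free_gen_carrier power_commutes)
  then have rel: "cyc_relators ords r \<subseteq> ?N"
    using J(3) free_gen_carrier[of _ "{1..r}"] by (auto simp: cyc_relators_def)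
  have "lcs ?F (k + 1) \<subseteq> ?N"
    using J(2) F.order_M_lcs[of "k + 1"] F.lcs_carrier by auto
  note ker = nil_proj_eq_one[OF _ _ N rel this]
  let ?x = "free_gen j"
  let ?g = "f \<otimes>\<^bsub>?F\<^esub> ?x \<otimes>\<^bsub>?F\<^esub> inv\<^bsub>?F\<^esub> (?x \<otimes>\<^bsub>?F\<^esub> f)"
  have x: "?x \<in> carrier ?F" using j by (rule free_gen_carrier)
  have "?q f \<otimes>\<^bsub>?G\<^esub> ?q ?x = ?q ?x \<otimes>\<^bsub>?G\<^esub> ?q f"
    using f(2) q.hom_closed[OF x] by (simp add: center_def)
  then have "?q ?g = \<one>\<^bsub>?G\<^esub>" using f(1) x by simp
  then have "magnus ?g - 1 \<in> J" using ker[of ?g] f(1) x by simp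
  then have "(magnus ?g - 1) * (magnus ?x * magnus f) \<in> J"
    using J(1) by (simp add: nc_ideal_def)
  moreover have "magnus ?g * (magnus ?x * magnus f) = magnus f * magnus ?x"
  proof -
    have "?g \<otimes>\<^bsub>?F\<^esub> (?x \<otimes>\<^bsub>?F\<^esub> f) = f \<otimes>\<^bsub>?F\<^esub> ?x"
      using f(1) x by (simp add: F.m_assoc)
    then show ?thesis using f(1) x F.M_mult by (metis F.inv_closed F.m_closed)
  qed
  ultimately show ?thesis
    using F.M_gen[OF j] by (simp add: algebra_simps)
qed

lemma count_le_count_append:
  assumes "u = a @ s @ b" "s \<noteq> []" "set s \<subseteq> {i}"
  shows "1 \<le> length s" "length s \<le> count (mset u) i"
proof -
  have "count (mset s) i = length s"
    using assms(3) by (induction s) auto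
  then show "length s \<le> count (mset u) i" using assms(1) by simp
  show "1 \<le> length s" using assms(2) by (cases s) auto
qed

text \<open>This reads off the coefficient at \<open>u\<close> of the additive commutator of
  \<open>magnus f\<close> with \<open>nc_X j\<close>. A run of a letter inside \<open>u\<close> is
  no longer than its multiplicity, so the condition on \<open>m\<close> puts the relators into
  \<open>path_ideal u m\<close>.\<close>

lemma central_magnus_coeff:
  assumes f: "f \<in> carrier (free_group {1..r})" "nil_proj ords r k f \<in> center (cyc_nil_product ords r k)"
    and j: "j \<in> {1..r}" and u: "length u \<le> k"
    and m: "\<And>i l. i \<in> {1..r} \<Longrightarrow> 1 \<le> l \<Longrightarrow> l \<le> count (mset u) i \<Longrightarrow> m dvd int (ords i choose l)"
  shows "m dvd (if u \<noteq> [] \<and> last u = j then nc_coeff (magnus f) (butlast u) else 0)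
    - (if u \<noteq> [] \<and> hd u = j then nc_coeff (magnus f) (tl u) else 0)"
proof -
  have "magnus f * nc_X j - nc_X j * magnus f \<in> path_ideal u m"
  proof (rule central_commutes_mod_ideal[OF path_ideal_ideal _ _ f j])
    show "P \<in> path_ideal u m" if "nc_order_ge (k + 1) P" for P
      using path_ideal_order[OF that] u by simp
    show "(1 + nc_X i) ^ ords i - 1 \<in> path_ideal u m" if "i \<in> {1..r}" for i
    proof (rule path_ideal_power)
      fix a s b assume "u = a @ s @ b" "s \<noteq> []" "set s \<subseteq> {i}"
      from count_le_count_append[OF this] show "m dvd int (ords i choose length s)"
        using m[OF that] by blast
    qed
  qed
  from path_ideal_coeff[OF this]
  have "m dvd nc_coeff (magnus f * nc_X j) u - nc_coeff (nc_X j * magnus f) u" by simp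
  moreover have "nc_coeff (nc_X j * magnus f) u
      = (if u \<noteq> [] \<and> hd u = j then nc_coeff (magnus f) (tl u) else 0)"
    by (cases u) (simp_all add: nc_coeff_X_mult nc_coeff_X)
  ultimately show ?thesis by (simp only: nc_coeff_mult_X)
qed

text \<open>For \<open>p = 2\<close> the path ideals lose a factor \<open>2\<close>. The following ideal is built so that the functional
  \<open>X_i X_j \<mapsto> 1\<close>, \<open>X_i X_i X_j \<mapsto> 2\<close>, \<open>X_i X_j X_j \<mapsto> 2\<close> vanishes on it modulo \<open>2 ^ Suc m\<close>.\<close>

definition square_ideal :: "nat \<Rightarrow> nat \<Rightarrow> nat \<Rightarrow> ncseries set" where
  "square_ideal i j m = {P. nc_coeff P [] = 0 \<and> 2 ^ m dvd nc_coeff P [i] \<and> 2 ^ m dvd nc_coeff P [j]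
     \<and> 2 ^ Suc m dvd nc_coeff P [j] + 2 * nc_coeff P [i, j] + 2 * nc_coeff P [j, j]
     \<and> 2 ^ Suc m dvd nc_coeff P [i] + 2 * nc_coeff P [i, i] + 2 * nc_coeff P [i, j]
     \<and> 2 ^ Suc m dvd nc_coeff P [i, j] + 2 * nc_coeff P [i, i, j] + 2 * nc_coeff P [i, j, j]}"

lemma two_power_Suc_dvd: "(2::int) ^ m dvd a \<Longrightarrow> 2 ^ Suc m dvd 2 * a * b"
  by (simp add: mult.assoc)

text \<open>The fourth condition on \<open>P\<close> is the sixth for \<open>nc_X i * P\<close>, and
  the fifth is the sixth for \<open>P * nc_X j\<close>. What multiplication adds besides these are
  even multiples of the coefficients at \<open>[i]\<close> and \<open>[j]\<close>, which the second
  and third conditions control.\<close>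

lemma square_ideal_ideal: "nc_ideal (square_ideal i j m)"
  unfolding nc_ideal_def
proof (intro conjI ballI allI)
  fix P Q assume P: "P \<in> square_ideal i j m"
  note p = P[unfolded square_ideal_def mem_Collect_eq]
  define c where "c = nc_coeff P"
  define d where "d = nc_coeff Q"
  have c: "c [] = 0" "2 ^ m dvd c [i]" "2 ^ m dvd c [j]"
    "2 ^ Suc m dvd c [j] + 2 * c [i, j] + 2 * c [j, j]"
    "2 ^ Suc m dvd c [i] + 2 * c [i, i] + 2 * c [i, j]"
    "2 ^ Suc m dvd c [i, j] + 2 * c [i, i, j] + 2 * c [i, j, j]"
    using p unfolding c_def by blast+
  have "2 ^ Suc m dvd d [] * (c [j] + 2 * c [i, j] + 2 * c [j, j]) + 2 * c [j] * (d [i] + d [j])"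
    by (rule dvd_add[OF dvd_mult[OF c(4)] two_power_Suc_dvd[OF c(3)]])
  moreover have "2 ^ Suc m dvd d [] * (c [i] + 2 * c [i, i] + 2 * c [i, j]) + 2 * c [i] * d [i] + 2 * c [j] * d [i]"
    by (rule dvd_add[OF dvd_add[OF dvd_mult[OF c(5)] two_power_Suc_dvd[OF c(2)]] two_power_Suc_dvd[OF c(3)]])
  moreover have "2 ^ Suc m dvd d [] * (c [i, j] + 2 * c [i, i, j] + 2 * c [i, j, j])
      + d [i] * (c [j] + 2 * c [i, j] + 2 * c [j, j]) + 2 * c [j] * (d [i, i] + d [i, j])"
    by (rule dvd_add[OF dvd_add[OF dvd_mult[OF c(6)] dvd_mult[OF c(4)]] two_power_Suc_dvd[OF c(3)]])
  ultimately show "Q * P \<in> square_ideal i j m"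
    using c unfolding square_ideal_def c_def d_def
    by (simp add: nc_coeff_mult algebra_simps)
  have "2 ^ Suc m dvd d [] * (c [j] + 2 * c [i, j] + 2 * c [j, j]) + 2 * c [i] * d [j] + 2 * c [j] * d [j]"
    by (rule dvd_add[OF dvd_add[OF dvd_mult[OF c(4)] two_power_Suc_dvd[OF c(2)]] two_power_Suc_dvd[OF c(3)]])
  moreover have "2 ^ Suc m dvd d [] * (c [i] + 2 * c [i, i] + 2 * c [i, j]) + 2 * c [i] * (d [i] + d [j])"
    by (rule dvd_add[OF dvd_mult[OF c(5)] two_power_Suc_dvd[OF c(2)]])
  moreover have "2 ^ Suc m dvd d [] * (c [i, j] + 2 * c [i, i, j] + 2 * c [i, j, j])
      + d [j] * (c [i] + 2 * c [i, i] + 2 * c [i, j]) + 2 * c [i] * (d [i, j] + d [j, j])"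
    by (rule dvd_add[OF dvd_add[OF dvd_mult[OF c(6)] dvd_mult[OF c(5)]] two_power_Suc_dvd[OF c(2)]])
  ultimately show "P * Q \<in> square_ideal i j m"
    using c unfolding square_ideal_def c_def d_def
    by (simp add: nc_coeff_mult algebra_simps)
next
  fix P Q assume P: "P \<in> square_ideal i j m" and Q: "Q \<in> square_ideal i j m"
  note p = P[unfolded square_ideal_def mem_Collect_eq] and q = Q[unfolded square_ideal_def mem_Collect_eq]
  have eq: "a + a' + 2 * (b + b') + 2 * (c + c') = (a + 2 * b + 2 * c) + (a' + 2 * b' + 2 * c')"
    for a a' b b' c c' :: int by simp
  show "P + Q \<in> square_ideal i j m"
    unfolding square_ideal_def mem_Collect_eq nc_coeff_add eq
    using p q by (simp only: dvd_add add_0_left simp_thms)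
qed (simp add: square_ideal_def)

text \<open>For \<open>k = j\<close> the fourth and for \<open>k = i\<close> the fifth condition
  concerns \<open>n + 2 * (n choose 2)\<close>, which is \<open>n * n\<close> and hence divisible by
  \<open>2 ^ (m + m)\<close>. The weights \<open>2\<close> of the functional make this square
  appear.\<close>

lemma square_ideal_power:
  assumes ij: "i \<noteq> j" and m: "1 \<le> m" and n: "k = i \<or> k = j \<Longrightarrow> 2 ^ m dvd n"
  shows "(1 + nc_X k) ^ n - 1 \<in> square_ideal i j m"
proof -
  have "2 * int (n choose 2) = int n * int n - int n"
  proof -
    have "2 * (n choose 2) = n * (n - 1)"
      using times_binomial_minus1_eq[of 2 n] by simp
    then have "2 * int (n choose 2) = int (n * (n - 1))" by (metis of_nat_mult of_nat_numeral)
    then show ?thesis by (cases n) (simp_all add: algebra_simps)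
  qed
  moreover have "2 ^ Suc m dvd int n * int n" "2 ^ m dvd int n" if "k = i \<or> k = j"
  proof -
    have n': "(2::int) ^ m dvd int n"
      using n[OF that] by (metis int_dvd_int_iff of_nat_numeral of_nat_power)
    then show "2 ^ m dvd int n" .
    have "(2::int) ^ Suc m dvd 2 ^ (m + m)" using m by (intro le_imp_power_dvd) simp
    also have "2 ^ (m + m) dvd int n * int n" unfolding power_add using n' n' by (rule mult_dvd_mono)
    finally show "2 ^ Suc m dvd int n * int n" .
  qed
  ultimately show ?thesis
    using ij unfolding square_ideal_def
    by (cases "k = i"; cases "k = j")
      (auto simp: nc_coeff_one_plus_X_power nc_coeff_1 numeral_2_eq_2[symmetric])
qed

section \<open>The center for cyclic groups of prime power order\<close>

locale p_cyclic_product =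
  fixes p r :: nat and \<alpha> :: "nat \<Rightarrow> nat"
  assumes prime_p: "Factorial_Ring.prime p"
    and r_ge_2: "2 \<le> r"
    and \<alpha>_pos: "\<And>i. i \<in> {1..r} \<Longrightarrow> 1 \<le> \<alpha> i"
    and \<alpha>_mono: "\<And>i j. i \<in> {1..r} \<Longrightarrow> j \<in> {1..r} \<Longrightarrow> i \<le> j \<Longrightarrow> \<alpha> i \<le> \<alpha> j"
begin

abbreviation "F \<equiv> free_group {1..r}"
abbreviation "G \<equiv> cyc_nil_product (\<lambda>i. p ^ \<alpha> i) r (p + 1)"
abbreviation "q \<equiv> nil_proj (\<lambda>i. p ^ \<alpha> i) r (p + 1)"
abbreviation "x i \<equiv> q (free_gen i)"

sublocale F: magnus_group F "{1..r}" free_gen magnus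
  by (rule magnus_group_free_group) simp

sublocale q: group_hom F G q
  by (rule nil_proj_hom)

lemma lcs_class: "lcs G (Suc (Suc p)) = {\<one>\<^bsub>G\<^esub>}"
  using lcs_cyc_nil_product[of "\<lambda>i. p ^ \<alpha> i" r "p + 1"] by (simp add: One_nat_def)

lemma x_closed: "i \<in> {1..r} \<Longrightarrow> x i \<in> carrier G"
  using q.hom_closed free_gen_carrier by blast

lemma x_pow: "i \<in> {1..r} \<Longrightarrow> x i [^]\<^bsub>G\<^esub> (p ^ \<alpha> i) = \<one>\<^bsub>G\<^esub>"
  using nil_proj_gen_pow[of i r "\<lambda>i. p ^ \<alpha> i"] by simp

lemma center_iff: "z \<in> center G \<longleftrightarrow> z \<in> carrier G \<and> (\<forall>i \<in> {1..r}. z \<otimes>\<^bsub>G\<^esub> x i = x i \<otimes>\<^bsub>G\<^esub> z)"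
proof
  assume "z \<in> center G"
  then show "z \<in> carrier G \<and> (\<forall>i \<in> {1..r}. z \<otimes>\<^bsub>G\<^esub> x i = x i \<otimes>\<^bsub>G\<^esub> z)"
    using x_closed by (simp add: center_def)
next
  assume z: "z \<in> carrier G \<and> (\<forall>i \<in> {1..r}. z \<otimes>\<^bsub>G\<^esub> x i = x i \<otimes>\<^bsub>G\<^esub> z)"
  let ?S = "{b \<in> carrier G. gcomm G z b \<in> {\<one>\<^bsub>G\<^esub>}}"
  have "generate G (q ` (free_gen ` {1..r})) \<subseteq> ?S"
  proof (rule q.H.generate_subgroup_incl)
    show "subgroup ?S G"
      using z by (intro q.H.normal_gcomm_subgroup_right q.H.one_is_normal) simp
    have "x i \<in> ?S" if "i \<in> {1..r}" for i
      using z x_closed[OF that] q.H.gcomm_eq_one_iff[of z "x i"] that by simp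
    then show "q ` (free_gen ` {1..r}) \<subseteq> ?S" by blast
  qed
  moreover have "generate G (q ` (free_gen ` {1..r})) = carrier G"
    using q.generate_img[of "free_gen ` {1..r}"] F.gen_closed F.generate_gens
      nil_proj_hom(2)[of "\<lambda>i. p ^ \<alpha> i" r "p + 1"] by (simp add: image_subset_iff)
  ultimately have "gcomm G z g = \<one>\<^bsub>G\<^esub>" if "g \<in> carrier G" for g
    using that by blast
  then show "z \<in> center G"
    using z q.H.gcomm_eq_one_iff by (simp add: center_def)
qed

lemma center_subgroup: "subgroup (center G) G"
proof (rule q.H.subgroupI)
  show "center G \<subseteq> carrier G" by (auto simp: center_def)
  have "\<one>\<^bsub>G\<^esub> \<in> center G" by (simp add: center_def)
  then show "center G \<noteq> {}" by blast
next
  fix a assume "a \<in> center G"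
  then have a: "a \<in> carrier G" "\<And>g. g \<in> carrier G \<Longrightarrow> a \<otimes>\<^bsub>G\<^esub> g = g \<otimes>\<^bsub>G\<^esub> a"
    by (simp_all add: center_def)
  have "inv\<^bsub>G\<^esub> a \<otimes>\<^bsub>G\<^esub> g = g \<otimes>\<^bsub>G\<^esub> inv\<^bsub>G\<^esub> a" if g: "g \<in> carrier G" for g
  proof -
    have "inv\<^bsub>G\<^esub> a \<otimes>\<^bsub>G\<^esub> g = inv\<^bsub>G\<^esub> a \<otimes>\<^bsub>G\<^esub> (g \<otimes>\<^bsub>G\<^esub> a) \<otimes>\<^bsub>G\<^esub> inv\<^bsub>G\<^esub> a"
      using a(1) g by (simp add: q.H.m_assoc)
    also have "\<dots> = g \<otimes>\<^bsub>G\<^esub> inv\<^bsub>G\<^esub> a"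
      unfolding a(2)[OF g, symmetric] using a(1) g by (simp add: q.H.m_assoc)
    finally show ?thesis .
  qed
  then show "inv\<^bsub>G\<^esub> a \<in> center G" using a(1) by (simp add: center_def)
next
  fix a b assume "a \<in> center G" "b \<in> center G"
  then have a: "a \<in> carrier G" "\<And>g. g \<in> carrier G \<Longrightarrow> a \<otimes>\<^bsub>G\<^esub> g = g \<otimes>\<^bsub>G\<^esub> a"
    and b: "b \<in> carrier G" "\<And>g. g \<in> carrier G \<Longrightarrow> b \<otimes>\<^bsub>G\<^esub> g = g \<otimes>\<^bsub>G\<^esub> b"
    by (simp_all add: center_def)
  have "a \<otimes>\<^bsub>G\<^esub> b \<otimes>\<^bsub>G\<^esub> g = g \<otimes>\<^bsub>G\<^esub> (a \<otimes>\<^bsub>G\<^esub> b)" if g: "g \<in> carrier G" for g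
  proof -
    have "a \<otimes>\<^bsub>G\<^esub> b \<otimes>\<^bsub>G\<^esub> g = (a \<otimes>\<^bsub>G\<^esub> g) \<otimes>\<^bsub>G\<^esub> b"
      using a(1) b(1) g by (simp only: q.H.m_assoc b(2)[OF g])
    also have "\<dots> = g \<otimes>\<^bsub>G\<^esub> (a \<otimes>\<^bsub>G\<^esub> b)"
      using a(1) b(1) g by (simp only: q.H.m_assoc a(2)[OF g])
    finally show ?thesis .
  qed
  then show "a \<otimes>\<^bsub>G\<^esub> b \<in> center G" using a(1) b(1) by (simp add: center_def)
qed

lemma lcs_center: "lcs G (p + 1) \<subseteq> center G"
proof
  fix z assume z: "z \<in> lcs G (p + 1)"
  then show "z \<in> center G"
    using q.H.lcs_central[OF lcs_class z] q.H.lcs_carrier[OF z] by (simp add: center_def)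
qed

lemma last_gen_pow_center: "x r [^]\<^bsub>G\<^esub> (p ^ (\<alpha> (r - 1) + 1)) \<in> center G"
proof -
  let ?z = "x r [^]\<^bsub>G\<^esub> (p ^ (\<alpha> (r - 1) + 1))"
  have r: "r \<in> {1..r}" "r - 1 \<in> {1..r}" using r_ge_2 by auto
  have "?z \<otimes>\<^bsub>G\<^esub> x i = x i \<otimes>\<^bsub>G\<^esub> ?z" if i: "i \<in> {1..r}" for i
  proof (cases "i = r")
    case True
    then show ?thesis
      using q.H.pow_mult_distrib q.H.nat_pow_Suc q.H.nat_pow_Suc2 x_closed[OF r(1)] by metis
  next
    case False
    then have "\<alpha> i \<le> \<alpha> (r - 1)" using i r by (intro \<alpha>_mono) auto
    then have "p ^ \<alpha> i dvd p ^ \<alpha> (r - 1)" by (rule le_imp_power_dvd)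
    then have "x i [^]\<^bsub>G\<^esub> (p ^ \<alpha> (r - 1)) = \<one>\<^bsub>G\<^esub>"
      by (rule q.H.pow_eq_one_dvd[OF x_closed[OF i] x_pow[OF i]])
    then have "gcomm G (x i) ?z = \<one>\<^bsub>G\<^esub>"
      by (rule q.H.gcomm_prime_power_eq_one[OF prime_p lcs_class x_closed[OF r(1)] x_closed[OF i],
            unfolded Suc_eq_plus1])
    then show ?thesis
      using q.H.gcomm_eq_one_iff[of "x i" ?z] x_closed[OF i] x_closed[OF r(1)] by simp
  qed
  then show ?thesis
    unfolding center_iff using q.H.nat_pow_closed[OF x_closed[OF r(1)]] by blast
qed

lemma power_dvd_ord_choose:
  assumes "i \<in> {1..r}" "m \<le> \<alpha> i" "1 \<le> l" "l < p"
  shows "int (p ^ m) dvd int (p ^ \<alpha> i choose l)"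
proof -
  have "p ^ m dvd p ^ \<alpha> i" using assms(2) by (rule le_imp_power_dvd)
  also have "\<dots> dvd (p ^ \<alpha> i choose l)"
    using assms by (intro prime_power_dvd_binomial[OF prime_p]) auto
  finally show ?thesis by (metis int_dvd_int_iff)
qed

lemma power_dvd_ord_choose_Suc:
  assumes "i \<in> {1..r}" "Suc m \<le> \<alpha> i" "1 \<le> l" "l \<le> p"
  shows "int (p ^ m) dvd int (p ^ \<alpha> i choose l)"
proof -
  obtain b where b: "\<alpha> i = Suc b" "m \<le> b" using assms(2) by (cases "\<alpha> i") auto
  have "p ^ m dvd p ^ b" using b(2) by (rule le_imp_power_dvd)
  also have "\<dots> dvd (p ^ \<alpha> i choose l)"
    unfolding b(1) using assms by (intro prime_power_dvd_binomial_Suc[OF prime_p]) auto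
  finally show ?thesis by (metis int_dvd_int_iff)
qed

section \<open>Congruences for the coefficients of a central element\<close>

context
  fixes f assumes f: "f \<in> carrier F" "q f \<in> center G"
begin

text \<open>In the word formed by \<open>j\<close> and \<open>n\<close> copies of \<open>i\<close>
  the first letter is \<open>j\<close> and the last is not, so only the coefficient at the copies of
  \<open>i\<close> survives. The letter \<open>j\<close> occurs once, which asks only for
  \<open>m \<le> \<alpha> j\<close>.\<close>

lemma central_coeff_replicate:
  assumes ij: "i \<in> {1..r}" "j \<in> {1..r}" "i \<noteq> j" and m: "m \<le> \<alpha> j"
    and n: "1 \<le> n" "n \<le> p" "\<And>l. 1 \<le> l \<Longrightarrow> l \<le> n \<Longrightarrow> int (p ^ m) dvd int (p ^ \<alpha> i choose l)"
  shows "int (p ^ m) dvd nc_coeff (magnus f) (replicate n i)"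
proof -
  let ?u = "j # replicate n i"
  have "int (p ^ m) dvd (if ?u \<noteq> [] \<and> last ?u = j then nc_coeff (magnus f) (butlast ?u) else 0)
    - (if ?u \<noteq> [] \<and> hd ?u = j then nc_coeff (magnus f) (tl ?u) else 0)"
  proof (rule central_magnus_coeff[OF f ij(2)])
    show "length ?u \<le> p + 1" using n by simp
    fix k l assume k: "k \<in> {1..r}" "1 \<le> l" "l \<le> count (mset ?u) k"
    have "count (mset ?u) k = (if k = j then 1 else if k = i then n else 0)"
      using ij by simp
    then consider "k = j" "l = 1" | "k = i" "l \<le> n"
      using k by (auto split: if_splits)
    then show "int (p ^ m) dvd int (p ^ \<alpha> k choose l)"
    proof cases
      case 1
      then show ?thesis
        using m le_imp_power_dvd[of m "\<alpha> j" "int p"] by (simp add: One_nat_def)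
    next
      case 2
      then show ?thesis using n(3) k by simp
    qed
  qed
  moreover have "last ?u = i" using n(1) by (cases n) (auto simp: replicate_append_same[symmetric])
  ultimately show ?thesis using ij by simp
qed

lemma central_coeff_singleton:
  assumes "i \<in> {1..r}" "j \<in> {1..r}" "i \<noteq> j" "m \<le> \<alpha> i" "m \<le> \<alpha> j"
  shows "int (p ^ m) dvd nc_coeff (magnus f) [i]"
proof -
  have "int (p ^ m) dvd nc_coeff (magnus f) (replicate 1 i)"
  proof (rule central_coeff_replicate[OF assms(1-3,5)])
    show "int (p ^ m) dvd int (p ^ \<alpha> i choose l)" if "1 \<le> l" "l \<le> 1" for l
      using that prime_gt_1_nat[OF prime_p] by (intro power_dvd_ord_choose assms) simp_all
  qed (use prime_ge_1_nat[OF prime_p] in simp_all)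
  then show ?thesis by (simp add: One_nat_def)
qed

lemma central_exponent:
  assumes "i \<in> {1..r}" "i < r"
  shows "int (p ^ \<alpha> i) dvd nc_coeff (magnus f) [i]"
  using assms by (intro central_coeff_singleton[of i r]) (auto intro: \<alpha>_mono)

text \<open>Class \<open>p + 1\<close> still controls words of length \<open>p + 1\<close>, so the
  coefficient at \<open>p\<close> copies of \<open>r\<close> is divisible by
  \<open>p ^ \<alpha> (r - 1)\<close> when \<open>\<alpha> (r - 1) < \<alpha> r\<close>. It is the
  binomial coefficient of the exponent sum over \<open>p\<close>, which yields one more factor
  \<open>p\<close> in that sum.\<close>

lemma central_last_exponent:
  "int (p ^ \<alpha> r) dvd nc_coeff (magnus f) [r] \<or> int (p ^ Suc (\<alpha> (r - 1))) dvd nc_coeff (magnus f) [r]"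
proof -
  have r: "r \<in> {1..r}" "r - 1 \<in> {1..r}" "r \<noteq> r - 1" using r_ge_2 by auto
  have le: "\<alpha> (r - 1) \<le> \<alpha> r" using r by (intro \<alpha>_mono) auto
  have 1: "int (p ^ \<alpha> (r - 1)) dvd nc_coeff (magnus f) [r]"
    using r le by (intro central_coeff_singleton[of r "r - 1"]) auto
  show ?thesis
  proof (cases "\<alpha> (r - 1) = \<alpha> r")
    case True
    then show ?thesis using 1 by simp
  next
    case False
    then have lt: "Suc (\<alpha> (r - 1)) \<le> \<alpha> r" using le by simp
    have "int (p ^ \<alpha> (r - 1)) dvd nc_coeff (magnus f) (replicate p r)"
      by (rule central_coeff_replicate[OF r order_refl _ order_refl power_dvd_ord_choose_Suc[OF r(1) lt]])
        (use prime_ge_1_nat[OF prime_p] in simp_all)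
    then have "int (p ^ Suc (\<alpha> (r - 1))) dvd nc_coeff (magnus f) [r]"
      using prime_power_Suc_dvd_of_falling[OF prime_p \<alpha>_pos[OF r(2)] 1 _ magnus_coeff_replicate] by blast
    then show ?thesis by simp
  qed
qed

text \<open>Commuting with a letter \<open>j\<close> of \<open>u\<close> other than the first gives the coefficient at once, unless \<open>u\<close>
  is \<open>h\<close> followed by \<open>p - 1\<close> copies of \<open>j\<close>; then one has to commute with \<open>h\<close> twice.\<close>

lemma central_coeff_word:
  assumes u: "set u \<subseteq> {1..r}" "length u \<le> p" "2 \<le> card (set u)" and p: "p \<noteq> 2"
    and m: "\<And>i. i \<in> set u \<Longrightarrow> m \<le> \<alpha> i"
  shows "int (p ^ m) dvd nc_coeff (magnus f) u"
proof -
  have p3: "3 \<le> p" using prime_ge_2_nat[OF prime_p] p by simp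
  have dvd: "int (p ^ m) dvd (if last v = j then nc_coeff (magnus f) (butlast v) else 0)
      - (if hd v = j then nc_coeff (magnus f) (tl v) else 0)"
    if v: "set v \<subseteq> set u" "length v \<le> p + 1" "v \<noteq> []" "j \<in> set u"
      and c: "\<And>i. i \<in> set u \<Longrightarrow> count (mset v) i < p" for v j
  proof -
    have "int (p ^ m) dvd (if v \<noteq> [] \<and> last v = j then nc_coeff (magnus f) (butlast v) else 0)
      - (if v \<noteq> [] \<and> hd v = j then nc_coeff (magnus f) (tl v) else 0)"
    proof (rule central_magnus_coeff[OF f])
      show "j \<in> {1..r}" using v u by blast
      fix i l assume i: "i \<in> {1..r}" "1 \<le> l" "l \<le> count (mset v) i"
      then have "i \<in> set v" by (metis count_mset_0_iff not_one_le_zero le_trans)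
      then have iu: "i \<in> set u" using v(1) by blast
      then have "l < p" using c[OF iu] i(3) by simp
      then show "int (p ^ m) dvd int (p ^ \<alpha> i choose l)"
        using power_dvd_ord_choose[OF i(1) m[OF iu] i(2)] by simp
    qed (rule v)
    then show ?thesis using v(3) by simp
  qed
  have "u \<noteq> []" using u(3) by auto
  then obtain h t where ht: "u = h # t" by (cases u) auto
  have "\<exists>j \<in> set u. j \<noteq> h"
  proof (rule ccontr)
    assume "\<not> (\<exists>j \<in> set u. j \<noteq> h)"
    then have "set u \<subseteq> {h}" by blast
    then have "card (set u) \<le> card {h}" by (intro card_mono) simp_all
    then show False using u(3) by simp
  qed
  then obtain j where j: "j \<in> set u" "j \<noteq> h" by blast
  \<comment> \<open>Two different letters within length \<open>p\<close> keep each multiplicity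
    below \<open>p\<close>, where the binomial coefficients retain the full power.\<close>
  have count_le: "count (mset u) i < p" if "i \<in> set u" for i
  proof -
    have "\<exists>k \<in> set u. k \<noteq> i" using j ht by (cases "i = h") auto
    then obtain k where k: "k \<in> set u" "k \<noteq> i" by blast
    have "count (mset u) i + count (mset u) k \<le> length u"
    proof -
      have "sum (count (mset u)) {i, k} \<le> sum (count (mset u)) (set u)"
        using that k by (intro sum_mono2) auto
      then show ?thesis using k size_multiset_overloaded_eq[of "mset u"] by simp
    qed
    moreover have "1 \<le> count (mset u) k" using k(1) by (simp add: Suc_le_eq One_nat_def)
    ultimately show ?thesis using u(2) by linarith
  qed
  show ?thesis
  \<comment> \<open>Appending \<open>j\<close> has to keep its multiplicity below
    \<open>p\<close>.\<close>
  proof (cases "count (mset u) j < p - 1")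
    case True
    have "int (p ^ m) dvd (if last (u @ [j]) = j then nc_coeff (magnus f) (butlast (u @ [j])) else 0)
      - (if hd (u @ [j]) = j then nc_coeff (magnus f) (tl (u @ [j])) else 0)"
      by (rule dvd) (use j u True count_le in auto)
    then show ?thesis using ht j by simp
  next
    case False
    have tl: "length t \<le> p - 1" using u(2) ht by simp
    have "count (mset t) j = count (mset u) j" using ht j by simp
    then have "length t \<le> count (mset t) j" using False tl by simp
    moreover have "count (mset t) j \<le> length t" by (simp add: count_mset count_le_length)
    ultimately have cj: "count (mset t) j = length t" by simp
    have tj: "i = j" if "i \<in> set t" for i
    proof (rule ccontr)
      assume "i \<noteq> j"
      have "count (mset t) j < length t"
        using that \<open>i \<noteq> j\<close> unfolding count_mset
        by (induction t) (auto simp: count_le_length less_Suc_eq_le)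
      then show False using cj by simp
    qed
    have lt: "length t = p - 1" using False cj tl ht j by simp
    then have t: "t \<noteq> []" "hd t = j" using tj p3 by (cases t; force)+
    \<comment> \<open>Here \<open>h\<close> occurs twice, so \<open>2 < p\<close> is required. This
      is why \<open>p = 2\<close> is treated separately.\<close>
    have c2: "count (mset (t @ [h, h])) i < p" "count (mset (u @ [h])) i < p" if "i \<in> set u" for i
    proof -
      have "count (mset t) h = 0" using tj j by (metis count_mset_0_iff)
      moreover have "i = h \<or> i = j" using that ht tj by auto
      ultimately show "count (mset (t @ [h, h])) i < p" "count (mset (u @ [h])) i < p"
        using j cj lt p3 ht by (auto simp: count_mset_0_iff[THEN iffD2])
    qed
    \<comment> \<open>At \<open>u @ [h]\<close>, commuting with \<open>h\<close> compares
      \<open>u\<close> with the word whose \<open>h\<close> has moved from the front to the back; at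
      \<open>t @ [h, h]\<close> only the last \<open>h\<close> can be removed, since
      \<open>t\<close> begins with \<open>j\<close>.\<close>
    have 1: "int (p ^ m) dvd (if last (u @ [h]) = h then nc_coeff (magnus f) (butlast (u @ [h])) else 0)
      - (if hd (u @ [h]) = h then nc_coeff (magnus f) (tl (u @ [h])) else 0)"
      by (rule dvd) (use ht u c2 in auto)
    have 2: "int (p ^ m) dvd (if last (t @ [h, h]) = h then nc_coeff (magnus f) (butlast (t @ [h, h])) else 0)
      - (if hd (t @ [h, h]) = h then nc_coeff (magnus f) (tl (t @ [h, h])) else 0)"
      by (rule dvd) (use ht lt p3 c2 in auto)
    have "int (p ^ m) dvd nc_coeff (magnus f) u - nc_coeff (magnus f) (t @ [h])"
      using 1 ht by simp
    moreover have "int (p ^ m) dvd nc_coeff (magnus f) (t @ [h])"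
      using 2 t j by (simp add: butlast_append)
    ultimately show ?thesis by (metis dvd_diffD1 dvd_add diff_add_cancel)
  qed
qed

text \<open>The sixth condition of \<open>square_ideal\<close> for the commutator with
  \<open>nc_X i\<close> involves the coefficients of \<open>magnus f\<close> at \<open>[j]\<close>,
  \<open>[i, j]\<close> and \<open>[j, j]\<close>. The first and last vanish because
  \<open>f\<close> has exponent sum \<open>0\<close> in \<open>j\<close>; the weight
  \<open>2\<close> of the middle one cancels against the doubled modulus.\<close>

lemma central_coeff_word_2:
  assumes p: "p = 2" and f2: "f \<in> lcs F 2" and ij: "i \<in> {1..r}" "j \<in> {1..r}" "i \<noteq> j"
    and m: "1 \<le> m" "m \<le> \<alpha> i" "m \<le> \<alpha> j"
  shows "int (p ^ m) dvd nc_coeff (magnus f) [i, j]"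
proof -
  have "magnus f * nc_X i - nc_X i * magnus f \<in> square_ideal i j m"
  proof (rule central_commutes_mod_ideal[OF square_ideal_ideal _ _ f ij(1)])
    fix P assume "nc_order_ge (p + 1 + 1) P"
    then have "nc_coeff P u = 0" if "length u \<le> 3" for u
      using that p by (simp add: nc_order_ge_def)
    then show "P \<in> square_ideal i j m" by (simp add: square_ideal_def)
  next
    fix k assume "k \<in> {1..r}"
    show "(1 + nc_X k) ^ p ^ \<alpha> k - 1 \<in> square_ideal i j m"
      using p m by (intro square_ideal_power[OF ij(3) m(1)]) (auto intro: le_imp_power_dvd)
  qed
  then have d: "2 * 2 ^ m dvd - nc_coeff (magnus f) [j]
      - (2 * nc_coeff (magnus f) [i, j] + 2 * nc_coeff (magnus f) [j, j])"
    using ij(3) by (auto simp: square_ideal_def nc_coeff_mult_X nc_coeff_X_mult algebra_simps)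
  have 1: "nc_coeff (magnus f) [j] = 0"
    using F.coeff_M_lcs_eq_0[OF _ f2] by simp
  have 2: "nc_coeff (magnus f) [j, j] = 0"
    using magnus_coeff_replicate[of 2 f j] 1 by (simp add: numeral_2_eq_2 falling_def)
  have "2 * (2::int) ^ m dvd 2 * nc_coeff (magnus f) [i, j]"
    using d 1 2 by simp
  then show ?thesis using p by simp
qed

end

text \<open>In weight at least \<open>2\<close> a multidegree with a single letter contributes nothing, hence the exponent \<open>1\<close>.\<close>

definition weight_exponent :: "nat \<Rightarrow> nat multiset \<Rightarrow> nat" where
  "weight_exponent w d = (if w = 1 \<or> 2 \<le> card (set_mset d) then p ^ Min (\<alpha> ` set_mset d) else 1)"

lemma weight_exponent_torsion:
  assumes u: "u \<in> words {1..r} w" and w: "1 \<le> w"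
  shows "foldl (gcomm G) (x (hd u)) (map x (tl u)) [^]\<^bsub>G\<^esub> weight_exponent w (mset u) \<in> lcs G (Suc w)"
proof -
  obtain h t where ht: "u = h # t" "length u = w" "set u \<subseteq> {1..r}"
    using u w by (cases u) (auto simp: words_def)
  have cl: "set (x h # map x t) \<subseteq> carrier G" using ht x_closed by auto
  show ?thesis
  proof (cases "w = 1 \<or> 2 \<le> card (set u)")
    case True
    have "Min (\<alpha> ` set u) \<in> \<alpha> ` set u" using ht by (intro Min_in) auto
    then obtain b where b: "b \<in> set u" "Min (\<alpha> ` set u) = \<alpha> b" by auto
    have "foldl (gcomm G) (x h) (map x t) [^]\<^bsub>G\<^esub> (p ^ \<alpha> b) \<in> lcs G (Suc (Suc (length (map x t))))"
    proof (rule q.H.foldl_gcomm_pow_in_lcs[OF cl])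
      show "x b \<in> set (x h # map x t)" using b ht by auto
      show "x b [^]\<^bsub>G\<^esub> (p ^ \<alpha> b) = \<one>\<^bsub>G\<^esub>" using b ht by (intro x_pow) auto
    qed
    then show ?thesis using True b ht by (auto simp: weight_exponent_def)
  next
    case False
    \<comment> \<open>With a single letter in weight at least \<open>2\<close>, the innermost
      commutator is that of an element with itself.\<close>
    then have "t \<noteq> []" using ht by (auto simp: One_nat_def)
    then obtain h' t' where t: "t = h' # t'" by (cases t) auto
    have "h' = h"
    proof (rule ccontr)
      assume "h' \<noteq> h"
      then have "card {h, h'} \<le> card (set u)" using ht t by (intro card_mono) auto
      then show False using False \<open>h' \<noteq> h\<close> by simp
    qed
    then have "foldl (gcomm G) (x h) (map x t) = foldl (gcomm G) \<one>\<^bsub>G\<^esub> (map x t')"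
      using t cl by simp
    also have "\<dots> = \<one>\<^bsub>G\<^esub>" using cl t by (intro q.H.foldl_gcomm_one) simp
    finally show ?thesis using ht by simp
  qed
qed

lemma central_lcs_step:
  assumes z: "z \<in> center G" "z \<in> lcs G w" and w: "2 \<le> w" "w \<le> p"
  shows "z \<in> lcs G (Suc w)"
proof -
  \<comment> \<open>The lift is taken in \<open>lcs F w\<close>, where the Dynkin criterion
    applies.\<close>
  obtain f where f: "f \<in> lcs F w" "z = q f"
    using z(2) q.image_lcs[OF nil_proj_hom(2), of w] by blast
  have fc: "f \<in> carrier F" "q f \<in> center G" using f z(1) by simp_all
  have w1: "1 \<le> w" using w by simp
  show ?thesis
    unfolding f(2)
  proof (rule F.dynkin_criterion_lcs[OF q.group_hom_axioms nil_proj_hom(2) w1 f(1) weight_exponent_torsion[OF _ w1]])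
    fix u assume u: "u \<in> words {1..r} w"
    then have uI: "set u \<subseteq> {1..r}" "length u = w" "u \<noteq> []" using w by (auto simp: words_def)
    show "int (weight_exponent w (mset u)) dvd nc_coeff (magnus f) u"
    proof (cases "2 \<le> card (set u)")
      case True
      let ?m = "Min (\<alpha> ` set u)"
      have m: "?m \<le> \<alpha> i" if "i \<in> set u" for i using that by (intro Min_le) auto
      have "int (p ^ ?m) dvd nc_coeff (magnus f) u"
      proof (cases "p = 2")
        case False
        then show ?thesis using uI w True m by (intro central_coeff_word[OF fc]) auto
      next
        case p2: True
        then have w2: "w = 2" using w by simp
        then obtain i j where ij: "u = [i, j]"
          using uI by (auto simp: length_Suc_conv numeral_2_eq_2)
        have "i \<noteq> j" using True ij by auto
        have "?m \<in> \<alpha> ` set u" using uI by (intro Min_in) auto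
        then have "1 \<le> ?m" using uI \<alpha>_pos by auto
        then show ?thesis
          unfolding ij using uI ij m \<open>i \<noteq> j\<close> f(1) w2
          by (intro central_coeff_word_2[OF fc p2]) auto
      qed
      then show ?thesis using True by (simp add: weight_exponent_def)
    next
      case False
      then show ?thesis using w by (simp add: weight_exponent_def)
    qed
    show "\<exists>k\<in>set u. coprime (count (mset u) k) (weight_exponent w (mset u))"
    proof (cases "2 \<le> card (set u)")
      case True
      obtain k where k: "k \<in> set u" using uI(3) by (cases u) auto
      have "set u \<noteq> {k}" using True by auto
      then obtain k' where k': "k' \<in> set u" "k' \<noteq> k" using k by blast
      \<comment> \<open>The second letter \<open>k'\<close> makes the multiplicity of
        \<open>k\<close> smaller than \<open>w\<close>, hence smaller than \<open>p\<close> and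
        prime to it. This is where \<open>w \<le> p\<close> enters.\<close>
      have "sum (count (mset u)) {k, k'} \<le> sum (count (mset u)) (set u)"
        using k k' by (intro sum_mono2) auto
      then have "count (mset u) k + count (mset u) k' \<le> w"
        using k' uI(2) size_multiset_overloaded_eq[of "mset u"] by simp
      moreover have "0 < count (mset u) k'" "0 < count (mset u) k" using k k' by simp_all
      ultimately have "\<not> p dvd count (mset u) k" using w by (intro nat_dvd_not_less) linarith+
      then have "coprime (count (mset u) k) p"
        using prime_imp_coprime[OF prime_p] by (metis coprime_commute)
      then show ?thesis using k by (auto simp: weight_exponent_def)
    next
      case False
      moreover obtain k where "k \<in> set u" using uI(3) by (cases u) auto
      ultimately show ?thesis using w by (auto simp: weight_exponent_def)
    qed
  qed
qed

lemma central_in_lcs: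
  assumes "z \<in> center G" "z \<in> lcs G 2"
  shows "z \<in> lcs G (p + 1)"
proof -
  have "z \<in> lcs G w" if "2 \<le> w" "w \<le> p + 1" for w
    using that
  proof (induction w rule: dec_induct)
    case (step w)
    then show ?case using assms(1) by (intro central_lcs_step) simp_all
  qed (rule assms)
  then show ?thesis using prime_ge_2_nat[OF prime_p] by simp
qed

lemma center_subset:
  "center G \<subseteq> generate G ({x r [^]\<^bsub>G\<^esub> (p ^ (\<alpha> (r - 1) + 1))} \<union> lcs G (p + 1))"
proof
  fix z assume z: "z \<in> center G"
  let ?y = "x r [^]\<^bsub>G\<^esub> (p ^ (\<alpha> (r - 1) + 1))"
  let ?Y = "generate G ({?y} \<union> lcs G (p + 1))"
  have r: "r \<in> {1..r}" using r_ge_2 by simp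
  have "{?y} \<union> lcs G (p + 1) \<subseteq> carrier G" using x_closed[OF r] by auto
  then interpret Y: subgroup ?Y G by (rule q.H.generate_is_subgroup)
  obtain f where f: "f \<in> carrier F" "z = q f"
    using z nil_proj_hom(2)[of "\<lambda>i. p ^ \<alpha> i" r "p + 1"] unfolding center_def by blast
  have fc: "q f \<in> center G" using f z by simp
  \<comment> \<open>The exponent sum of the letter \<open>r\<close> in \<open>f\<close>. Dividing by
    this power of \<open>x r\<close> leaves a central element whose exponent sum in \<open>r\<close>
    is \<open>0\<close>.\<close>
  define e where "e = nc_coeff (magnus f) [r]"
  define g where "g = free_gen r [^]\<^bsub>F\<^esub> e"
  have gr: "free_gen r \<in> carrier F" using r by (rule free_gen_carrier)
  have g: "g \<in> carrier F" "q g = x r [^]\<^bsub>G\<^esub> e"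
    using gr q.hom_int_pow[OF gr] by (simp_all add: g_def)
  have "q g \<in> ?Y"
  proof -
    consider "int (p ^ \<alpha> r) dvd e" | "int (p ^ Suc (\<alpha> (r - 1))) dvd e"
      using central_last_exponent[OF f(1) fc] unfolding e_def by blast
    then show ?thesis
    proof cases
      case 1
      then obtain c where "e = int (p ^ \<alpha> r) * c" by blast
      then have "x r [^]\<^bsub>G\<^esub> e = (x r [^]\<^bsub>G\<^esub> int (p ^ \<alpha> r)) [^]\<^bsub>G\<^esub> c"
        using q.H.int_pow_pow[OF x_closed[OF r]] by simp
      also have "x r [^]\<^bsub>G\<^esub> int (p ^ \<alpha> r) = \<one>\<^bsub>G\<^esub>"
        using x_pow[OF r] by (simp only: int_pow_int)
      finally show ?thesis using g(2) Y.one_closed by simp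
    next
      case 2
      then obtain c where "e = int (p ^ (\<alpha> (r - 1) + 1)) * c" unfolding Suc_eq_plus1 by blast
      then have "x r [^]\<^bsub>G\<^esub> e = (x r [^]\<^bsub>G\<^esub> int (p ^ (\<alpha> (r - 1) + 1))) [^]\<^bsub>G\<^esub> c"
        using q.H.int_pow_pow[OF x_closed[OF r]] by simp
      also have "\<dots> = ?y [^]\<^bsub>G\<^esub> c" by (simp only: int_pow_int)
      also have "\<dots> \<in> ?Y"
        by (rule q.H.subgroup_int_pow_closed[OF Y.subgroup_axioms]) (simp add: generate.incl)
      finally show ?thesis using g(2) by simp
    qed
  qed
  \<comment> \<open>Centrality of \<open>q g\<close> makes \<open>q h\<close> central again, so that
    the coefficient congruences apply to \<open>h\<close>.\<close>
  moreover have "{?y} \<union> lcs G (p + 1) \<subseteq> center G"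
    using last_gen_pow_center lcs_center by simp
  then have "?Y \<subseteq> center G" by (rule q.H.generate_subgroup_incl[OF _ center_subgroup])
  ultimately have gc: "q g \<in> center G" by blast
  define h where "h = f \<otimes>\<^bsub>F\<^esub> inv\<^bsub>F\<^esub> g"
  have h: "h \<in> carrier F" "q h = q f \<otimes>\<^bsub>G\<^esub> inv\<^bsub>G\<^esub> q g"
    using f g by (simp_all add: h_def)
  have hc: "q h \<in> center G"
    unfolding h(2) using fc gc center_subgroup by (simp add: subgroup.m_closed subgroup.m_inv_closed)
  \<comment> \<open>The same criterion handles weight \<open>1\<close>: the letters
    \<open>i < r\<close> are covered by \<open>central_exponent\<close>, the letter \<open>r\<close>
    by the choice of \<open>e\<close>.\<close>
  have "q h \<in> lcs G (Suc 1)"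
  proof (rule F.dynkin_criterion_lcs[OF q.group_hom_axioms nil_proj_hom(2) order_refl _ weight_exponent_torsion[OF _ order_refl]])
    show "h \<in> lcs F 1" using h by (simp add: One_nat_def)
    fix u assume "u \<in> words {1..r} 1"
    then obtain i where u: "u = [i]" and i: "i \<in> {1..r}"
      by (auto simp: words_def One_nat_def length_Suc_conv)
    show "int (weight_exponent 1 (mset u)) dvd nc_coeff (magnus h) u"
    proof (cases "i = r")
      case True
      have "nc_coeff (magnus (inv\<^bsub>F\<^esub> g)) [r] = - nc_coeff (magnus g) [r]"
        using g F.coeff_M_lcs_inv[of 1 g "[r]"] by (simp add: One_nat_def)
      moreover have "nc_coeff (magnus g) [r] = e"
        unfolding g_def F.coeff_M_singleton_pow[OF gr]
        by (simp add: F.M_gen[OF r] nc_coeff_1 nc_coeff_X)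
      ultimately have "nc_coeff (magnus h) [r] = 0"
        using f g by (simp add: h_def F.coeff_M_singleton_mult e_def)
      then show ?thesis using u True by simp
    next
      case False
      then have "int (p ^ \<alpha> i) dvd nc_coeff (magnus h) [i]"
        using i by (intro central_exponent[OF h(1) hc]) auto
      then show ?thesis using u by (simp add: weight_exponent_def)
    qed
    show "\<exists>k\<in>set u. coprime (count (mset u) k) (weight_exponent 1 (mset u))"
      using u by simp
  qed
  then have "q h \<in> lcs G (p + 1)"
    using central_in_lcs[OF hc] by (simp add: One_nat_def numeral_2_eq_2)
  then have "q h \<in> ?Y" by (simp add: generate.incl)
  moreover have "z = q h \<otimes>\<^bsub>G\<^esub> q g"
    unfolding f(2) h(2) using q.hom_closed[OF f(1)] q.hom_closed[OF g(1)] by (simp add: q.H.m_assoc)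
  ultimately show "z \<in> ?Y" using Y.m_closed[OF _ \<open>q g \<in> ?Y\<close>] by metis
qed

theorem center_eq:
  "center G = generate G ({x r [^]\<^bsub>G\<^esub> (p ^ (\<alpha> (r - 1) + 1))} \<union> lcs G (p + 1))"
proof
  show "generate G ({x r [^]\<^bsub>G\<^esub> (p ^ (\<alpha> (r - 1) + 1))} \<union> lcs G (p + 1)) \<subseteq> center G"
    using last_gen_pow_center lcs_center by (intro q.H.generate_subgroup_incl center_subgroup) simp
qed (rule center_subset)

end

theorem theorem2p4:
  fixes p r :: nat and \<alpha> :: "nat \<Rightarrow> nat"
    and G :: "word set set monoid" and x :: "nat \<Rightarrow> word set set"
  assumes "Factorial_Ring.prime p"
    and "2 \<le> r"
    and "\<forall>i \<in> {1..r}. 1 \<le> \<alpha> i"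
    and "\<forall>i \<in> {1..r}. \<forall>j \<in> {1..r}. i \<le> j \<longrightarrow> \<alpha> i \<le> \<alpha> j"
  defines "G \<equiv> cyc_nil_product (\<lambda>i. p ^ \<alpha> i) r (p + 1)"
    and "x \<equiv> cyc_nil_gen (\<lambda>i. p ^ \<alpha> i) r (p + 1)"
  shows "center G =
           generate G ({x r [^]\<^bsub>G\<^esub> (p ^ (\<alpha> (r - 1) + 1))} \<union> lcs G (p + 1))"
proof -
  interpret p_cyclic_product p r \<alpha>
    using assms(1-4) by unfold_locales auto
  show ?thesis
    unfolding G_def x_def using center_eq by (simp only: nil_proj_gen)
qed

end
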